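(* Let $n\ge 2$ be an integer and let $\alpha\in\mathrm{Aut}(\mathcal D_n)$. Then the following conditions are equivalent: (1) $\alpha^{-1}$ has property (P); (2) there exists a permutation unitary $u\in\mathcal P_n$ such that $\alpha=\lambda_u|_{\mathcal D_n}$. In this case, $\alpha$ extends to an endomorphism of $\mathcal F_n$, and both $\alpha$ and $\alpha^{-1}$ are $\tau$-preserving (i.e. $\tau\alpha=\tau=\tau\alpha^{-1}$ on $\mathcal D_n$).
   Context: Let $n\ge 2$. $\mathcal O_n$ is the Cuntz algebra, the $C^*$-algebra generated by isometries $S_1,\dots,S_n$ with $\sum_{i=1}^n S_iS_i^*=1$. For $k\ge 0$, $W_n^k$ is the set of words $\mu=(\mu_1,\dots,\mu_k)$ with letters in $\{1,\dots,n\}$, $S_\mu=S_{\mu_1}\cdots S_{\mu_k}$ (and $S_\emptyset=1$), $P_\mu=S_\mu S_\mu^*$. $\mathcal F_n^k=\mathrm{span}\{S_\mu S_\nu^*:\mu,\nu\in W_n^k\}\cong M_{n^k}(\mathbb C)$, and $\mathcal F_n=\overline{\bigcup_k\mathcal F_n^k}$ is the core UHF-subalgebra, with unique normalized trace $\tau$. $\mathcal D_n$ (the diagonal) is the $C^*$-subalgebra generated by all $P_\mu$, and $\mathcal D_n^k=\mathrm{span}\{P_\mu:\mu\in W_n^k\}$. $\mathcal P_n=\bigcup_k\mathcal P_n^k$, where $\mathcal P_n^k$ is the set of unitaries $\sum_{\mu\in W_n^k}S_{\sigma(\mu)}S_\mu^*$ with $\sigma$ a permutation of $W_n^k$. For a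 unitary $u\in\mathcal O_n$, $\lambda_u$ is the unital $*$-endomorphism of $\mathcal O_n$ with $\lambda_u(S_i)=uS_i$ for all $i$. The canonical shift is $\varphi(x)=\sum_{i=1}^n S_ixS_i^*$; it restricts to an endomorphism of $\mathcal D_n$ (with $\varphi^0=\mathrm{id}$). An automorphism $\alpha$ of $\mathcal D_n$ has property (P) if there is an integer $m\ge 0$ such that $\alpha\varphi^k(x)=\varphi^{k-m}\alpha\varphi^m(x)$ for all $k\ge m$ and all $x\in\mathcal D_n^1$. *)

theory Defs
  imports "HOL-Analysis.Analysis"
begin

section \<open>C*-algebras\<close>

text \<open>Unital nonzero complex C*-algebras. The library's algebra classes carry real scalars only,
  so the complex scalar multiplication is added and required to extend the real one.\<close>

class cstar_algebra = real_normed_algebra_1 + complete_space +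
  fixes scaleC :: "complex \<Rightarrow> 'a \<Rightarrow> 'a"  (infixr "*\<^sub>C" 75)
    and adj :: "'a \<Rightarrow> 'a"
  assumes scaleC_add_right: "c *\<^sub>C (x + y) = c *\<^sub>C x + c *\<^sub>C y"
    and scaleC_add_left: "(c + d) *\<^sub>C x = c *\<^sub>C x + d *\<^sub>C x"
    and scaleC_scaleC: "c *\<^sub>C d *\<^sub>C x = (c * d) *\<^sub>C x"
    and scaleC_of_real: "complex_of_real r *\<^sub>C x = r *\<^sub>R x"
    and scaleC_mult_left: "(c *\<^sub>C x) * y = c *\<^sub>C (x * y)"
    and scaleC_mult_right: "x * (c *\<^sub>C y) = c *\<^sub>C (x * y)"
    and norm_scaleC: "norm (c *\<^sub>C x) = cmod c * norm x"
    and adj_add: "adj (x + y) = adj x + adj y"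
    and adj_scaleC: "adj (c *\<^sub>C x) = cnj c *\<^sub>C adj x"
    and adj_mult: "adj (x * y) = adj y * adj x"
    and adj_adj: "adj (adj x) = x"
    and cstar_identity: "norm (adj x * x) = (norm x)\<^sup>2"

definition cstar_subalgebra :: "'a::cstar_algebra set \<Rightarrow> bool" where
  "cstar_subalgebra B \<longleftrightarrow>
     closed B \<and> 0 \<in> B \<and>
     (\<forall>x\<in>B. \<forall>y\<in>B. x + y \<in> B \<and> x * y \<in> B) \<and>
     (\<forall>c. \<forall>x\<in>B. c *\<^sub>C x \<in> B) \<and>
     (\<forall>x\<in>B. adj x \<in> B)"

text \<open>Maps between C*-subalgebras are functions on the ambient type whose values outside the
  domain are irrelevant. No continuity is required: it is automatic for *-homomorphisms.\<close>

definition star_hom :: "'a::cstar_algebra set \<Rightarrow> 'b::cstar_algebra set \<Rightarrow> ('a \<Rightarrow> 'b) \<Rightarrow> bool" where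
  "star_hom B C f \<longleftrightarrow>
     f ` B \<subseteq> C \<and>
     (\<forall>x\<in>B. \<forall>y\<in>B. f (x + y) = f x + f y \<and> f (x * y) = f x * f y) \<and>
     (\<forall>c. \<forall>x\<in>B. f (c *\<^sub>C x) = c *\<^sub>C f x) \<and>
     (\<forall>x\<in>B. f (adj x) = adj (f x))"

definition unital_star_endo :: "'a::cstar_algebra set \<Rightarrow> ('a \<Rightarrow> 'a) \<Rightarrow> bool" where
  "unital_star_endo B f \<longleftrightarrow> star_hom B B f \<and> f 1 = 1"

definition star_auto :: "'a::cstar_algebra set \<Rightarrow> ('a \<Rightarrow> 'a) \<Rightarrow> bool" where
  "star_auto B f \<longleftrightarrow> star_hom B B f \<and> bij_betw f B B"

section \<open>The Cuntz algebra\<close>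

text \<open>The whole type is the C*-algebra generated by \<open>S 1, \<dots>, S n\<close>. By Cuntz's uniqueness theorem
  this determines it up to isomorphism when \<open>n \<ge> 2\<close>.\<close>

definition cuntz_algebra :: "nat \<Rightarrow> (nat \<Rightarrow> 'a::cstar_algebra) \<Rightarrow> bool" where
  "cuntz_algebra n S \<longleftrightarrow>
     (\<forall>i\<in>{1..n}. adj (S i) * S i = 1) \<and>
     (\<Sum>i=1..n. S i * adj (S i)) = 1 \<and>
     cstar_subalgebra hull (S ` {1..n}) = UNIV"

definition words :: "nat \<Rightarrow> nat \<Rightarrow> nat list set" where
  "words n k = {\<mu>. length \<mu> = k \<and> set \<mu> \<subseteq> {1..n}}"

definition S_word :: "(nat \<Rightarrow> 'a::cstar_algebra) \<Rightarrow> nat list \<Rightarrow> 'a" where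
  "S_word S \<mu> = prod_list (map S \<mu>)"

definition P_word :: "(nat \<Rightarrow> 'a::cstar_algebra) \<Rightarrow> nat list \<Rightarrow> 'a" where
  "P_word S \<mu> = S_word S \<mu> * adj (S_word S \<mu>)"

definition core_level :: "nat \<Rightarrow> (nat \<Rightarrow> 'a::cstar_algebra) \<Rightarrow> nat \<Rightarrow> 'a set" where
  "core_level n S k =
     range (\<lambda>c. \<Sum>\<mu>\<in>words n k. \<Sum>\<nu>\<in>words n k. c \<mu> \<nu> *\<^sub>C (S_word S \<mu> * adj (S_word S \<nu>)))"

definition core :: "nat \<Rightarrow> (nat \<Rightarrow> 'a::cstar_algebra) \<Rightarrow> 'a set" where
  "core n S = closure (\<Union>k. core_level n S k)"

definition diagonal_level :: "nat \<Rightarrow> (nat \<Rightarrow> 'a::cstar_algebra) \<Rightarrow> nat \<Rightarrow> 'a set" where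
  "diagonal_level n S k = range (\<lambda>c. \<Sum>\<mu>\<in>words n k. c \<mu> *\<^sub>C P_word S \<mu>)"

definition diagonal :: "nat \<Rightarrow> (nat \<Rightarrow> 'a::cstar_algebra) \<Rightarrow> 'a set" where
  "diagonal n S = cstar_subalgebra hull (\<Union>k. P_word S ` words n k)"

definition perm_unitaries :: "nat \<Rightarrow> (nat \<Rightarrow> 'a::cstar_algebra) \<Rightarrow> 'a set" where
  "perm_unitaries n S =
     (\<Union>k. {\<Sum>\<mu>\<in>words n k. S_word S (\<sigma> \<mu>) * adj (S_word S \<mu>) | \<sigma>.
              bij_betw \<sigma> (words n k) (words n k)})"

text \<open>\<open>\<Lambda>\<close> is the endomorphism \<open>\<lambda>\<^sub>u\<close>; there is at most one such \<open>\<Lambda>\<close>, as the \<open>S i\<close> generate.\<close>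

definition is_lambda :: "nat \<Rightarrow> (nat \<Rightarrow> 'a::cstar_algebra) \<Rightarrow> 'a \<Rightarrow> ('a \<Rightarrow> 'a) \<Rightarrow> bool" where
  "is_lambda n S u \<Lambda> \<longleftrightarrow> unital_star_endo UNIV \<Lambda> \<and> (\<forall>i\<in>{1..n}. \<Lambda> (S i) = u * S i)"

definition shift :: "nat \<Rightarrow> (nat \<Rightarrow> 'a::cstar_algebra) \<Rightarrow> 'a \<Rightarrow> 'a" where
  "shift n S x = (\<Sum>i=1..n. S i * x * adj (S i))"

definition property_P :: "nat \<Rightarrow> (nat \<Rightarrow> 'a::cstar_algebra) \<Rightarrow> ('a \<Rightarrow> 'a) \<Rightarrow> bool" where
  "property_P n S \<alpha> \<longleftrightarrow>
     (\<exists>m. \<forall>k\<ge>m. \<forall>x\<in>diagonal_level n S 1.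
        \<alpha> ((shift n S ^^ k) x) = (shift n S ^^ (k - m)) (\<alpha> ((shift n S ^^ m) x)))"

text \<open>A normalized trace on the core is a tracial state. Only its values on the core matter, where
  it is unique.\<close>

definition normalized_trace :: "nat \<Rightarrow> (nat \<Rightarrow> 'a::cstar_algebra) \<Rightarrow> ('a \<Rightarrow> complex) \<Rightarrow> bool" where
  "normalized_trace n S \<tau> \<longleftrightarrow>
     (\<forall>x\<in>core n S. \<forall>y\<in>core n S. \<tau> (x + y) = \<tau> x + \<tau> y \<and> \<tau> (x * y) = \<tau> (y * x)) \<and>
     (\<forall>c. \<forall>x\<in>core n S. \<tau> (c *\<^sub>C x) = c * \<tau> x) \<and>
     (\<forall>x\<in>core n S. \<tau> (adj x * x) \<in> \<real>\<^sub>\<ge>\<^sub>0) \<and>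
     \<tau> 1 = 1"

end

theory Submission
  imports Defs "HOL-Real_Asymp.Real_Asymp"
begin

text \<open>
  Suppose \<open>\<alpha> = \<lambda>\<^sub>u\<close> on the diagonal with \<open>u\<close> of level \<open>K\<close>. Then
  \<open>\<lambda>\<^sub>u \<phi>\<^sup>l = Ad(v) \<phi>\<^sup>l \<lambda>\<^sub>u\<close> for a unitary \<open>v\<close> of level \<open>K + l\<close>, which commutes with the range of
  \<open>\<phi>\<^sup>K\<^sup>+\<^sup>l\<close>; this gives property (P) with \<open>m = K\<close>, and traciality gives the invariance of \<open>\<tau>\<close>.
  Conversely, property (P) of \<open>\<beta> = \<alpha>\<^sup>-\<^sup>1\<close> says that
  \<open>\<gamma>(y) = \<alpha>(\<Sum>\<^sub>i S\<^sub>i \<beta>(S\<^sub>i\<^sup>* y S\<^sub>i) S\<^sub>i\<^sup>*)\<close> fixes \<open>\<phi>\<^sup>k(x)\<close> for \<open>k > m\<close> and \<open>x\<close> of level 1. As projections of the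
  diagonal have finite level, \<open>\<gamma>\<close> permutes the minimal projections of some level and is \<open>Ad(u)\<close> for
  the corresponding permutation unitary, whence \<open>\<alpha>(P\<^sub>\<mu>) = \<lambda>\<^sub>u(P\<^sub>\<mu>)\<close> by induction on \<open>\<mu>\<close>.

  The existence of \<open>\<lambda>\<^sub>u\<close> is Cuntz's uniqueness theorem, which needs
  \<open>\<parallel>p(T)\<parallel> \<le> \<parallel>p(S)\<parallel>\<close> for *-polynomials \<open>p\<close> and Cuntz families \<open>S\<close>, \<open>T\<close>. Compressing with a
  suitable isometry bounds each homogeneous part of \<open>p\<close>, so the estimate holds up to a factor linear
  in the degree of \<open>p\<close>; applying it to \<open>(p\<^sup>*p)\<^sup>N\<close> with \<open>N = 2\<^sup>m\<close> and taking roots removes the factor.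
\<close>

subsection \<open>Norms, square roots and positivity\<close>

text \<open>Spectral arguments are replaced by two devices: the exponents \<open>2 ^ m\<close>, for
  which the C*-identity alone gives the norm of a power of a self-adjoint element, and square roots
  of \<open>1 - h\<close> for \<open>norm h < 1\<close>. They give continuity of homomorphisms and
  traces with non-optimal constants, which is all that limits of finite-level elements require. In
  the direction from (1) to (2) the unitary has to be recovered from the action on the diagonal
  alone. The inner sum of \<open>\<gamma>\<close> keeps the first letter of a word and applies
  \<beta> to the rest; applying \<alpha> then compares \<alpha> on a word with \<alpha> on its tail,
  and if \<alpha> is \<open>\<lambda>\<^sub>u\<close>, exactly conjugation by \<open>u\<close>
  remains. Since \<beta> is what acts on tails, (P) is the right condition for \<beta>. It controls
  only the letters far out. For the first letters finiteness takes over: the finitely many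
  projections \<open>\<gamma> (Pw \<mu>)\<close> with \<open>\<mu>\<close> of length
  \<open>m + 1\<close> share a level \<open>k\<close>, so level \<open>m + 1 + k\<close> is
  invariant.\<close>

lemma scaleC_0_left [simp]: "0 *\<^sub>C x = (0::'a::cstar_algebra)"
  using scaleC_of_real[of 0 x] by simp

lemma scaleC_1_left [simp]: "1 *\<^sub>C x = (x::'a::cstar_algebra)"
  using scaleC_of_real[of 1 x] by simp

lemma scaleC_minus1_left: "(-1) *\<^sub>C x = - (x::'a::cstar_algebra)"
  using scaleC_of_real[of "-1" x] by simp

lemma bounded_linear_scaleC: "bounded_linear (\<lambda>x::'a::cstar_algebra. c *\<^sub>C x)"
proof (rule bounded_linear_intro[of _ "cmod c"])
  show "c *\<^sub>C (r *\<^sub>R x) = r *\<^sub>R c *\<^sub>C x" for r and x :: 'a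
    by (metis scaleC_of_real scaleC_scaleC mult.commute)
qed (simp_all add: scaleC_add_right norm_scaleC)

lemma norm_adj [simp]: "norm (adj x) = norm (x::'a::cstar_algebra)"
proof -
  have le: "norm y \<le> norm (adj y)" for y :: 'a
  proof (cases "y = 0")
    case False
    have "norm y * norm y \<le> norm (adj y) * norm y"
      using norm_mult_ineq[of "adj y" y] by (simp add: cstar_identity power2_eq_square)
    with False show ?thesis by simp
  qed simp
  show ?thesis using le[of x] le[of "adj x"] by (simp add: adj_adj)
qed

lemma bounded_linear_adj: "bounded_linear (adj :: 'a::cstar_algebra \<Rightarrow> 'a)"
proof (rule bounded_linear_intro[of _ 1])
  show "adj (r *\<^sub>R x) = r *\<^sub>R adj x" for r and x :: 'a
    by (metis adj_scaleC scaleC_of_real complex_cnj_complex_of_real)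
qed (simp_all add: adj_add)

lemmas scaleC_0_right [simp] = linear_simps(3)[OF bounded_linear_scaleC]
  and scaleC_diff_right = linear_simps(2)[OF bounded_linear_scaleC]
  and adj_0 [simp] = linear_simps(3)[OF bounded_linear_adj]
  and adj_minus = linear_simps(4)[OF bounded_linear_adj]
  and adj_diff = linear_simps(2)[OF bounded_linear_adj]
  and adj_scaleR = linear_simps(5)[OF bounded_linear_adj]

lemma scaleC_sum_right: "c *\<^sub>C sum f A = (\<Sum>x\<in>A. c *\<^sub>C (f x :: 'a::cstar_algebra))"
  by (induction A rule: infinite_finite_induct) (simp_all add: scaleC_add_right)

lemma scaleC_sum_left: "sum c A *\<^sub>C x = (\<Sum>i\<in>A. c i *\<^sub>C (x :: 'a::cstar_algebra))"
  by (induction A rule: infinite_finite_induct) (simp_all add: scaleC_add_left)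

lemma adj_sum: "adj (sum f A) = (\<Sum>x\<in>A. adj (f x :: 'a::cstar_algebra))"
  by (induction A rule: infinite_finite_induct) (simp_all add: adj_add)

lemma adj_1 [simp]: "adj 1 = (1::'a::cstar_algebra)"
  by (metis adj_adj adj_mult mult_1_left)

lemma tendsto_adj: "(f \<longlongrightarrow> l) F \<Longrightarrow> ((\<lambda>x. adj (f x)) \<longlongrightarrow> adj (l::'a::cstar_algebra)) F"
  by (rule bounded_linear.tendsto[OF bounded_linear_adj])

lemma tendsto_scaleC: "(f \<longlongrightarrow> l) F \<Longrightarrow> ((\<lambda>x. c *\<^sub>C f x) \<longlongrightarrow> c *\<^sub>C (l::'a::cstar_algebra)) F"
  by (rule bounded_linear.tendsto[OF bounded_linear_scaleC])

lemma continuous_on_adj: "continuous_on A (adj :: 'a::cstar_algebra \<Rightarrow> 'a)"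
  by (rule bounded_linear.continuous_on[OF bounded_linear_adj continuous_on_id])

lemma adj_mult_self_eq_0: "adj x * x = 0 \<Longrightarrow> x = (0::'a::cstar_algebra)"
  using cstar_identity[of x] by simp

lemma norm_isometry: "adj w * w = 1 \<Longrightarrow> norm (w::'a::cstar_algebra) = 1"
  using cstar_identity[of w] by (simp add: abs_square_eq_1)

lemma norm_projection_le: "\<lbrakk>adj p = p; p * p = p\<rbrakk> \<Longrightarrow> norm (p::'a::cstar_algebra) \<le> 1"
  using cstar_identity[of p] by (auto simp: power2_eq_square)

lemma norm_projection_eq: "\<lbrakk>adj p = p; p * p = p; p \<noteq> 0\<rbrakk> \<Longrightarrow> norm (p::'a::cstar_algebra) = 1"
  using cstar_identity[of p] by (simp add: power2_eq_square)

text \<open>Squares of self-adjoint elements are self-adjoint, so the C*-identity can be iterated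
  along repeated squaring. This stands in for the spectral radius formula.\<close>

lemma norm_self_adjoint_power2:
  assumes "adj (h::'a::cstar_algebra) = h"
  shows "norm (h ^ 2 ^ m) = norm h ^ 2 ^ m"
proof -
  have "adj (h ^ 2 ^ m) = h ^ 2 ^ m \<and> norm (h ^ 2 ^ m) = norm h ^ 2 ^ m"
  proof (induction m)
    case 0
    then show ?case using assms by simp
  next
    case (Suc m)
    let ?k = "h ^ 2 ^ m"
    have eq: "h ^ 2 ^ Suc m = ?k * ?k"
      by (simp add: power_add[symmetric] mult_2)
    have "norm (?k * ?k) = (norm ?k)\<^sup>2"
      using cstar_identity[of ?k] Suc by simp
    then show ?case
      unfolding eq using Suc by (simp add: adj_mult power_mult[symmetric] mult.commute)
  qed
  then show ?thesis by simp
qed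

text \<open>Replacing an element by its powers turns an estimate with subexponential constant into the
  estimate with constant one.\<close>

lemma power_trick:
  fixes a b :: real
  assumes "a \<ge> 0" "b \<ge> 0" and le: "\<And>m. a ^ 2 ^ m \<le> (A * 2 ^ m + B) * b ^ 2 ^ m"
  shows "a \<le> b"
proof (rule ccontr)
  assume "\<not> a \<le> b"
  then have ab: "b < a" by simp
  show False
  proof (cases "b = 0")
    case True
    then show False using le[of 0] ab by simp
  next
    case False
    with assms have b: "b > 0" by simp
    define r where "r = a / b"
    have r: "r > 1" using ab b by (simp add: r_def)
    have up: "r ^ 2 ^ m \<le> A * 2 ^ m + B" for m
      using le[of m] b by (simp add: r_def power_divide divide_simps)
    \<comment> \<open>With \<open>r > 1\<close> the power \<open>r ^ 2 ^ m\<close> is exponential in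
      \<open>2 ^ m\<close> and outgrows the linear factor; the limit is taken over real
      \<open>x\<close> and then specialised to \<open>x = 2 ^ m\<close>.\<close>
    have "((\<lambda>x. (A * x + B) * exp (- ln r * x)) \<longlongrightarrow> 0) at_top"
      using r ln_gt_zero[OF r] by real_asymp
    moreover have "filterlim (\<lambda>m::nat. (2::real) ^ m) at_top sequentially"
      by real_asymp
    ultimately have "(\<lambda>m::nat. (A * 2 ^ m + B) * exp (- ln r * 2 ^ m)) \<longlonglongrightarrow> 0"
      by (rule filterlim_compose)
    then have "eventually (\<lambda>m. (A * 2 ^ m + B) * exp (- ln r * 2 ^ m) < 1) sequentially"
      by (rule order_tendstoD) simp
    then obtain m where m: "(A * 2 ^ m + B) * exp (- ln r * 2 ^ m) < 1"
      by (auto simp: eventually_sequentially)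
    have "exp (ln r * 2 ^ m) = r ^ 2 ^ m"
      using r exp_of_nat2_mult[of "ln r" "2^m"] by simp
    moreover from m have "A * 2 ^ m + B < exp (ln r * 2 ^ m)"
      by (simp add: exp_minus field_simps)
    ultimately have "A * 2 ^ m + B < r ^ 2 ^ m" by simp
    with up[of m] show False by simp
  qed
qed

text \<open>Orthogonality kills all mixed terms in powers of \<open>x + y\<close>, leaving
  \<open>x ^ N + y ^ N\<close> of norm at most \<open>2 * t ^ N\<close>; the power trick removes the
  2.\<close>

lemma norm_orthogonal_add_le:
  fixes x y :: "'a::cstar_algebra"
  assumes x: "adj x = x" and y: "adj y = y" and xy: "x * y = 0"
    and t: "norm x \<le> t" "norm y \<le> t"
  shows "norm (x + y) \<le> t"
proof (rule power_trick[where A = 0 and B = 2])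
  have yx: "y * x = 0" using xy x y adj_mult[of x y] by simp
  have pow: "(x + y) ^ Suc k = x ^ Suc k + y ^ Suc k" for k
  proof (induction k)
    case (Suc k)
    have "(x + y) ^ Suc (Suc k) = (x + y) * (x ^ Suc k + y ^ Suc k)"
      using Suc by (simp only: power_Suc)
    also have "\<dots> = x ^ Suc (Suc k) + y ^ Suc (Suc k) + (x * y) * y ^ k + (y * x) * x ^ k"
      by (simp add: algebra_simps)
    finally show ?case by (simp add: xy yx)
  qed simp
  have pow2: "(x + y) ^ 2 ^ m = x ^ 2 ^ m + y ^ 2 ^ m" for m
    using pow[of "2 ^ m - 1"] by simp
  fix m
  have "norm (x + y) ^ 2 ^ m = norm (x ^ 2 ^ m + y ^ 2 ^ m)"
    by (subst pow2[symmetric], subst norm_self_adjoint_power2) (simp_all add: adj_add x y)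
  also have "\<dots> \<le> norm x ^ 2 ^ m + norm y ^ 2 ^ m"
    using norm_triangle_ineq[of "x ^ 2 ^ m" "y ^ 2 ^ m"]
    by (simp add: norm_self_adjoint_power2 x y)
  also have "\<dots> \<le> t ^ 2 ^ m + t ^ 2 ^ m"
    using t by (intro add_mono power_mono) auto
  finally show "norm (x + y) ^ 2 ^ m \<le> (0 * 2 ^ m + 2) * t ^ 2 ^ m" by simp
qed (use t order_trans[OF norm_ge_zero] in auto)

text \<open>The square root of \<open>1 - h\<close> is \<open>1 - z\<close> with \<open>z\<close> the fixed point of \<open>z \<mapsto> (h + z\<^sup>2) / 2\<close>.\<close>

lemma sqrt_one_minus:
  fixes h :: "'a::cstar_algebra"
  assumes B: "cstar_subalgebra B" and hB: "h \<in> B" and h: "adj h = h" and nh: "norm h < 1"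
  obtains z where "z \<in> B" "adj z = z" "(1 - z) * (1 - z) = 1 - h"
    "\<And>y. y * h = h * y \<Longrightarrow> y * z = z * y"
proof -
  \<comment> \<open>The smaller fixed point of the scalar map taking r to
    \<open>(norm h + r * r) / 2\<close>, so \<open>g\<close> maps the ball of radius
    \<open>r\<close> into itself; as \<open>r < 1\<close>, it also serves as the contraction
    constant there.\<close>
  define r where "r = 1 - sqrt (1 - norm h)"
  have r0: "0 \<le> r" and r1: "r < 1" and rr: "(norm h + r * r) / 2 = r"
    using nh by (auto simp: r_def field_simps)
  \<comment> \<open>Every property wanted of \<open>z\<close> is closed and preserved by
    \<open>g\<close>; built into \<open>X\<close>, it passes to the fixed point, including
    commutation with all that commutes with \<open>h\<close>.\<close>
  define X where "X = {z \<in> B. adj z = z \<and> norm z \<le> r \<and> (\<forall>y. y * h = h * y \<longrightarrow> y * z = z * y)}"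
  define g where "g = (\<lambda>z. (1/2) *\<^sub>R (h + z * z))"
  have Xeq: "X = B \<inter> {z. adj z = z} \<inter> {z. norm z \<le> r} \<inter> (\<Inter>y\<in>{y. y * h = h * y}. {z. y * z = z * y})"
    by (auto simp: X_def)
  have "closed B" using B by (simp add: cstar_subalgebra_def)
  moreover have "closed {z::'a. adj z = z}"
    by (rule closed_Collect_eq) (simp_all add: continuous_on_adj)
  moreover have "closed {z::'a. norm z \<le> r}"
    by (rule closed_Collect_le) (intro continuous_intros)+
  moreover have "closed {z. y * z = z * y}" for y :: 'a
    by (rule closed_Collect_eq) (intro continuous_intros)+
  ultimately have "closed X" unfolding Xeq by (intro closed_Int closed_INT ballI)
  then have "complete X" by (simp add: complete_eq_closed)
  moreover have "X \<noteq> {}"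
    using B r0 by (auto simp: X_def cstar_subalgebra_def intro!: exI[of _ 0])
  moreover have "g ` X \<subseteq> X"
  proof (rule image_subsetI)
    fix z assume "z \<in> X"
    then have z: "z \<in> B" "adj z = z" "norm z \<le> r"
      and c: "\<And>y. y * h = h * y \<Longrightarrow> y * z = z * y" by (simp_all only: X_def mem_Collect_eq)
    have "complex_of_real (1/2) *\<^sub>C (h + z * z) \<in> B"
      using B hB z(1) unfolding cstar_subalgebra_def by blast
    then have gB: "g z \<in> B" by (simp only: scaleC_of_real g_def)
    have ga: "adj (g z) = g z"
      by (simp only: g_def adj_scaleR adj_add adj_mult h z(2))
    have "norm (h + z * z) \<le> norm h + norm z * norm z"
      by (meson add_left_mono norm_mult_ineq norm_triangle_ineq order_trans)
    also have "\<dots> \<le> norm h + r * r"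
      using z(3) r0 by (intro add_left_mono mult_mono) auto
    finally have gn: "norm (g z) \<le> r" using rr by (simp add: g_def)
    have gc: "y * g z = g z * y" if yh: "y * h = h * y" for y
    proof -
      have "y * z = z * y" by (rule c[OF yh])
      then have "y * (z * z) = z * z * y" by (metis mult.assoc)
      then show ?thesis by (simp add: g_def distrib_left distrib_right yh)
    qed
    show "g z \<in> X" using gB ga gn gc by (simp only: X_def mem_Collect_eq) blast
  qed
  moreover have "\<forall>z\<in>X. \<forall>w\<in>X. dist (g z) (g w) \<le> r * dist z w"
  proof (intro ballI)
    fix z w assume "z \<in> X" "w \<in> X"
    then have zw: "norm z \<le> r" "norm w \<le> r" by (auto simp: X_def)
    have "g z - g w = (1/2) *\<^sub>R (z * (z - w) + (z - w) * w)"
      by (simp add: g_def algebra_simps)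
    then have "norm (g z - g w) = 1/2 * norm (z * (z - w) + (z - w) * w)" by simp
    also have "\<dots> \<le> 1/2 * (norm z * norm (z - w) + norm (z - w) * norm w)"
      by (intro mult_left_mono norm_triangle_le add_mono norm_mult_ineq) simp
    also have "\<dots> \<le> 1/2 * (r * norm (z - w) + norm (z - w) * r)"
      using zw by (intro mult_left_mono add_mono mult_right_mono) auto
    finally show "dist (g z) (g w) \<le> r * dist z w" by (simp add: dist_norm)
  qed
  ultimately have "\<exists>!z\<in>X. g z = z"
    by (intro Banach_fix[OF _ _ r0 r1]) blast+
  then obtain z where z: "z \<in> X" "g z = z" by blast
  have "z + z = 2 *\<^sub>R g z" using z by (simp add: scaleR_2)
  also have "\<dots> = h + z * z" by (simp add: g_def)
  finally have "(1 - z) * (1 - z) = 1 - h" by (simp add: algebra_simps)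
  with z(1) show ?thesis by (intro that[of z]) (simp_all only: X_def mem_Collect_eq)
qed

lemma cstar_subalgebra_UNIV: "cstar_subalgebra UNIV"
  by (simp add: cstar_subalgebra_def)

text \<open>\<open>x + \<i> y\<close> is a multiple of an isometry, and \<open>x\<close> is its real part.\<close>

lemma norm_commuting_squares_le:
  fixes x y :: "'a::cstar_algebra"
  assumes x: "adj x = x" and y: "adj y = y" and xy: "x * y = y * x"
    and sum: "x * x + y * y = s *\<^sub>R 1"
  shows "norm (x * x) \<le> \<bar>s\<bar>"
proof -
  define w where "w = x + \<i> *\<^sub>C y"
  have aw: "adj w = x - \<i> *\<^sub>C y"
    by (simp add: w_def adj_add adj_scaleC x y) (metis scaleC_minus1_left scaleC_scaleC mult_minus1)
  have "adj w * w = x * x + y * y"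
    unfolding aw unfolding w_def
    by (simp add: algebra_simps scaleC_mult_left scaleC_mult_right scaleC_scaleC xy scaleC_minus1_left
        scaleC_diff_right)
  then have w2: "(norm w)\<^sup>2 = \<bar>s\<bar>" using cstar_identity[of w] sum by simp
  have "2 *\<^sub>R x = w + adj w" unfolding aw unfolding w_def by (simp add: scaleR_2)
  then have "2 * norm x = norm (w + adj w)" by (metis norm_scaleR abs_numeral)
  also have "\<dots> \<le> 2 * norm w" using norm_triangle_ineq[of w "adj w"] by simp
  finally have "(norm x)\<^sup>2 \<le> (norm w)\<^sup>2" by (intro power_mono) auto
  then show ?thesis using cstar_identity[of x] x w2 by simp
qed

text \<open>For self-adjoint \<open>h\<close> of norm below 1, \<open>1 - h * h\<close> has a square
  root in \<open>B\<close> that commutes with \<open>h\<close>. Since \<open>f\<close> preserves the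
  relation that the two squares add up to 1, \<open>f h\<close> has norm at most 1. The factor 2 is
  harmless, as only continuity is wanted.\<close>

lemma star_hom_norm_le:
  fixes f :: "'a::cstar_algebra \<Rightarrow> 'b::cstar_algebra"
  assumes B: "cstar_subalgebra B" and f: "star_hom B C f" and one: "1 \<in> B" "f 1 = 1" and xB: "x \<in> B"
  shows "norm (f x) \<le> 2 * norm x"
proof -
  have fadd: "f (a + b) = f a + f b" and fmult: "f (a * b) = f a * f b" if "a \<in> B" "b \<in> B" for a b
    using f that by (auto simp: star_hom_def)
  have fsc: "f (c *\<^sub>C a) = c *\<^sub>C f a" and fadj: "f (adj a) = adj (f a)" if "a \<in> B" for a c
    using f that by (auto simp: star_hom_def)
  have Badd: "a + b \<in> B" and Bmult: "a * b \<in> B" if "a \<in> B" "b \<in> B" for a b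
    using B that by (auto simp: cstar_subalgebra_def)
  have Bsc: "c *\<^sub>C a \<in> B" and Badj: "adj a \<in> B" if "a \<in> B" for a c
    using B that by (auto simp: cstar_subalgebra_def)
  have Bdiff: "a - b \<in> B" if "a \<in> B" "b \<in> B" for a b
    using Badd[OF that(1) Bsc[OF that(2), of "-1"]] by (simp add: scaleC_minus1_left)
  have small: "norm (f h) \<le> 1" if h: "h \<in> B" "adj h = h" and nh: "norm h < 1" for h
  proof -
    have "norm (h * h) < 1"
      using cstar_identity[of h] h nh by (simp add: power_less_one_iff)
    then obtain z where z: "z \<in> B" "adj z = z" "(1 - z) * (1 - z) = 1 - h * h"
      and zc: "\<And>y. y * (h * h) = (h * h) * y \<Longrightarrow> y * z = z * y"
      using sqrt_one_minus[OF B Bmult[OF h(1) h(1)]] h(2) by (metis adj_mult)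
    have hz: "h * z = z * h" using zc[of h] by (simp add: mult.assoc)
    have yB: "1 - z \<in> B" using Bdiff one z by blast
    have "f (h * h + (1 - z) * (1 - z)) = 1" using z one by simp
    then have "f h * f h + f (1 - z) * f (1 - z) = 1 *\<^sub>R 1"
      using fadd fmult h yB Bmult by simp
    moreover have "f h * f (1 - z) = f (1 - z) * f h"
      using fmult[OF h(1) yB] fmult[OF yB h(1)] hz by (simp add: algebra_simps)
    moreover have "adj (f h) = f h" using fadj[OF h(1)] h by simp
    moreover have "adj (f (1 - z)) = f (1 - z)"
      using fadj[OF yB] z by (simp add: adj_diff)
    ultimately have "norm (f h * f h) \<le> 1"
      using norm_commuting_squares_le by fastforce
    then have "(norm (f h))\<^sup>2 \<le> 1" using cstar_identity[of "f h"] fadj[OF h(1)] h by simp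
    then show ?thesis by (simp add: power_le_one_iff)
  qed
  have sa: "norm (f h) \<le> 2 * norm h" if h: "h \<in> B" "adj h = h" for h
  proof (cases "h = 0")
    case True
    then show ?thesis using fsc[OF h(1), of 0] by simp
  next
    case False
    \<comment> \<open>\<open>small\<close> needs a norm strictly below 1; scaling to 1/2 is what
      costs the factor 2.\<close>
    define c where "c = complex_of_real (1 / (2 * norm h))"
    have c: "cmod c * norm h = 1/2" using False by (simp add: c_def norm_divide)
    have "norm (f (c *\<^sub>C h)) \<le> 1"
      using c h by (intro small Bsc) (auto simp: norm_scaleC adj_scaleC c_def)
    then have "cmod c * norm (f h) \<le> 1" using fsc h by (simp add: norm_scaleC)
    then show ?thesis using False by (simp add: c_def norm_divide divide_simps)
  qed
  have "(norm (f x))\<^sup>2 = norm (f (adj x * x))"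
    using fmult[OF Badj[OF xB] xB] fadj[OF xB] by (simp add: cstar_identity)
  also have "\<dots> \<le> 2 * norm (adj x * x)"
    using sa[of "adj x * x"] Bmult[OF Badj[OF xB] xB] by (simp add: adj_mult adj_adj)
  also have "\<dots> \<le> (2 * norm x)\<^sup>2" by (simp add: cstar_identity power_mult_distrib)
  finally show ?thesis by (rule power2_le_imp_le) simp
qed

text \<open>The two bounds express positivity of \<open>a\<close> and of \<open>- a\<close>. For
  every d > 0, up to one common scaling, d + a and d - a are squares of commuting self-adjoint
  elements with the scalar sum 2 d. So d + a has norm at most 2 d, and \<open>a\<close> has norm at
  most 3 d.\<close>

lemma self_adjoint_two_sided_zero:
  fixes a :: "'a::cstar_algebra"
  assumes a: "adj a = a" and le: "norm (t *\<^sub>R 1 - a) \<le> t" "norm (t *\<^sub>R 1 + a) \<le> t"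
  shows "a = 0"
proof -
  have t: "t \<ge> 0" using le(1) norm_ge_zero order_trans by blast
  have bound: "norm a \<le> 0 + e" if e: "e > 0" for e
  proof -
    define d where "d = e / 3"
    have d: "d > 0" using e by (simp add: d_def)
    let ?c = "1 / (t + d)"
    define g1 where "g1 = ?c *\<^sub>R (t *\<^sub>R 1 - a)"
    define g2 where "g2 = ?c *\<^sub>R (t *\<^sub>R 1 + a)"
    have g: "adj g1 = g1" "adj g2 = g2" "norm g1 < 1" "norm g2 < 1"
      using le t d by (auto simp: g1_def g2_def adj_scaleR adj_diff adj_add a)
    obtain z1 where z1: "adj z1 = z1" "(1 - z1) * (1 - z1) = 1 - g1"
        "\<And>y. y * g1 = g1 * y \<Longrightarrow> y * z1 = z1 * y"
      using sqrt_one_minus[OF cstar_subalgebra_UNIV UNIV_I g(1) g(3)] by metis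
    obtain z2 where z2: "adj z2 = z2" "(1 - z2) * (1 - z2) = 1 - g2"
        "\<And>y. y * g2 = g2 * y \<Longrightarrow> y * z2 = z2 * y"
      using sqrt_one_minus[OF cstar_subalgebra_UNIV UNIV_I g(2) g(4)] by metis
    have "a * g1 = g1 * a" by (simp add: g1_def algebra_simps)
    then have "a * z1 = z1 * a" using z1(3) by blast
    then have "z1 * g2 = g2 * z1" by (simp add: g2_def algebra_simps)
    then have "z1 * z2 = z2 * z1" using z2(3) by blast
    moreover have "(t + d) * ?c = 1" using t d by simp
    then have one: "1 = (t * ?c) *\<^sub>R (1::'a) + (d * ?c) *\<^sub>R 1"
      by (metis scaleR_left_distrib distrib_right scaleR_one)
    have e1: "1 - g1 = (d * ?c) *\<^sub>R 1 + ?c *\<^sub>R a"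
      by (subst one) (simp add: g1_def scaleR_diff_right mult.commute)
    have e2: "1 - g2 = (d * ?c) *\<^sub>R 1 - ?c *\<^sub>R a"
      by (subst one) (simp add: g2_def scaleR_add_right mult.commute)
    have "(1 - z1) * (1 - z1) + (1 - z2) * (1 - z2) = (d * ?c + d * ?c) *\<^sub>R 1"
      unfolding z1(2) z2(2) e1 e2 scaleR_left_distrib by simp
    ultimately have "norm ((1 - z1) * (1 - z1)) \<le> \<bar>d * ?c + d * ?c\<bar>"
      using z1(1) z2(1)
      by (intro norm_commuting_squares_le[where y = "1 - z2"]) (simp_all add: adj_diff algebra_simps)
    moreover have "(1 - z1) * (1 - z1) = ?c *\<^sub>R (d *\<^sub>R 1 + a)"
      by (simp add: z1(2) e1 scaleR_add_right mult.commute)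
    ultimately have "?c * norm (d *\<^sub>R 1 + a) \<le> d * ?c + d * ?c"
      using t d by simp
    then have "?c * norm (d *\<^sub>R 1 + a) \<le> ?c * (2 * d)" by (simp add: algebra_simps)
    then have "norm (d *\<^sub>R 1 + a) \<le> 2 * d" by (rule mult_left_le_imp_le) (use t d in simp)
    moreover have "norm a \<le> norm (d *\<^sub>R 1 + a) + norm (d *\<^sub>R (1::'a))"
      using norm_triangle_ineq4[of "d *\<^sub>R 1 + a" "d *\<^sub>R (1::'a)"] by simp
    ultimately show ?thesis using d by (simp add: d_def)
  qed
  then have "norm a \<le> 0" using field_le_epsilon by blast
  then show ?thesis by simp
qed

text \<open>Compressing the sum by \<open>p j\<close> shows that the positive elements
  \<open>p j * p i * p j\<close> with \<open>i\<close> other than \<open>j\<close> add up to 0, so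
  each of them vanishes. Positivity enters only through norm estimates. The Cuntz relations merely
  ask that the range projections sum to 1; orthogonality of the ranges is drawn from this
  lemma.\<close>

lemma projections_sum_1_orthogonal:
  fixes p :: "'i \<Rightarrow> 'a::cstar_algebra"
  assumes I: "finite I" and adj: "\<And>i. i \<in> I \<Longrightarrow> adj (p i) = p i"
    and idem: "\<And>i. i \<in> I \<Longrightarrow> p i * p i = p i" and sum: "(\<Sum>i\<in>I. p i) = 1"
    and j: "j \<in> I" and k: "k \<in> I" and jk: "j \<noteq> k"
  shows "p k * p j = 0"
proof -
  define a where "a = (\<lambda>i. p j * p i * p j)"
  define Q where "Q = I - {j} - {k}"
  \<comment> \<open>The norm form of positivity of \<open>a i\<close> in the corner of
    \<open>p j\<close>.\<close>
  have pa: "norm (p j - a i) \<le> 1" if "i \<in> I" for i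
  proof -
    have "p j - a i = p j * (1 - p i) * p j"
      using idem j by (simp add: a_def algebra_simps)
    also have "norm \<dots> \<le> norm (p j) * norm (1 - p i) * norm (p j)"
      by (meson norm_mult_ineq mult_right_mono norm_ge_zero order_trans)
    also have "\<dots> \<le> 1 * 1 * 1"
      using that j idem adj
      by (intro mult_mono norm_projection_le) (auto simp: adj_diff algebra_simps)
    finally show ?thesis by simp
  qed
  have "(\<Sum>i\<in>I. a i) = p j * (\<Sum>i\<in>I. p i) * p j"
    by (simp add: a_def sum_distrib_left sum_distrib_right)
  also have "\<dots> = p j" using sum idem j by simp
  finally have "a j + (a k + (\<Sum>i\<in>Q. a i)) = p j"
    using I j k jk by (simp add: Q_def sum.remove[of I j] sum.remove[of "I - {j}" k])
  then have ak: "a k = - (\<Sum>i\<in>Q. a i)"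
    using idem j by (simp add: a_def eq_neg_iff_add_eq_0)
  define N where "N = real (card Q)"
  \<comment> \<open>The extra 1 absorbs \<open>p j\<close> in the estimate for \<open>a k\<close>
    and \<open>p j - a k\<close> in the estimate for \<open>- a k\<close>.\<close>
  define t where "t = N + 1"
  have "(\<Sum>i\<in>Q. p j - a i) = N *\<^sub>R p j + a k"
    by (simp add: sum_subtractf ak N_def scaleR_conv_of_real)
  moreover have "norm (\<Sum>i\<in>Q. p j - a i) \<le> N"
    using sum_norm_le[of Q "\<lambda>i. p j - a i" "\<lambda>_. 1"] pa by (auto simp: N_def Q_def)
  ultimately have Nak: "norm (N *\<^sub>R p j + a k) \<le> N" by simp
  have npj: "norm (p j) \<le> 1" "norm (1 - p j) \<le> 1"
    using j idem adj by (auto intro!: norm_projection_le simp: adj_diff algebra_simps)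
  have adja: "adj (a k) = a k" using j k adj by (simp add: a_def adj_mult mult.assoc)
  have t0: "t \<ge> 0" by (simp add: t_def N_def)
  have orth: "(1 - p j) * p j = 0" "(1 - p j) * a k = 0"
    using idem j by (simp_all add: a_def algebra_simps flip: mult.assoc)
  \<comment> \<open>The two-sided criterion refers to the unit of the whole algebra, so
    \<open>t *\<^sub>R (1 - p j)\<close> is added to the corner as an orthogonal summand.\<close>
  have corner: "norm (t *\<^sub>R 1 + b) \<le> t"
    if b: "norm (t *\<^sub>R p j + b) \<le> t" "adj b = b" "(1 - p j) * b = 0" for b
  proof -
    have "norm (t *\<^sub>R (1 - p j) + (t *\<^sub>R p j + b)) \<le> t"
    proof (rule norm_orthogonal_add_le)
      show "norm (t *\<^sub>R (1 - p j)) \<le> t" using npj t0 by (simp add: mult_left_le)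
    qed (use b adj j orth in \<open>simp_all add: adj_scaleR adj_add adj_diff distrib_left\<close>)
    then show ?thesis by (simp add: scaleR_diff_right)
  qed
  have "norm (t *\<^sub>R p j + a k) \<le> norm (N *\<^sub>R p j + a k) + norm (p j)"
    using norm_triangle_ineq[of "N *\<^sub>R p j + a k" "p j"] by (simp add: t_def algebra_simps)
  then have 1: "norm (t *\<^sub>R 1 + a k) \<le> t"
    using Nak npj adja orth by (intro corner) (auto simp: t_def)
  have "norm (t *\<^sub>R p j + - a k) \<le> norm (N *\<^sub>R p j) + norm (p j - a k)"
    using norm_triangle_ineq[of "N *\<^sub>R p j" "p j - a k"] by (simp add: t_def algebra_simps)
  also have "\<dots> \<le> N + 1"
    using npj pa[OF k] by (intro add_mono) (auto simp: N_def mult_left_le)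
  finally have 2: "norm (t *\<^sub>R 1 - a k) \<le> t"
    using corner[of "- a k"] adja orth by (simp add: t_def adj_minus)
  have "a k = 0" using self_adjoint_two_sided_zero[OF adja 2 1] .
  then have "adj (p k * p j) * (p k * p j) = 0"
    using j k adj idem by (simp add: a_def adj_mult) (metis mult.assoc)
  then show ?thesis by (rule adj_mult_self_eq_0)
qed

subsection \<open>C*-subalgebras\<close>

lemma cstar_subalgebraD:
  assumes "cstar_subalgebra B"
  shows "closed B" "0 \<in> B" "x \<in> B \<Longrightarrow> y \<in> B \<Longrightarrow> x + y \<in> B"
    "x \<in> B \<Longrightarrow> y \<in> B \<Longrightarrow> x * y \<in> B" "x \<in> B \<Longrightarrow> c *\<^sub>C x \<in> B" "x \<in> B \<Longrightarrow> adj x \<in> B"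
  using assms by (auto simp: cstar_subalgebra_def)

lemma cstar_subalgebra_Inter: "(\<And>B. B \<in> \<B> \<Longrightarrow> cstar_subalgebra B) \<Longrightarrow> cstar_subalgebra (\<Inter>\<B>)"
  unfolding cstar_subalgebra_def by (simp add: closed_Inter)

lemma cstar_subalgebra_hull: "cstar_subalgebra (cstar_subalgebra hull X)"
  unfolding hull_def by (rule cstar_subalgebra_Inter) simp

lemma closure_sequentialI:
  fixes x :: "'a::metric_space"
  shows "(\<And>n. f n \<in> A) \<Longrightarrow> f \<longlonglongrightarrow> x \<Longrightarrow> x \<in> closure A"
  unfolding closure_sequential by (intro exI[of _ f]) simp

lemma closure_sequentialE:
  fixes x :: "'a::metric_space"
  assumes "x \<in> closure A"
  obtains f where "\<And>n. f n \<in> A" "f \<longlonglongrightarrow> x"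
  using iffD1[OF closure_sequential assms] by (elim exE conjE) (rule that, simp_all)

lemma cstar_subalgebra_closure:
  fixes A :: "'a::cstar_algebra set"
  assumes "0 \<in> A" and add: "\<And>x y. x \<in> A \<Longrightarrow> y \<in> A \<Longrightarrow> x + y \<in> A"
    and mult: "\<And>x y. x \<in> A \<Longrightarrow> y \<in> A \<Longrightarrow> x * y \<in> A"
    and sc: "\<And>c x. x \<in> A \<Longrightarrow> c *\<^sub>C x \<in> A" and adj: "\<And>x. x \<in> A \<Longrightarrow> adj x \<in> A"
  shows "cstar_subalgebra (closure A)"
  unfolding cstar_subalgebra_def
proof (intro conjI ballI allI)
  show "0 \<in> closure A" using \<open>0 \<in> A\<close> closure_subset by blast
  fix x y assume x: "x \<in> closure A" and y: "y \<in> closure A"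
  obtain f where f: "\<And>n. f n \<in> A" "f \<longlonglongrightarrow> x" by (rule closure_sequentialE[OF x], rule that)
  obtain g where g: "\<And>n. g n \<in> A" "g \<longlonglongrightarrow> y" by (rule closure_sequentialE[OF y], rule that)
  show "x + y \<in> closure A"
    by (rule closure_sequentialI[OF add[OF f(1) g(1)] tendsto_add[OF f(2) g(2)]])
  show "x * y \<in> closure A"
    by (rule closure_sequentialI[OF mult[OF f(1) g(1)] tendsto_mult[OF f(2) g(2)]])
next
  fix c x assume x: "x \<in> closure A"
  obtain f where f: "\<And>n. f n \<in> A" "f \<longlonglongrightarrow> x" by (rule closure_sequentialE[OF x], rule that)
  show "c *\<^sub>C x \<in> closure A"
    by (rule closure_sequentialI[OF sc[OF f(1)] tendsto_scaleC[OF f(2)]])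
next
  fix x assume x: "x \<in> closure A"
  obtain f where f: "\<And>n. f n \<in> A" "f \<longlonglongrightarrow> x" by (rule closure_sequentialE[OF x], rule that)
  show "adj x \<in> closure A"
    by (rule closure_sequentialI[OF adj[OF f(1)] tendsto_adj[OF f(2)]])
qed simp

lemma cstar_subalgebra_sum:
  assumes "cstar_subalgebra B" "\<And>i. i \<in> I \<Longrightarrow> f i \<in> B"
  shows "sum f I \<in> B"
  using assms(2) by (induction I rule: infinite_finite_induct) (auto intro: cstar_subalgebraD[OF assms(1)])

subsection \<open>Words and Cuntz families\<close>

lemma words_0 [simp]: "words n 0 = {[]}"
  by (auto simp: words_def)

lemma words_Suc: "words n (Suc k) = (\<lambda>(i, \<mu>). i # \<mu>) ` ({1..n} \<times> words n k)"
proof -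
  have "\<mu> \<in> words n (Suc k) \<Longrightarrow> \<mu> \<in> (\<lambda>(i, \<mu>). i # \<mu>) ` ({1..n} \<times> words n k)" for \<mu>
    by (cases \<mu>) (auto simp: words_def)
  then show ?thesis by (auto simp: words_def)
qed

lemma words_SucE:
  assumes "\<kappa> \<in> words n (Suc k)"
  obtains i \<mu> where "\<kappa> = i # \<mu>" "i \<in> {1..n}" "\<mu> \<in> words n k"
  using assms by (auto simp: words_Suc)

lemma finite_words [simp]: "finite (words n k)"
  using finite_lists_length_eq[of "{1..n}" k] by (simp add: words_def conj_commute)

lemma Cons_words: "i \<in> {1..n} \<Longrightarrow> \<mu> \<in> words n k \<Longrightarrow> i # \<mu> \<in> words n (Suc k)"
  by (auto simp: words_def)

lemma words_appendE:
  assumes "\<kappa> \<in> words n (k + l)"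
  obtains \<mu> \<nu> where "\<kappa> = \<mu> @ \<nu>" "\<mu> \<in> words n k" "\<nu> \<in> words n l"
proof -
  have "take k \<kappa> \<in> words n k" "drop k \<kappa> \<in> words n l"
    using assms by (auto simp: words_def dest: in_set_takeD in_set_dropD)
  then show ?thesis using that[of "take k \<kappa>" "drop k \<kappa>"] by simp
qed

lemma S_word_Nil [simp]: "S_word S [] = 1"
  and S_word_Cons: "S_word S (i # \<mu>) = S i * S_word S \<mu>"
  and S_word_append: "S_word S (\<mu> @ \<nu>) = S_word S \<mu> * S_word S \<nu>"
  by (simp_all add: S_word_def)

lemma P_word_Nil [simp]: "P_word S [] = 1"
  by (simp add: P_word_def)

lemma adj_P_word [simp]: "adj (P_word S \<mu>) = P_word S \<mu>"
  by (simp add: P_word_def adj_mult adj_adj)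

lemma P_word_append: "P_word S (\<mu> @ \<nu>) = S_word S \<mu> * P_word S \<nu> * adj (S_word S \<mu>)"
  by (simp add: P_word_def S_word_append adj_mult mult.assoc)

lemma P_word_Cons: "P_word S (i # \<mu>) = S i * P_word S \<mu> * adj (S i)"
  by (simp add: P_word_def S_word_Cons adj_mult mult.assoc)

locale cuntz_family =
  fixes n :: nat and S :: "nat \<Rightarrow> 'a::cstar_algebra"
  assumes isometry: "i \<in> {1..n} \<Longrightarrow> adj (S i) * S i = 1"
    and sum_range_projections: "(\<Sum>i=1..n. S i * adj (S i)) = 1"
begin

abbreviation \<phi> :: "'a \<Rightarrow> 'a" where "\<phi> \<equiv> shift n S"
abbreviation Sw :: "nat list \<Rightarrow> 'a" where "Sw \<equiv> S_word S"
abbreviation Pw :: "nat list \<Rightarrow> 'a" where "Pw \<equiv> P_word S"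

lemma adj_S_mult_S:
  assumes i: "i \<in> {1..n}" and j: "j \<in> {1..n}"
  shows "adj (S i) * S j = (if i = j then 1 else 0)"
proof (cases "i = j")
  case False
  have "(S i * adj (S i)) * (S j * adj (S j)) = 0"
  proof (rule projections_sum_1_orthogonal[where I = "{1..n}" and p = "\<lambda>i. S i * adj (S i)"])
    show "S k * adj (S k) * (S k * adj (S k)) = S k * adj (S k)" if "k \<in> {1..n}" for k
    proof -
      have "S k * adj (S k) * (S k * adj (S k)) = S k * (adj (S k) * S k) * adj (S k)"
        by (simp add: mult.assoc)
      then show ?thesis using isometry[OF that] by simp
    qed
  qed (use i j False sum_range_projections in \<open>auto simp: adj_mult adj_adj\<close>)
  then have "adj (S i) * ((S i * adj (S i)) * (S j * adj (S j))) * S j = 0" by simp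
  moreover have "adj (S i) * ((S i * adj (S i)) * (S j * adj (S j))) * S j =
      (adj (S i) * S i) * adj (S i) * S j * (adj (S j) * S j)"
    by (simp add: mult.assoc)
  ultimately show ?thesis using False isometry i j by simp
qed (use isometry i in simp)

lemma adj_S_mult_S_left:
  "i \<in> {1..n} \<Longrightarrow> j \<in> {1..n} \<Longrightarrow> adj (S i) * (S j * x) = (if i = j then x else 0)"
  using adj_S_mult_S[of i j] by (simp flip: mult.assoc)

lemma adj_Sw_mult_Sw:
  assumes "\<mu> \<in> words n k" "\<nu> \<in> words n k"
  shows "adj (Sw \<mu>) * Sw \<nu> = (if \<mu> = \<nu> then 1 else 0)"
  using assms
proof (induction k arbitrary: \<mu> \<nu>)
  case (Suc k)
  from Suc.prems obtain i \<mu>' j \<nu>' where eq: "\<mu> = i # \<mu>'" "\<nu> = j # \<nu>'"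
    and m: "i \<in> {1..n}" "\<mu>' \<in> words n k" "j \<in> {1..n}" "\<nu>' \<in> words n k"
    by (meson words_SucE)
  have "adj (Sw \<mu>) * Sw \<nu> = adj (Sw \<mu>') * (adj (S i) * (S j * Sw \<nu>'))"
    by (simp add: eq S_word_Cons adj_mult mult.assoc)
  then show ?case using Suc.IH[OF m(2,4)] m by (auto simp: adj_S_mult_S_left eq)
qed simp

lemma Sw_isometry: "\<mu> \<in> words n k \<Longrightarrow> adj (Sw \<mu>) * Sw \<mu> = 1"
  using adj_Sw_mult_Sw[of \<mu> k \<mu>] by simp

lemma adj_Sw_mult_Sw_left:
  "\<mu> \<in> words n k \<Longrightarrow> \<nu> \<in> words n k \<Longrightarrow> adj (Sw \<mu>) * (Sw \<nu> * x) = (if \<mu> = \<nu> then x else 0)"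
  using adj_Sw_mult_Sw[of \<mu> k \<nu>] by (simp flip: mult.assoc)

lemma Pw_mult_Sw: "\<mu> \<in> words n k \<Longrightarrow> Pw \<mu> * Sw \<mu> = Sw \<mu>"
  using Sw_isometry[of \<mu> k] by (simp add: P_word_def mult.assoc)

lemma Pw_mult_Pw: "\<mu> \<in> words n k \<Longrightarrow> \<nu> \<in> words n k \<Longrightarrow> Pw \<mu> * Pw \<nu> = (if \<mu> = \<nu> then Pw \<mu> else 0)"
  by (simp add: P_word_def mult.assoc adj_Sw_mult_Sw_left)

lemma Pw_nonzero: "\<mu> \<in> words n k \<Longrightarrow> Pw \<mu> \<noteq> 0"
  using Pw_mult_Sw[of \<mu> k] Sw_isometry[of \<mu> k] by auto

lemma sum_Pw: "(\<Sum>\<mu>\<in>words n k. Pw \<mu>) = 1"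
proof (induction k)
  case (Suc k)
  have "(\<Sum>\<mu>\<in>words n (Suc k). Pw \<mu>) = (\<Sum>(i, \<mu>)\<in>{1..n} \<times> words n k. Pw (i # \<mu>))"
    unfolding words_Suc by (subst sum.reindex) (auto simp: inj_on_def case_prod_unfold)
  also have "\<dots> = (\<Sum>i=1..n. S i * (\<Sum>\<mu>\<in>words n k. Pw \<mu>) * adj (S i))"
    by (simp add: sum.cartesian_product[symmetric] P_word_Cons sum_distrib_left sum_distrib_right)
  finally show ?case using Suc sum_range_projections by simp
qed simp

lemma sum_Pw_left: "(\<Sum>\<mu>\<in>words n k. Pw \<mu> * x) = x"
  and sum_Pw_right: "(\<Sum>\<mu>\<in>words n k. x * Pw \<mu>) = x"
  using sum_Pw[of k] by (simp_all flip: sum_distrib_left sum_distrib_right)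

text \<open>Inserting the partition of unity by the \<open>Pw \<mu>\<close> on both sides turns
  \<open>x\<close> into a matrix over the algebra, indexed by words.\<close>

lemma matrix_decomposition:
  "x = (\<Sum>\<mu>\<in>words n k. \<Sum>\<nu>\<in>words n k. Sw \<mu> * (adj (Sw \<mu>) * x * Sw \<nu>) * adj (Sw \<nu>))"
proof -
  have "x = (\<Sum>\<mu>\<in>words n k. \<Sum>\<nu>\<in>words n k. Pw \<mu> * x * Pw \<nu>)"
    by (simp add: sum_Pw_right sum_Pw_left)
  then show ?thesis by (simp add: P_word_def mult.assoc)
qed

subsection \<open>The canonical shift\<close>

lemma shift_add: "\<phi> (x + y) = \<phi> x + \<phi> y"
  by (simp add: shift_def distrib_left distrib_right sum.distrib)

lemma shift_adj: "\<phi> (adj x) = adj (\<phi> x)"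
  by (simp add: shift_def adj_sum adj_mult adj_adj mult.assoc)

lemma shift_1: "\<phi> 1 = 1"
  using sum_range_projections by (simp add: shift_def)

lemma shift_mult_S: "i \<in> {1..n} \<Longrightarrow> \<phi> x * S i = S i * x"
  by (simp add: shift_def sum_distrib_right mult.assoc adj_S_mult_S if_distrib[of "\<lambda>y. _ * y"] cong: if_cong)

lemma adj_S_mult_shift: "i \<in> {1..n} \<Longrightarrow> adj (S i) * \<phi> x = x * adj (S i)"
  by (simp add: shift_def sum_distrib_left mult.assoc adj_S_mult_S_left)

lemma shift_mult: "\<phi> (x * y) = \<phi> x * \<phi> y"
proof -
  have "\<phi> x * \<phi> y = (\<Sum>i=1..n. \<phi> x * S i * y * adj (S i))"
    by (simp add: shift_def[of n S y] sum_distrib_left mult.assoc)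
  then show ?thesis by (simp add: shift_mult_S shift_def[of n S "x * y"] mult.assoc)
qed

lemma shift_pow_add: "(\<phi> ^^ k) (x + y) = (\<phi> ^^ k) x + (\<phi> ^^ k) y"
  by (induction k) (simp_all add: shift_add)

lemma shift_pow_mult: "(\<phi> ^^ k) (x * y) = (\<phi> ^^ k) x * (\<phi> ^^ k) y"
  by (induction k) (simp_all add: shift_mult)

lemma shift_pow_adj: "(\<phi> ^^ k) (adj x) = adj ((\<phi> ^^ k) x)"
  by (induction k) (simp_all add: shift_adj)

lemma shift_pow_1: "(\<phi> ^^ k) 1 = 1"
  by (induction k) (simp_all add: shift_1)

lemma shift_pow_mult_Sw: "\<mu> \<in> words n k \<Longrightarrow> (\<phi> ^^ k) x * Sw \<mu> = Sw \<mu> * x"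
proof (induction k arbitrary: \<mu>)
  case (Suc k)
  then obtain i \<nu> where eq: "\<mu> = i # \<nu>" and m: "i \<in> {1..n}" "\<nu> \<in> words n k"
    by (meson words_SucE)
  have "(\<phi> ^^ Suc k) x * Sw \<mu> = \<phi> ((\<phi> ^^ k) x) * S i * Sw \<nu>"
    by (simp add: eq S_word_Cons mult.assoc)
  also have "\<dots> = S i * ((\<phi> ^^ k) x * Sw \<nu>)" using m by (simp add: shift_mult_S mult.assoc)
  finally show ?case using Suc.IH[OF m(2)] by (simp add: mult.assoc eq S_word_Cons)
qed simp

lemma adj_Sw_mult_shift_pow: "\<mu> \<in> words n k \<Longrightarrow> adj (Sw \<mu>) * (\<phi> ^^ k) x = x * adj (Sw \<mu>)"
  using arg_cong[OF shift_pow_mult_Sw[of \<mu> k "adj x"], of adj]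
  by (simp add: adj_mult shift_pow_adj adj_adj)

lemma Pw_mult_shift_pow: "\<mu> \<in> words n k \<Longrightarrow> Pw \<mu> * (\<phi> ^^ k) x = Sw \<mu> * x * adj (Sw \<mu>)"
  by (simp add: P_word_def mult.assoc adj_Sw_mult_shift_pow)

lemma Pw_append: "\<mu> \<in> words n k \<Longrightarrow> Pw (\<mu> @ \<nu>) = Pw \<mu> * (\<phi> ^^ k) (Pw \<nu>)"
  by (simp add: Pw_mult_shift_pow P_word_append)

subsection \<open>The core\<close>

text \<open>Compressing with words reads off matrix entries, so membership becomes an entrywise test
  without coefficient sums; most of the closure properties below are checked in this form.\<close>

lemma core_level_iff:
  "x \<in> core_level n S k \<longleftrightarrow>
     (\<forall>\<mu>\<in>words n k. \<forall>\<nu>\<in>words n k. \<exists>c. adj (Sw \<mu>) * x * Sw \<nu> = c *\<^sub>C 1)"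
proof
  assume "x \<in> core_level n S k"
  then obtain c where x: "x = (\<Sum>\<alpha>\<in>words n k. \<Sum>\<beta>\<in>words n k. c \<alpha> \<beta> *\<^sub>C (Sw \<alpha> * adj (Sw \<beta>)))"
    by (auto simp: core_level_def)
  have "adj (Sw \<mu>) * x * Sw \<nu> = c \<mu> \<nu> *\<^sub>C 1" if m: "\<mu> \<in> words n k" "\<nu> \<in> words n k" for \<mu> \<nu>
  proof -
    have "adj (Sw \<mu>) * x * Sw \<nu> = (\<Sum>\<alpha>\<in>words n k. \<Sum>\<beta>\<in>words n k.
        c \<alpha> \<beta> *\<^sub>C (adj (Sw \<mu>) * Sw \<alpha> * (adj (Sw \<beta>) * Sw \<nu>)))"
      by (simp add: x sum_distrib_left sum_distrib_right scaleC_mult_left scaleC_mult_right mult.assoc)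
    also have "\<dots> = (\<Sum>\<alpha>\<in>words n k. \<Sum>\<beta>\<in>words n k.
        if \<beta> = \<nu> then if \<alpha> = \<mu> then c \<alpha> \<beta> *\<^sub>C 1 else 0 else 0)"
      using m by (intro sum.cong refl) (auto simp: adj_Sw_mult_Sw)
    also have "\<dots> = c \<mu> \<nu> *\<^sub>C 1" using m by simp
    finally show ?thesis .
  qed
  then show "\<forall>\<mu>\<in>words n k. \<forall>\<nu>\<in>words n k. \<exists>c. adj (Sw \<mu>) * x * Sw \<nu> = c *\<^sub>C 1" by blast
next
  assume "\<forall>\<mu>\<in>words n k. \<forall>\<nu>\<in>words n k. \<exists>c. adj (Sw \<mu>) * x * Sw \<nu> = c *\<^sub>C 1"
  then obtain c where c: "\<And>\<mu> \<nu>. \<mu> \<in> words n k \<Longrightarrow> \<nu> \<in> words n k \<Longrightarrow> adj (Sw \<mu>) * x * Sw \<nu> = c \<mu> \<nu> *\<^sub>C 1"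
    by metis
  have "x = (\<Sum>\<mu>\<in>words n k. \<Sum>\<nu>\<in>words n k. c \<mu> \<nu> *\<^sub>C (Sw \<mu> * adj (Sw \<nu>)))"
    by (subst matrix_decomposition[of x k]) (simp add: c scaleC_mult_left scaleC_mult_right)
  then show "x \<in> core_level n S k" by (auto simp: core_level_def)
qed

lemma core_level_add: "x \<in> core_level n S k \<Longrightarrow> y \<in> core_level n S k \<Longrightarrow> x + y \<in> core_level n S k"
  unfolding core_level_iff by (fastforce simp: distrib_left distrib_right simp flip: scaleC_add_left)

lemma core_level_scaleC: "x \<in> core_level n S k \<Longrightarrow> d *\<^sub>C x \<in> core_level n S k"
  unfolding core_level_iff by (fastforce simp: scaleC_mult_left scaleC_mult_right scaleC_scaleC)

lemma core_level_adj:
  assumes "x \<in> core_level n S k"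
  shows "adj x \<in> core_level n S k"
  unfolding core_level_iff
proof (intro ballI)
  fix \<mu> \<nu> assume "\<mu> \<in> words n k" "\<nu> \<in> words n k"
  with assms obtain c where "adj (Sw \<nu>) * x * Sw \<mu> = c *\<^sub>C 1" unfolding core_level_iff by blast
  from arg_cong[OF this, of adj] show "\<exists>c. adj (Sw \<mu>) * adj x * Sw \<nu> = c *\<^sub>C 1"
    by (auto simp: adj_mult adj_adj adj_scaleC mult.assoc)
qed

lemma core_level_mult:
  assumes "x \<in> core_level n S k" "y \<in> core_level n S k"
  shows "x * y \<in> core_level n S k"
  unfolding core_level_iff
proof (intro ballI)
  from assms(1) obtain c where c: "\<And>\<mu> \<nu>. \<mu> \<in> words n k \<Longrightarrow> \<nu> \<in> words n k \<Longrightarrow> adj (Sw \<mu>) * x * Sw \<nu> = c \<mu> \<nu> *\<^sub>C 1"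
    unfolding core_level_iff by metis
  from assms(2) obtain d where d: "\<And>\<mu> \<nu>. \<mu> \<in> words n k \<Longrightarrow> \<nu> \<in> words n k \<Longrightarrow> adj (Sw \<mu>) * y * Sw \<nu> = d \<mu> \<nu> *\<^sub>C 1"
    unfolding core_level_iff by metis
  fix \<mu> \<nu> assume m: "\<mu> \<in> words n k" "\<nu> \<in> words n k"
  have "adj (Sw \<mu>) * (x * y) * Sw \<nu> = adj (Sw \<mu>) * x * (\<Sum>\<kappa>\<in>words n k. Pw \<kappa> * (y * Sw \<nu>))"
    by (simp add: sum_Pw_left mult.assoc)
  also have "\<dots> = (\<Sum>\<kappa>\<in>words n k. (adj (Sw \<mu>) * x * Sw \<kappa>) * (adj (Sw \<kappa>) * y * Sw \<nu>))"
    by (simp add: sum_distrib_left P_word_def mult.assoc)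
  also have "\<dots> = (\<Sum>\<kappa>\<in>words n k. c \<mu> \<kappa> * d \<kappa> \<nu>) *\<^sub>C 1"
    using m by (simp add: c d scaleC_mult_left scaleC_mult_right scaleC_scaleC scaleC_sum_left mult.commute)
  finally show "\<exists>c. adj (Sw \<mu>) * (x * y) * Sw \<nu> = c *\<^sub>C 1" by blast
qed

text \<open>A matrix unit is the sum of its refinements by a common tail of \<open>l\<close>
  letters; entries with distinct tails vanish.\<close>

lemma core_level_mono:
  assumes "x \<in> core_level n S k"
  shows "x \<in> core_level n S (k + l)"
  unfolding core_level_iff
proof (intro ballI)
  fix \<mu> \<nu> assume "\<mu> \<in> words n (k + l)" "\<nu> \<in> words n (k + l)"
  then obtain \<mu>1 \<mu>2 \<nu>1 \<nu>2 where eq: "\<mu> = \<mu>1 @ \<mu>2" "\<nu> = \<nu>1 @ \<nu>2"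
    and m: "\<mu>1 \<in> words n k" "\<nu>1 \<in> words n k" "\<mu>2 \<in> words n l" "\<nu>2 \<in> words n l"
    by (meson words_appendE)
  obtain c where c: "adj (Sw \<mu>1) * x * Sw \<nu>1 = c *\<^sub>C 1"
    using assms m unfolding core_level_iff by blast
  have "adj (Sw \<mu>) * x * Sw \<nu> = adj (Sw \<mu>2) * (adj (Sw \<mu>1) * x * Sw \<nu>1) * Sw \<nu>2"
    by (simp add: eq S_word_append adj_mult mult.assoc)
  also have "\<dots> = (if \<mu>2 = \<nu>2 then c else 0) *\<^sub>C 1"
    using m by (simp add: c scaleC_mult_left scaleC_mult_right adj_Sw_mult_Sw)
  finally show "\<exists>c. adj (Sw \<mu>) * x * Sw \<nu> = c *\<^sub>C 1" by blast
qed

lemma core_level_shift: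
  assumes "x \<in> core_level n S k"
  shows "\<phi> x \<in> core_level n S (Suc k)"
  unfolding core_level_iff
proof (intro ballI)
  fix \<mu> \<nu> assume "\<mu> \<in> words n (Suc k)" "\<nu> \<in> words n (Suc k)"
  then obtain i \<mu>' j \<nu>' where eq: "\<mu> = i # \<mu>'" "\<nu> = j # \<nu>'"
    and m: "i \<in> {1..n}" "\<mu>' \<in> words n k" "j \<in> {1..n}" "\<nu>' \<in> words n k"
    by (meson words_SucE)
  obtain c where c: "adj (Sw \<mu>') * x * Sw \<nu>' = c *\<^sub>C 1"
    using assms m unfolding core_level_iff by blast
  have "adj (Sw \<mu>) * \<phi> x * Sw \<nu> = adj (Sw \<mu>') * (adj (S i) * \<phi> x) * S j * Sw \<nu>'"
    by (simp add: eq S_word_Cons adj_mult mult.assoc)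
  also have "\<dots> = adj (Sw \<mu>') * x * (adj (S i) * S j) * Sw \<nu>'"
    using m by (simp add: adj_S_mult_shift mult.assoc)
  also have "\<dots> = (if i = j then c else 0) *\<^sub>C 1"
    using m c by (simp add: adj_S_mult_S)
  finally show "\<exists>c. adj (Sw \<mu>) * \<phi> x * Sw \<nu> = c *\<^sub>C 1" by blast
qed

text \<open>In the matrix picture \<open>(\<phi> ^^ k) y\<close> is block diagonal with all blocks
  equal to \<open>y\<close>, and scalar matrices commute with such an element. This is the source of
  property (P).\<close>

lemma core_level_commute:
  assumes "x \<in> core_level n S k"
  shows "x * (\<phi> ^^ k) y = (\<phi> ^^ k) y * x"
proof -
  obtain c where x: "x = (\<Sum>\<alpha>\<in>words n k. \<Sum>\<beta>\<in>words n k. c \<alpha> \<beta> *\<^sub>C (Sw \<alpha> * adj (Sw \<beta>)))"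
    using assms by (auto simp: core_level_def)
  have "Sw \<alpha> * adj (Sw \<beta>) * (\<phi> ^^ k) y = (\<phi> ^^ k) y * (Sw \<alpha> * adj (Sw \<beta>))"
    if "\<alpha> \<in> words n k" "\<beta> \<in> words n k" for \<alpha> \<beta>
    using that by (simp add: mult.assoc adj_Sw_mult_shift_pow) (simp flip: mult.assoc add: shift_pow_mult_Sw)
  then show ?thesis
    by (simp add: x sum_distrib_left sum_distrib_right scaleC_mult_left scaleC_mult_right)
qed

lemma core_level_matrix_unit:
  "\<mu> \<in> words n k \<Longrightarrow> \<nu> \<in> words n k \<Longrightarrow> Sw \<mu> * adj (Sw \<nu>) \<in> core_level n S k"
  unfolding core_level_iff
proof (intro ballI)
  fix \<alpha> \<beta> assume "\<mu> \<in> words n k" "\<nu> \<in> words n k" "\<alpha> \<in> words n k" "\<beta> \<in> words n k"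
  then have "adj (Sw \<alpha>) * (Sw \<mu> * adj (Sw \<nu>)) * Sw \<beta> = (if \<alpha> = \<mu> \<and> \<nu> = \<beta> then 1 else 0) *\<^sub>C 1"
    by (auto simp: mult.assoc adj_Sw_mult_Sw adj_Sw_mult_Sw_left)
  then show "\<exists>c. adj (Sw \<alpha>) * (Sw \<mu> * adj (Sw \<nu>)) * Sw \<beta> = c *\<^sub>C 1" by blast
qed

lemma core_level_subset_core: "core_level n S k \<subseteq> core n S"
  unfolding core_def by (rule subset_trans[OF _ closure_subset]) auto

lemma cstar_subalgebra_core: "cstar_subalgebra (core n S)"
  unfolding core_def
proof (rule cstar_subalgebra_closure)
  have "0 \<in> core_level n S 0"
    by (simp add: core_level_iff) (metis scaleC_0_left)
  then show "0 \<in> (\<Union>k. core_level n S k)" by blast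
  fix x y assume "x \<in> (\<Union>k. core_level n S k)" "y \<in> (\<Union>k. core_level n S k)"
  then obtain k l where "x \<in> core_level n S k" "y \<in> core_level n S l" by blast
  then have "x \<in> core_level n S (k + l)" "y \<in> core_level n S (k + l)"
    using core_level_mono[of x k l] core_level_mono[of y l k] by (simp_all add: add.commute)
  then show "x + y \<in> (\<Union>k. core_level n S k)" "x * y \<in> (\<Union>k. core_level n S k)"
    by (auto intro: core_level_add core_level_mult)
next
  fix c x assume "x \<in> (\<Union>k. core_level n S k)"
  then obtain k where "x \<in> core_level n S k" by blast
  then show "c *\<^sub>C x \<in> (\<Union>k. core_level n S k)" "adj x \<in> (\<Union>k. core_level n S k)"
    by (auto intro: core_level_scaleC core_level_adj)
qed

lemma one_in_core: "1 \<in> core n S"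
  using core_level_matrix_unit[of "[]" 0 "[]"] core_level_subset_core by auto

subsection \<open>The diagonal\<close>

text \<open>The \<open>Pw \<mu>\<close> are orthogonal with sum 1, so an element is known from its
  products with them. As for the core, this avoids choosing coefficients.\<close>

lemma diagonal_level_iff:
  "x \<in> diagonal_level n S k \<longleftrightarrow> (\<forall>\<mu>\<in>words n k. \<exists>c. x * Pw \<mu> = c *\<^sub>C Pw \<mu>)"
proof
  assume "x \<in> diagonal_level n S k"
  then obtain c where x: "x = (\<Sum>\<mu>\<in>words n k. c \<mu> *\<^sub>C Pw \<mu>)" by (auto simp: diagonal_level_def)
  have "x * Pw \<nu> = c \<nu> *\<^sub>C Pw \<nu>" if "\<nu> \<in> words n k" for \<nu>
  proof -
    have "x * Pw \<nu> = (\<Sum>\<mu>\<in>words n k. if \<mu> = \<nu> then c \<mu> *\<^sub>C Pw \<mu> else 0)"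
      unfolding x sum_distrib_right using that
      by (intro sum.cong) (auto simp: scaleC_mult_left Pw_mult_Pw)
    then show ?thesis using that by simp
  qed
  then show "\<forall>\<mu>\<in>words n k. \<exists>c. x * Pw \<mu> = c *\<^sub>C Pw \<mu>" by blast
next
  assume "\<forall>\<mu>\<in>words n k. \<exists>c. x * Pw \<mu> = c *\<^sub>C Pw \<mu>"
  then obtain c where "\<And>\<mu>. \<mu> \<in> words n k \<Longrightarrow> x * Pw \<mu> = c \<mu> *\<^sub>C Pw \<mu>" by metis
  then have "x = (\<Sum>\<mu>\<in>words n k. c \<mu> *\<^sub>C Pw \<mu>)"
    using sum_Pw_right[of x k] by simp
  then show "x \<in> diagonal_level n S k" by (auto simp: diagonal_level_def)
qed

lemma diagonal_level_add:
  "x \<in> diagonal_level n S k \<Longrightarrow> y \<in> diagonal_level n S k \<Longrightarrow> x + y \<in> diagonal_level n S k"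
  unfolding diagonal_level_iff by (fastforce simp: distrib_right simp flip: scaleC_add_left)

lemma diagonal_level_scaleC: "x \<in> diagonal_level n S k \<Longrightarrow> d *\<^sub>C x \<in> diagonal_level n S k"
  unfolding diagonal_level_iff by (fastforce simp: scaleC_mult_left scaleC_scaleC)

lemma diagonal_level_mult:
  "x \<in> diagonal_level n S k \<Longrightarrow> y \<in> diagonal_level n S k \<Longrightarrow> x * y \<in> diagonal_level n S k"
  unfolding diagonal_level_iff by (fastforce simp: mult.assoc scaleC_mult_right scaleC_scaleC)

lemma diagonal_level_sum:
  assumes "\<And>i. i \<in> I \<Longrightarrow> f i \<in> diagonal_level n S k"
  shows "sum f I \<in> diagonal_level n S k"
proof -
  have "0 \<in> diagonal_level n S k" by (auto simp: diagonal_level_iff intro: exI[of _ 0])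
  with assms show ?thesis
    by (induction I rule: infinite_finite_induct) (auto intro: diagonal_level_add)
qed

lemma diagonal_level_adj:
  assumes "x \<in> diagonal_level n S k"
  shows "adj x \<in> diagonal_level n S k"
proof -
  obtain c where "x = (\<Sum>\<mu>\<in>words n k. c \<mu> *\<^sub>C Pw \<mu>)" using assms by (auto simp: diagonal_level_def)
  then have "adj x = (\<Sum>\<mu>\<in>words n k. cnj (c \<mu>) *\<^sub>C Pw \<mu>)" by (simp add: adj_sum adj_scaleC)
  then show ?thesis by (auto simp: diagonal_level_def)
qed

lemma diagonal_level_commute:
  assumes "x \<in> diagonal_level n S k" "y \<in> diagonal_level n S k"
  shows "x * y = y * x"
proof -
  have "x * y * Pw \<mu> = y * x * Pw \<mu>" if m: "\<mu> \<in> words n k" for \<mu>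
  proof -
    obtain c d where "x * Pw \<mu> = c *\<^sub>C Pw \<mu>" "y * Pw \<mu> = d *\<^sub>C Pw \<mu>"
      using assms m unfolding diagonal_level_iff by blast
    then show ?thesis by (simp add: mult.assoc scaleC_mult_right scaleC_scaleC mult.commute)
  qed
  then have "(\<Sum>\<mu>\<in>words n k. x * y * Pw \<mu>) = (\<Sum>\<mu>\<in>words n k. y * x * Pw \<mu>)" by (rule sum.cong[OF refl])
  then show ?thesis by (simp only: sum_Pw_right)
qed

lemma diagonal_level_mono:
  assumes "x \<in> diagonal_level n S k"
  shows "x \<in> diagonal_level n S (k + l)"
  unfolding diagonal_level_iff
proof
  fix \<kappa> assume "\<kappa> \<in> words n (k + l)"
  then obtain \<mu> \<nu> where eq: "\<kappa> = \<mu> @ \<nu>" and m: "\<mu> \<in> words n k" by (meson words_appendE)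
  obtain c where "x * Pw \<mu> = c *\<^sub>C Pw \<mu>" using assms m unfolding diagonal_level_iff by blast
  then have "x * Pw \<kappa> = c *\<^sub>C Pw \<kappa>"
    using m by (simp add: eq Pw_append scaleC_mult_left flip: mult.assoc)
  then show "\<exists>c. x * Pw \<kappa> = c *\<^sub>C Pw \<kappa>" by blast
qed

lemma Pw_diagonal_level: "\<mu> \<in> words n k \<Longrightarrow> Pw \<mu> \<in> diagonal_level n S k"
  unfolding diagonal_level_iff
  by (metis Pw_mult_Pw scaleC_0_left scaleC_1_left)

lemma one_diagonal_level: "1 \<in> diagonal_level n S k"
  by (simp add: diagonal_level_iff) (metis scaleC_1_left)

lemma diagonal_level_S:
  assumes "x \<in> diagonal_level n S k" and i: "i \<in> {1..n}"
  shows "S i * x * adj (S i) \<in> diagonal_level n S (Suc k)"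
  unfolding diagonal_level_iff
proof
  fix \<kappa> assume "\<kappa> \<in> words n (Suc k)"
  then obtain j \<mu> where eq: "\<kappa> = j # \<mu>" and m: "j \<in> {1..n}" "\<mu> \<in> words n k" by (meson words_SucE)
  obtain c where c: "x * Pw \<mu> = c *\<^sub>C Pw \<mu>" using assms m unfolding diagonal_level_iff by blast
  have "S i * x * adj (S i) * Pw \<kappa> = S i * x * (adj (S i) * (S j * (Pw \<mu> * adj (S j))))"
    by (simp add: eq P_word_Cons mult.assoc)
  also have "\<dots> = (if i = j then S i * (x * Pw \<mu>) * adj (S i) else 0)"
    using i m by (simp add: adj_S_mult_S_left mult.assoc)
  also have "\<dots> = (if i = j then c else 0) *\<^sub>C Pw \<kappa>"
    by (simp add: c eq P_word_Cons scaleC_mult_left scaleC_mult_right)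
  finally show "\<exists>c. S i * x * adj (S i) * Pw \<kappa> = c *\<^sub>C Pw \<kappa>" by blast
qed

lemma diagonal_level_adj_S:
  assumes "x \<in> diagonal_level n S (Suc k)" and i: "i \<in> {1..n}"
  shows "adj (S i) * x * S i \<in> diagonal_level n S k"
  unfolding diagonal_level_iff
proof
  fix \<mu> assume m: "\<mu> \<in> words n k"
  obtain c where c: "x * Pw (i # \<mu>) = c *\<^sub>C Pw (i # \<mu>)"
    using assms Cons_words[OF i m] unfolding diagonal_level_iff by blast
  have "adj (S i) * x * S i * Pw \<mu> = adj (S i) * (x * Pw (i # \<mu>)) * S i"
    using i by (simp add: P_word_Cons mult.assoc isometry)
  also have "\<dots> = c *\<^sub>C Pw \<mu>"
    unfolding c using i
    by (simp add: P_word_Cons scaleC_mult_left scaleC_mult_right mult.assoc isometry adj_S_mult_S_left)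
  finally show "\<exists>c. adj (S i) * x * S i * Pw \<mu> = c *\<^sub>C Pw \<mu>" by blast
qed

lemma diagonal_level_shift: "x \<in> diagonal_level n S k \<Longrightarrow> \<phi> x \<in> diagonal_level n S (Suc k)"
  unfolding shift_def by (intro diagonal_level_sum diagonal_level_S)

lemma diagonal_level_shift_pow: "x \<in> diagonal_level n S k \<Longrightarrow> (\<phi> ^^ l) x \<in> diagonal_level n S (l + k)"
  by (induction l) (simp_all add: diagonal_level_shift)

text \<open>If the diagonal is seen as the continuous functions on infinite words, these are the
  functions of finitely many letters. Identities on the diagonal are proved here and extended by
  density at the very end.\<close>

definition alg_diagonal :: "'a set" where
  "alg_diagonal = (\<Union>k. diagonal_level n S k)"

lemma alg_diagonalI: "x \<in> diagonal_level n S k \<Longrightarrow> x \<in> alg_diagonal"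
  by (auto simp: alg_diagonal_def)

lemma alg_diagonal_common_level:
  assumes "x \<in> alg_diagonal" "y \<in> alg_diagonal"
  obtains k where "x \<in> diagonal_level n S k" "y \<in> diagonal_level n S k"
proof -
  obtain k l where "x \<in> diagonal_level n S k" "y \<in> diagonal_level n S l"
    using assms by (auto simp: alg_diagonal_def)
  then show ?thesis
    using that[of "k + l"] diagonal_level_mono[of x k l] diagonal_level_mono[of y l k]
    by (simp add: add.commute)
qed

lemma alg_diagonal_finite_level:
  assumes "finite X" "X \<subseteq> alg_diagonal"
  obtains k where "X \<subseteq> diagonal_level n S k"
proof -
  have "\<exists>k. X \<subseteq> diagonal_level n S k"
    using assms
  proof (induction X)
    case (insert x X)
    then obtain k l where k: "X \<subseteq> diagonal_level n S k" and "x \<in> diagonal_level n S l"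
      by (auto simp: alg_diagonal_def)
    then have "x \<in> diagonal_level n S (k + l)" using diagonal_level_mono[of x l k] by (simp add: add.commute)
    moreover have "X \<subseteq> diagonal_level n S (k + l)" using k diagonal_level_mono by blast
    ultimately show ?case by blast
  qed simp
  then show ?thesis using that by blast
qed

lemma alg_diagonal_commute: "x \<in> alg_diagonal \<Longrightarrow> y \<in> alg_diagonal \<Longrightarrow> x * y = y * x"
  by (metis alg_diagonal_common_level diagonal_level_commute)

lemma alg_diagonal_add: "x \<in> alg_diagonal \<Longrightarrow> y \<in> alg_diagonal \<Longrightarrow> x + y \<in> alg_diagonal"
  by (metis alg_diagonalI alg_diagonal_common_level diagonal_level_add)

lemma alg_diagonal_mult: "x \<in> alg_diagonal \<Longrightarrow> y \<in> alg_diagonal \<Longrightarrow> x * y \<in> alg_diagonal"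
  by (metis alg_diagonalI alg_diagonal_common_level diagonal_level_mult)

lemma alg_diagonal_scaleC: "x \<in> alg_diagonal \<Longrightarrow> c *\<^sub>C x \<in> alg_diagonal"
  using diagonal_level_scaleC by (fastforce simp: alg_diagonal_def)

lemma one_alg_diagonal: "1 \<in> alg_diagonal"
  using one_diagonal_level by (rule alg_diagonalI)

lemma Pw_alg_diagonal: "\<mu> \<in> words n k \<Longrightarrow> Pw \<mu> \<in> alg_diagonal"
  by (rule alg_diagonalI[OF Pw_diagonal_level])

lemma zero_alg_diagonal: "0 \<in> alg_diagonal"
  using alg_diagonal_scaleC[OF one_alg_diagonal, of 0] by simp

lemma alg_diagonal_sum: "(\<And>i. i \<in> I \<Longrightarrow> f i \<in> alg_diagonal) \<Longrightarrow> sum f I \<in> alg_diagonal"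
  by (induction I rule: infinite_finite_induct) (auto simp: zero_alg_diagonal intro: alg_diagonal_add)

lemma alg_diagonal_adj: "x \<in> alg_diagonal \<Longrightarrow> adj x \<in> alg_diagonal"
  using diagonal_level_adj by (fastforce simp: alg_diagonal_def)

lemma alg_diagonal_S: "x \<in> alg_diagonal \<Longrightarrow> i \<in> {1..n} \<Longrightarrow> S i * x * adj (S i) \<in> alg_diagonal"
  unfolding alg_diagonal_def using diagonal_level_S by blast

lemma alg_diagonal_adj_S: "x \<in> alg_diagonal \<Longrightarrow> i \<in> {1..n} \<Longrightarrow> adj (S i) * x * S i \<in> alg_diagonal"
  \<comment> \<open>Compression by a generator deletes a letter, so the level is first raised by 1
    to make it positive.\<close>
  unfolding alg_diagonal_def using diagonal_level_adj_S diagonal_level_mono[of _ _ 1] by fastforce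

lemma alg_diagonal_shift_pow: "x \<in> alg_diagonal \<Longrightarrow> (\<phi> ^^ l) x \<in> alg_diagonal"
  unfolding alg_diagonal_def using diagonal_level_shift_pow by blast

lemma diagonal_eq: "diagonal n S = closure alg_diagonal"
proof
  have "cstar_subalgebra (closure alg_diagonal)"
    by (intro cstar_subalgebra_closure zero_alg_diagonal alg_diagonal_add alg_diagonal_mult
        alg_diagonal_scaleC alg_diagonal_adj)
  moreover have "(\<Union>k. Pw ` words n k) \<subseteq> closure alg_diagonal"
    using Pw_alg_diagonal closure_subset by fastforce
  ultimately show "diagonal n S \<subseteq> closure alg_diagonal"
    unfolding diagonal_def by (intro hull_minimal)
  have D: "cstar_subalgebra (diagonal n S)" by (simp add: diagonal_def cstar_subalgebra_hull)
  have P: "Pw \<mu> \<in> diagonal n S" if "\<mu> \<in> words n k" for \<mu> k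
    using that hull_subset[of "\<Union>k. Pw ` words n k" cstar_subalgebra] by (auto simp: diagonal_def)
  have "diagonal_level n S k \<subseteq> diagonal n S" for k
    by (auto simp: diagonal_level_def intro!: cstar_subalgebra_sum[OF D] cstar_subalgebraD(5)[OF D] P)
  then have "alg_diagonal \<subseteq> diagonal n S" by (auto simp: alg_diagonal_def)
  then show "closure alg_diagonal \<subseteq> diagonal n S"
    using cstar_subalgebraD(1)[OF D] by (rule closure_minimal)
qed

lemma cstar_subalgebra_diagonal: "cstar_subalgebra (diagonal n S)"
  by (simp add: diagonal_def cstar_subalgebra_hull)

lemma alg_diagonal_subset: "alg_diagonal \<subseteq> diagonal n S"
  unfolding diagonal_eq by (rule closure_subset)

lemma one_diagonal: "1 \<in> diagonal n S"
  using one_alg_diagonal alg_diagonal_subset by blast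

lemma diagonal_subset_core: "diagonal n S \<subseteq> core n S"
proof -
  have "(\<Union>k. Pw ` words n k) \<subseteq> core n S"
    using core_level_matrix_unit core_level_subset_core by (fastforce simp: P_word_def)
  then show ?thesis
    unfolding diagonal_def by (intro hull_minimal cstar_subalgebra_core)
qed

lemma diagonal_commute_Pw:
  assumes "x \<in> diagonal n S" "\<mu> \<in> words n k"
  shows "x * Pw \<mu> = Pw \<mu> * x"
proof -
  obtain f where f: "\<And>m. f m \<in> alg_diagonal" "f \<longlonglongrightarrow> x"
    by (rule closure_sequentialE[OF assms(1)[unfolded diagonal_eq]], rule that)
  have "(\<lambda>m. f m * Pw \<mu>) \<longlonglongrightarrow> x * Pw \<mu>" "(\<lambda>m. Pw \<mu> * f m) \<longlonglongrightarrow> Pw \<mu> * x"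
    by (intro tendsto_mult f(2) tendsto_const)+
  moreover have "f m * Pw \<mu> = Pw \<mu> * f m" for m
    using f(1) Pw_alg_diagonal[OF assms(2)] by (rule alg_diagonal_commute)
  ultimately show ?thesis using LIMSEQ_unique by fastforce
qed

text \<open>If \<open>p\<close> is close to an element of level \<open>k\<close>, then each subprojection \<open>p P\<^sub>\<mu>\<close> of \<open>P\<^sub>\<mu>\<close> is
  close to a scalar multiple of \<open>P\<^sub>\<mu>\<close>, hence trivial.\<close>

lemma diagonal_projection:
  assumes p: "p \<in> diagonal n S" "adj p = p" "p * p = p"
  shows "p \<in> alg_diagonal"
proof -
  have "\<forall>e>0. \<exists>x\<in>alg_diagonal. dist x p < e"
    using p(1) unfolding diagonal_eq closure_approachable .
  \<comment> \<open>Why 1/2: if neither \<open>p * Pw \<mu>\<close> nor its complement in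
    \<open>Pw \<mu>\<close> were 0, the scalar \<open>c\<close> below would be at distance less than
    1/2 from both 1 and 0.\<close>
  from this[rule_format, of "1 / 2"] obtain x where "x \<in> alg_diagonal" and px: "norm (p - x) < 1 / 2"
    by (auto simp: dist_norm norm_minus_commute)
  then obtain k where x: "x \<in> diagonal_level n S k" by (auto simp: alg_diagonal_def)
  have "\<exists>c. p * Pw \<mu> = c *\<^sub>C Pw \<mu>" if m: "\<mu> \<in> words n k" for \<mu>
  proof -
    obtain c where c: "x * Pw \<mu> = c *\<^sub>C Pw \<mu>" using x m unfolding diagonal_level_iff by blast
    have PP: "Pw \<mu> * Pw \<mu> = Pw \<mu>" using Pw_mult_Pw[OF m m] by simp
    have comm: "p * Pw \<mu> = Pw \<mu> * p" using diagonal_commute_Pw[OF p(1) m] .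
    define e where "e = p * Pw \<mu>"
    define d where "d = Pw \<mu> - e"
    have ee: "e * e = e" "adj e = e"
    proof -
      have "e * e = p * (Pw \<mu> * p) * Pw \<mu>" by (simp add: e_def mult.assoc)
      also have "\<dots> = (p * p) * (Pw \<mu> * Pw \<mu>)" by (simp add: comm[symmetric] mult.assoc)
      finally show "e * e = e" by (simp add: PP p(3) e_def)
      show "adj e = e" by (simp add: e_def adj_mult p(2) comm)
    qed
    have eP: "e * Pw \<mu> = e" "Pw \<mu> * e = e"
      by (simp_all add: e_def mult.assoc PP) (simp_all add: comm PP flip: mult.assoc)
    have dd: "d * d = d" "adj d = d"
      using ee eP PP by (simp_all add: d_def adj_diff algebra_simps)
    have near: "norm (e - c *\<^sub>C Pw \<mu>) < 1 / 2"
    proof -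
      have "e - c *\<^sub>C Pw \<mu> = (p - x) * Pw \<mu>" by (simp add: e_def c left_diff_distrib)
      also have "norm \<dots> \<le> norm (p - x) * 1"
        by (intro order_trans[OF norm_mult_ineq] mult_left_mono norm_projection_le) (simp_all add: PP)
      finally show ?thesis using px by simp
    qed
    have "e = 0 \<or> d = 0"
    proof (rule ccontr)
      assume "\<not> (e = 0 \<or> d = 0)"
      then have ne: "norm e = 1" "norm d = 1" using norm_projection_eq ee dd by blast+
      have "(1 - c) *\<^sub>C e = e * (e - c *\<^sub>C Pw \<mu>)"
        by (simp add: right_diff_distrib ee eP scaleC_mult_right)
          (metis diff_conv_add_uminus scaleC_1_left scaleC_add_left scaleC_minus1_left scaleC_scaleC mult_minus1)
      then have "cmod (1 - c) \<le> norm e * norm (e - c *\<^sub>C Pw \<mu>)"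
        using norm_mult_ineq[of e "e - c *\<^sub>C Pw \<mu>"] ne by (metis norm_scaleC mult_1_right)
      then have c1: "cmod (1 - c) < 1/2" using near ne by simp
      have "(- c) *\<^sub>C d = d * (e - c *\<^sub>C Pw \<mu>)"
        using ee eP PP by (simp add: d_def algebra_simps scaleC_mult_right)
          (metis scaleC_minus1_left scaleC_scaleC mult_minus1 scaleC_diff_right)
      then have "cmod c \<le> norm d * norm (e - c *\<^sub>C Pw \<mu>)"
        using norm_mult_ineq[of d "e - c *\<^sub>C Pw \<mu>"] ne by (metis norm_scaleC norm_minus_cancel mult_1_right)
      then have c0: "cmod c < 1/2" using near ne by simp
      have "1 \<le> cmod (1 - c) + cmod c" using norm_triangle_ineq[of "1 - c" c] by simp
      then show False using c0 c1 by simp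
    qed
    then have "p * Pw \<mu> = 0 *\<^sub>C Pw \<mu> \<or> p * Pw \<mu> = 1 *\<^sub>C Pw \<mu>"
      by (auto simp: e_def[symmetric] d_def)
    then show ?thesis by blast
  qed
  then have "p \<in> diagonal_level n S k" by (simp add: diagonal_level_iff)
  then show ?thesis by (rule alg_diagonalI)
qed

end

subsection \<open>Cuntz's uniqueness theorem\<close>

text \<open>A list of triples \<open>(c, \<mu>, \<nu>)\<close> stands for the *-polynomial with terms \<open>c S\<^sub>\<mu> S\<^sub>\<nu>\<^sup>*\<close>, which can
  be evaluated in every Cuntz family.\<close>

type_synonym monomial = "complex \<times> nat list \<times> nat list"

fun ev_monomial :: "(nat \<Rightarrow> 'a::cstar_algebra) \<Rightarrow> monomial \<Rightarrow> 'a" where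
  "ev_monomial S (c, \<mu>, \<nu>) = c *\<^sub>C (S_word S \<mu> * adj (S_word S \<nu>))"

definition ev :: "(nat \<Rightarrow> 'a::cstar_algebra) \<Rightarrow> monomial list \<Rightarrow> 'a" where
  "ev S xs = sum_list (map (ev_monomial S) xs)"

text \<open>The weight under the gauge action: multiplying every generator by a scalar z of modulus
  1 multiplies the term by z to this power.\<close>

fun gauge_degree :: "monomial \<Rightarrow> int" where
  "gauge_degree (c, \<mu>, \<nu>) = int (length \<mu>) - int (length \<nu>)"

fun monomial_adj :: "monomial \<Rightarrow> monomial" where
  "monomial_adj (c, \<mu>, \<nu>) = (cnj c, \<nu>, \<mu>)"

fun monomial_scale :: "complex \<Rightarrow> monomial \<Rightarrow> monomial" where
  "monomial_scale d (c, \<mu>, \<nu>) = (d * c, \<mu>, \<nu>)"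

text \<open>The middle factor \<open>adj (S_word S \<nu>) * S_word S \<alpha>\<close> cancels a
  common prefix and is 0 unless one word is a prefix of the other. The \<open>take\<close> tests
  include the comparison of lengths, and the empty list stands for 0.\<close>

fun monomial_mult :: "monomial \<Rightarrow> monomial \<Rightarrow> monomial list" where
  "monomial_mult (c, \<mu>, \<nu>) (d, \<alpha>, \<beta>) =
     (if take (length \<nu>) \<alpha> = \<nu> then [(c * d, \<mu> @ drop (length \<nu>) \<alpha>, \<beta>)]
      else if take (length \<alpha>) \<nu> = \<alpha> then [(c * d, \<mu>, \<beta> @ drop (length \<alpha>) \<nu>)]
      else [])"

definition poly_mult :: "monomial list \<Rightarrow> monomial list \<Rightarrow> monomial list" where
  "poly_mult xs ys = concat (map (\<lambda>x. concat (map (monomial_mult x) ys)) xs)"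

text \<open>For a polynomial p this is \<open>(adj p * p) ^ 2 ^ m\<close> by repeated squaring, done
  formally so that the same list can be evaluated in two Cuntz families.\<close>

fun gram_power :: "monomial list \<Rightarrow> nat \<Rightarrow> monomial list" where
  "gram_power xs 0 = poly_mult (map monomial_adj xs) xs"
| "gram_power xs (Suc m) = poly_mult (gram_power xs m) (gram_power xs m)"

fun letters_in :: "nat \<Rightarrow> monomial \<Rightarrow> bool" where
  "letters_in n (c, \<mu>, \<nu>) \<longleftrightarrow> set \<mu> \<subseteq> {1..n} \<and> set \<nu> \<subseteq> {1..n}"

abbreviation polynomials :: "nat \<Rightarrow> monomial list set" where
  "polynomials n \<equiv> {xs. \<forall>m\<in>set xs. letters_in n m}"

abbreviation polynomials_upto :: "nat \<Rightarrow> nat \<Rightarrow> monomial list set" where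
  "polynomials_upto n d \<equiv> {xs \<in> polynomials n. \<forall>m\<in>set xs. \<bar>gauge_degree m\<bar> \<le> int d}"

fun matrix_monomial :: "nat \<Rightarrow> monomial \<Rightarrow> bool" where
  "matrix_monomial K (c, \<mu>, \<nu>) \<longleftrightarrow> length \<mu> = length \<nu> \<and> length \<nu> \<le> K"

abbreviation matrix_polynomials :: "nat \<Rightarrow> nat \<Rightarrow> monomial list set" where
  "matrix_polynomials n K \<equiv> {xs \<in> polynomials n. \<forall>m\<in>set xs. matrix_monomial K m}"

section \<open>Formal arithmetic of *-polynomials\<close>

lemma ev_Nil [simp]: "ev S [] = 0"
  and ev_Cons: "ev S (x # xs) = ev_monomial S x + ev S xs"
  and ev_append: "ev S (xs @ ys) = ev S xs + ev S ys"
  by (simp_all add: ev_def)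

lemma ev_adj: "ev S (map monomial_adj xs) = adj (ev S xs)"
proof -
  have "ev_monomial S (monomial_adj x) = adj (ev_monomial S x)" for x
    by (cases x) (simp add: adj_scaleC adj_mult adj_adj)
  then show ?thesis by (induction xs) (simp_all add: ev_Cons adj_add)
qed

lemma ev_scale: "ev S (map (monomial_scale d) xs) = d *\<^sub>C ev S xs"
proof -
  have "ev_monomial S (monomial_scale d x) = d *\<^sub>C ev_monomial S x" for x
    by (cases x) (simp add: scaleC_scaleC)
  then show ?thesis by (induction xs) (simp_all add: ev_Cons scaleC_add_right)
qed

lemma set_poly_mult: "set (poly_mult xs ys) = (\<Union>x\<in>set xs. \<Union>y\<in>set ys. set (monomial_mult x y))"
  by (auto simp: poly_mult_def)

lemma letters_in_monomial_mult:
  "letters_in n x \<Longrightarrow> letters_in n y \<Longrightarrow> m \<in> set (monomial_mult x y) \<Longrightarrow> letters_in n m"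
  by (cases x; cases y) (auto split: if_splits dest: in_set_dropD)

lemma gauge_degree_monomial_mult:
  assumes "m \<in> set (monomial_mult x y)"
  shows "gauge_degree m = gauge_degree x + gauge_degree y"
proof -
  obtain c \<mu> \<nu> d \<alpha> \<beta> where [simp]: "x = (c, \<mu>, \<nu>)" "y = (d, \<alpha>, \<beta>)" by (cases x; cases y) auto
  have "length \<nu> \<le> length \<alpha>" if "take (length \<nu>) \<alpha> = \<nu>"
    using arg_cong[OF that, of length] by simp
  moreover have "length \<alpha> \<le> length \<nu>" if "take (length \<alpha>) \<nu> = \<alpha>"
    using arg_cong[OF that, of length] by simp
  ultimately show ?thesis using assms by (auto split: if_splits simp: of_nat_diff)
qed

lemma matrix_monomial_mult:
  assumes "matrix_monomial K x" "matrix_monomial K y" "m \<in> set (monomial_mult x y)"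
  shows "matrix_monomial K m"
proof -
  obtain c \<mu> \<nu> d \<alpha> \<beta> where [simp]: "x = (c, \<mu>, \<nu>)" "y = (d, \<alpha>, \<beta>)" by (cases x; cases y) auto
  have "length \<nu> \<le> length \<alpha>" if "take (length \<nu>) \<alpha> = \<nu>"
    using arg_cong[OF that, of length] by simp
  moreover have "length \<alpha> \<le> length \<nu>" if "take (length \<alpha>) \<nu> = \<alpha>"
    using arg_cong[OF that, of length] by simp
  ultimately show ?thesis using assms by (auto split: if_splits)
qed

lemma letters_in_adj [simp]: "letters_in n (monomial_adj x) \<longleftrightarrow> letters_in n x"
  by (cases x) auto

lemma letters_in_scale [simp]: "letters_in n (monomial_scale c x) \<longleftrightarrow> letters_in n x"
  by (cases x) auto

lemma gauge_degree_adj [simp]: "gauge_degree (monomial_adj x) = - gauge_degree x"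
  by (cases x) auto

lemma matrix_monomial_adj [simp]: "matrix_monomial K (monomial_adj x) \<longleftrightarrow> matrix_monomial K x"
  by (cases x) auto

lemma poly_mult_polynomials:
  "xs \<in> polynomials n \<Longrightarrow> ys \<in> polynomials n \<Longrightarrow> poly_mult xs ys \<in> polynomials n"
  by (auto simp: set_poly_mult dest: letters_in_monomial_mult)

lemma poly_mult_upto:
  assumes "xs \<in> polynomials_upto n d" "ys \<in> polynomials_upto n e"
  shows "poly_mult xs ys \<in> polynomials_upto n (d + e)"
proof -
  have "\<bar>gauge_degree m\<bar> \<le> int (d + e)" if m: "m \<in> set (poly_mult xs ys)" for m
  proof -
    obtain x y where xy: "x \<in> set xs" "y \<in> set ys" "m \<in> set (monomial_mult x y)"
      using m unfolding set_poly_mult by blast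
    then have "\<bar>gauge_degree x\<bar> \<le> int d" "\<bar>gauge_degree y\<bar> \<le> int e" using assms by auto
    then show ?thesis using gauge_degree_monomial_mult[OF xy(3)] by simp
  qed
  then show ?thesis using assms poly_mult_polynomials[of xs n ys] by simp
qed

lemma gram_power_polynomials: "xs \<in> polynomials n \<Longrightarrow> gram_power xs m \<in> polynomials n"
  by (induction m) (simp_all only: gram_power.simps poly_mult_polynomials, intro poly_mult_polynomials, auto)

lemma gram_power_upto:
  assumes "xs \<in> polynomials_upto n d"
  shows "gram_power xs m \<in> polynomials_upto n (2 * d * 2 ^ m)"
proof (induction m)
  case 0
  have "map monomial_adj xs \<in> polynomials_upto n d" using assms by simp
  from poly_mult_upto[OF this assms] show ?case
    by (simp only: gram_power.simps mult_2 power_0 mult_1_right)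
next
  case (Suc m)
  have "2 * d * 2 ^ Suc m = 2 * d * 2 ^ m + 2 * d * 2 ^ m" by simp
  with poly_mult_upto[OF Suc Suc] show ?case by (simp only: gram_power.simps)
qed

lemma gram_power_matrix:
  assumes "xs \<in> matrix_polynomials n K"
  shows "gram_power xs m \<in> matrix_polynomials n K"
proof -
  have mult: "poly_mult ys zs \<in> matrix_polynomials n K"
    if "ys \<in> matrix_polynomials n K" "zs \<in> matrix_polynomials n K" for ys zs
  proof -
    have "matrix_monomial K m" if k: "m \<in> set (poly_mult ys zs)" for m
    proof -
      obtain y z where m: "y \<in> set ys" "z \<in> set zs" "m \<in> set (monomial_mult y z)"
        using k unfolding set_poly_mult by blast
      show ?thesis
        by (rule matrix_monomial_mult[OF _ _ m(3)]) (use m \<open>ys \<in> _\<close> \<open>zs \<in> _\<close> in auto)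
    qed
    then show ?thesis using poly_mult_polynomials[of ys n zs] that by blast
  qed
  show ?thesis
  proof (induction m)
    case 0
    have "map monomial_adj xs \<in> matrix_polynomials n K" using assms by simp
    from mult[OF this assms] show ?case by (simp only: gram_power.simps)
  next
    case (Suc m)
    from mult[OF Suc Suc] show ?case by (simp only: gram_power.simps)
  qed
qed

text \<open>The entry at row \<mu> and column \<nu> of a matrix polynomial: a term contributes
  exactly when \<mu> and \<nu> extend its two words by the same tail. No Cuntz family occurs in it,
  which is what makes two families comparable.\<close>

definition matrix_coefficient :: "nat list \<Rightarrow> nat list \<Rightarrow> monomial list \<Rightarrow> complex" where
  "matrix_coefficient \<mu> \<nu> xs =
    (\<Sum>(c, \<alpha>, \<beta>)\<leftarrow>xs. if take (length \<alpha>) \<mu> = \<alpha> \<and> take (length \<beta>) \<nu> = \<beta> \<and>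
        drop (length \<alpha>) \<mu> = drop (length \<beta>) \<nu> then c else 0)"

context cuntz_family
begin

lemma adj_Sw_mult_Sw_general:
  assumes "set \<nu> \<subseteq> {1..n}" "set \<alpha> \<subseteq> {1..n}"
  shows "adj (Sw \<nu>) * Sw \<alpha> =
    (if take (length \<nu>) \<alpha> = \<nu> then Sw (drop (length \<nu>) \<alpha>)
     else if take (length \<alpha>) \<nu> = \<alpha> then adj (Sw (drop (length \<alpha>) \<nu>)) else 0)"
proof -
  have prefix: "adj (Sw \<nu>) * Sw \<alpha> = (if take (length \<nu>) \<alpha> = \<nu> then Sw (drop (length \<nu>) \<alpha>) else 0)"
    if "set \<nu> \<subseteq> {1..n}" "set \<alpha> \<subseteq> {1..n}" "length \<nu> \<le> length \<alpha>" for \<nu> \<alpha>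
  proof -
    define \<alpha>1 \<alpha>2 where "\<alpha>1 = take (length \<nu>) \<alpha>" and "\<alpha>2 = drop (length \<nu>) \<alpha>"
    have "\<nu> \<in> words n (length \<nu>)" "\<alpha>1 \<in> words n (length \<nu>)"
      using that by (auto simp: words_def \<alpha>1_def dest: in_set_takeD)
    then have "adj (Sw \<nu>) * (Sw \<alpha>1 * Sw \<alpha>2) = (if \<nu> = \<alpha>1 then Sw \<alpha>2 else 0)"
      by (rule adj_Sw_mult_Sw_left)
    moreover have "Sw \<alpha> = Sw \<alpha>1 * Sw \<alpha>2" by (simp add: \<alpha>1_def \<alpha>2_def flip: S_word_append)
    ultimately show ?thesis
      unfolding \<alpha>1_def[symmetric] \<alpha>2_def[symmetric] by (cases "\<nu> = \<alpha>1") simp_all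
  qed
  show ?thesis
  proof (cases "length \<nu> \<le> length \<alpha>")
    case True
    then show ?thesis using prefix[OF assms True] by auto
  next
    case False
    then have "length \<alpha> \<le> length \<nu>" by simp
    from arg_cong[OF prefix[OF assms(2,1) this], of adj] show ?thesis
      using False by (auto simp: adj_mult adj_adj)
  qed
qed

lemma ev_monomial_mult:
  assumes "letters_in n x" "letters_in n y"
  shows "ev S (monomial_mult x y) = ev_monomial S x * ev_monomial S y"
proof -
  obtain c \<mu> \<nu> d \<alpha> \<beta> where [simp]: "x = (c, \<mu>, \<nu>)" "y = (d, \<alpha>, \<beta>)" by (cases x; cases y) auto
  have "ev_monomial S x * ev_monomial S y = (c * d) *\<^sub>C (Sw \<mu> * (adj (Sw \<nu>) * Sw \<alpha>) * adj (Sw \<beta>))"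
    by (simp add: scaleC_mult_left scaleC_mult_right scaleC_scaleC mult.assoc mult.commute)
  moreover have "adj (Sw \<nu>) * Sw \<alpha> =
    (if take (length \<nu>) \<alpha> = \<nu> then Sw (drop (length \<nu>) \<alpha>)
     else if take (length \<alpha>) \<nu> = \<alpha> then adj (Sw (drop (length \<alpha>) \<nu>)) else 0)"
    using assms by (intro adj_Sw_mult_Sw_general) auto
  ultimately show ?thesis
    by (simp split del: if_split) (simp add: ev_Cons S_word_append adj_mult mult.assoc)
qed

lemma ev_poly_mult:
  assumes "xs \<in> polynomials n" "ys \<in> polynomials n"
  shows "ev S (poly_mult xs ys) = ev S xs * ev S ys"
proof -
  have single: "ev S (concat (map (monomial_mult x) ys)) = ev_monomial S x * ev S ys"
    if "letters_in n x" for x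
    using that assms(2)
    by (induction ys) (simp_all add: ev_append ev_Cons ev_monomial_mult distrib_left)
  show ?thesis using assms(1)
    by (induction xs) (simp_all add: poly_mult_def ev_append ev_Cons single distrib_right)
qed

lemma norm_ev_gram_power:
  assumes "xs \<in> polynomials n"
  shows "norm (ev S (gram_power xs m)) = ((norm (ev S xs))\<^sup>2) ^ 2 ^ m"
proof -
  have "ev S (gram_power xs m) = (adj (ev S xs) * ev S xs) ^ 2 ^ m"
  proof (induction m)
    case 0
    have "map monomial_adj xs \<in> polynomials n" using assms by simp
    from ev_poly_mult[OF this assms] show ?case by (simp add: ev_adj)
  next
    case (Suc m)
    then show ?case
      using ev_poly_mult[OF gram_power_polynomials gram_power_polynomials, OF assms assms]
      by (simp add: power_add[symmetric] mult_2)
  qed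
  moreover have "adj (adj (ev S xs) * ev S xs) = adj (ev S xs) * ev S xs"
    by (simp add: adj_mult adj_adj)
  ultimately show ?thesis using norm_self_adjoint_power2 cstar_identity by metis
qed

lemma norm_Sw: "set \<mu> \<subseteq> {1..n} \<Longrightarrow> norm (Sw \<mu>) = 1"
  using norm_isometry Sw_isometry[of \<mu> "length \<mu>"] by (auto simp: words_def)

lemma ev_matrix_coefficient:
  assumes xs: "xs \<in> matrix_polynomials n K" and m: "\<mu> \<in> words n K" "\<nu> \<in> words n K"
  shows "adj (Sw \<mu>) * ev S xs * Sw \<nu> = matrix_coefficient \<mu> \<nu> xs *\<^sub>C 1"
  using xs
proof (induction xs)
  case (Cons x xs)
  obtain c \<alpha> \<beta> where [simp]: "x = (c, \<alpha>, \<beta>)" by (cases x) auto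
  have len: "length \<alpha> = length \<beta>" "length \<beta> \<le> K" "set \<alpha> \<subseteq> {1..n}" "set \<beta> \<subseteq> {1..n}"
    using Cons.prems by auto
  define r where "r = K - length \<beta>"
  have w: "\<alpha> \<in> words n (length \<beta>)" "\<beta> \<in> words n (length \<beta>)"
      "take (length \<beta>) \<mu> \<in> words n (length \<beta>)" "take (length \<beta>) \<nu> \<in> words n (length \<beta>)"
      "drop (length \<beta>) \<mu> \<in> words n r" "drop (length \<beta>) \<nu> \<in> words n r"
    using len m by (auto simp: words_def r_def dest: in_set_takeD in_set_dropD)
  have left: "adj (Sw \<mu>) * Sw \<alpha> = (if take (length \<beta>) \<mu> = \<alpha> then adj (Sw (drop (length \<beta>) \<mu>)) else 0)"
  proof -
    have "adj (Sw \<mu>) = adj (Sw (drop (length \<beta>) \<mu>)) * adj (Sw (take (length \<beta>) \<mu>))"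
      by (metis S_word_append adj_mult append_take_drop_id)
    then show ?thesis by (simp add: mult.assoc adj_Sw_mult_Sw[OF w(3) w(1)])
  qed
  have right: "adj (Sw \<beta>) * Sw \<nu> = (if take (length \<beta>) \<nu> = \<beta> then Sw (drop (length \<beta>) \<nu>) else 0)"
  proof -
    have "Sw \<nu> = Sw (take (length \<beta>) \<nu>) * Sw (drop (length \<beta>) \<nu>)"
      by (metis S_word_append append_take_drop_id)
    then show ?thesis by (auto simp: adj_Sw_mult_Sw_left[OF w(2) w(4)])
  qed
  have "adj (Sw \<mu>) * ev_monomial S x * Sw \<nu> = c *\<^sub>C ((adj (Sw \<mu>) * Sw \<alpha>) * (adj (Sw \<beta>) * Sw \<nu>))"
    by (simp add: scaleC_mult_left scaleC_mult_right mult.assoc)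
  also have "\<dots> = (if take (length \<alpha>) \<mu> = \<alpha> \<and> take (length \<beta>) \<nu> = \<beta> \<and>
        drop (length \<alpha>) \<mu> = drop (length \<beta>) \<nu> then c else 0) *\<^sub>C 1"
    using len(1) by (simp add: left right adj_Sw_mult_Sw[OF w(5) w(6)] Sw_isometry[OF w(6)])
  finally show ?case using Cons
    by (simp add: matrix_coefficient_def ev_Cons distrib_left distrib_right scaleC_add_left)
qed (simp add: matrix_coefficient_def)

end

text \<open>The constant is independent of \<open>m\<close> for matrices of a fixed level, because Gram powers
  preserve the level, and linear in the degree in general.\<close>

lemma norm_ev_le_of_growth:
  fixes S :: "nat \<Rightarrow> 'a::cstar_algebra" and T :: "nat \<Rightarrow> 'b::cstar_algebra"
  assumes S: "cuntz_family n S" and T: "cuntz_family n T" and xs: "xs \<in> polynomials n"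
    and le: "\<And>m. norm (ev T (gram_power xs m)) \<le> (A * 2 ^ m + B) * norm (ev S (gram_power xs m))"
  shows "norm (ev T xs) \<le> norm (ev S xs)"
proof -
  have "(norm (ev T xs))\<^sup>2 \<le> (norm (ev S xs))\<^sup>2"
  proof (rule power_trick[where A = A and B = B])
    show "((norm (ev T xs))\<^sup>2) ^ 2 ^ m \<le> (A * 2 ^ m + B) * ((norm (ev S xs))\<^sup>2) ^ 2 ^ m" for m
      using le[of m]
      by (simp only: cuntz_family.norm_ev_gram_power[OF S xs] cuntz_family.norm_ev_gram_power[OF T xs])
  qed simp_all
  then show ?thesis by (rule power2_le_imp_le) simp
qed

lemma norm_ev_matrix_le:
  fixes S :: "nat \<Rightarrow> 'a::cstar_algebra" and T :: "nat \<Rightarrow> 'b::cstar_algebra"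
  assumes S: "cuntz_family n S" and T: "cuntz_family n T" and xs: "xs \<in> matrix_polynomials n K"
  shows "norm (ev T xs) \<le> norm (ev S xs)"
proof -
  interpret S: cuntz_family n S by fact
  interpret T: cuntz_family n T by fact
  \<comment> \<open>The number of matrix entries. Each entry is the same scalar in both families and
    is bounded by the norm in \<open>S\<close>, so summing over all entries costs the factor
    \<open>N\<close>.\<close>
  define N where "N = real (card (words n K)) * real (card (words n K))"
  have crude: "norm (ev T ys) \<le> N * norm (ev S ys)" if ys: "ys \<in> matrix_polynomials n K" for ys
  proof -
    have term_le: "norm (S_word T \<mu> * (adj (S_word T \<mu>) * ev T ys * S_word T \<nu>) * adj (S_word T \<nu>))
        \<le> norm (ev S ys)" if m: "\<mu> \<in> words n K" "\<nu> \<in> words n K" for \<mu> \<nu>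
    proof -
      let ?c = "matrix_coefficient \<mu> \<nu> ys"
      have nT: "norm (S_word T \<mu>) = 1" "norm (S_word T \<nu>) = 1"
        using m by (auto intro!: T.norm_Sw simp: words_def)
      have nS: "norm (S_word S \<mu>) = 1" "norm (S_word S \<nu>) = 1"
        using m by (auto intro!: S.norm_Sw simp: words_def)
      have "S_word T \<mu> * (adj (S_word T \<mu>) * ev T ys * S_word T \<nu>) * adj (S_word T \<nu>)
          = ?c *\<^sub>C (S_word T \<mu> * adj (S_word T \<nu>))"
        unfolding T.ev_matrix_coefficient[OF ys m] by (simp add: scaleC_mult_left scaleC_mult_right)
      also have "norm \<dots> \<le> cmod ?c"
        using norm_mult_ineq[of "S_word T \<mu>" "adj (S_word T \<nu>)"] nT
        by (simp add: norm_scaleC mult_left_le)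
      also have "\<dots> = norm (adj (S_word S \<mu>) * ev S ys * S_word S \<nu>)"
        unfolding S.ev_matrix_coefficient[OF ys m] by (simp add: norm_scaleC)
      also have "\<dots> \<le> norm (adj (S_word S \<mu>)) * norm (ev S ys) * norm (S_word S \<nu>)"
        by (meson norm_mult_ineq mult_right_mono norm_ge_zero order_trans)
      finally show ?thesis using nS by simp
    qed
    have "norm (ev T ys) \<le> (\<Sum>\<mu>\<in>words n K. \<Sum>\<nu>\<in>words n K. norm (ev S ys))"
      by (subst T.matrix_decomposition[of _ K]) (intro sum_norm_le term_le)
    also have "\<dots> = N * norm (ev S ys)" by (simp add: N_def)
    finally show ?thesis .
  qed
  show ?thesis
  proof (rule norm_ev_le_of_growth[OF S T, where A = 0 and B = N])
    show "xs \<in> polynomials n" using xs by blast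
    show "norm (ev T (gram_power xs m)) \<le> (0 * 2 ^ m + N) * norm (ev S (gram_power xs m))" for m
      using crude[OF gram_power_matrix[OF xs]] by (simp only: mult_zero_left add_0_left)
  qed
qed

context cuntz_family
begin

text \<open>\<open>W = \<phi>\<^sup>K(S\<^sub>\<gamma>)\<close> is an isometry commuting with the matrices of level \<open>K\<close>, and \<open>\<gamma>\<close> is
  chosen such that \<open>W\<^sup>* x W = 0\<close> for monomials \<open>x\<close> of nonzero degree.\<close>

lemma norm_ev_degree_0_le:
  assumes n: "n \<ge> 2" and xs: "xs \<in> polynomials n"
  shows "norm (ev S (filter (\<lambda>m. gauge_degree m = 0) xs)) \<le> norm (ev S xs)"
proof -
  \<comment> \<open>A crude bound for the length of every word occurring in
    \<open>xs\<close>.\<close>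
  define K where "K = sum_list (map (\<lambda>(c, \<mu>, \<nu>). length \<mu> + length \<nu>) xs)"
  \<comment> \<open>A word without self-overlap: deleting 1 to \<open>K\<close> letters in front
    leaves a suffix ending in 2, while the prefix of \<open>\<gamma>\<close> of that length consists
    of 1s only. Two distinct letters are used here.\<close>
  define \<gamma> where "\<gamma> = replicate K 1 @ [2::nat]"
  define W where "W = (\<phi> ^^ K) (Sw \<gamma>)"
  have \<gamma>w: "\<gamma> \<in> words n (Suc K)" using n by (auto simp: \<gamma>_def words_def)
  have disj: "adj ((\<phi> ^^ j) (Sw \<gamma>)) * Sw \<gamma> = 0" if j: "1 \<le> j" "j \<le> K" for j
  proof -
    define \<alpha> where "\<alpha> = replicate (K - j) 1 @ [2::nat]"
    define \<beta> where "\<beta> = replicate (j - 1) 1 @ [2::nat]"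
    define \<delta> where "\<delta> = replicate (Suc (K - j)) (1::nat)"
    have 1: "\<gamma> = replicate j 1 @ \<alpha>" using j by (simp add: \<gamma>_def \<alpha>_def replicate_add[symmetric])
    have 2: "\<gamma> = \<delta> @ \<beta>"
      using j unfolding \<gamma>_def \<beta>_def \<delta>_def append_assoc[symmetric] replicate_add[symmetric] by simp
    have w: "replicate j 1 \<in> words n j" "\<delta> \<in> words n (Suc (K - j))" "\<alpha> \<in> words n (Suc (K - j))"
      using n by (auto simp: words_def \<alpha>_def \<delta>_def)
    have "\<delta> \<noteq> \<alpha>"
    proof
      assume "\<delta> = \<alpha>"
      then have "last \<delta> = last \<alpha>" by (rule arg_cong)
      then show False by (simp add: \<alpha>_def \<delta>_def last_replicate del: replicate.simps)
    qed
    then have e3: "adj (Sw \<gamma>) * Sw \<alpha> = 0"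
      by (simp add: 2 S_word_append adj_mult mult.assoc adj_Sw_mult_Sw[OF w(2) w(3)])
    have e1: "adj ((\<phi> ^^ j) (Sw \<gamma>)) * Sw \<gamma> = (\<phi> ^^ j) (adj (Sw \<gamma>)) * Sw (replicate j 1) * Sw \<alpha>"
      by (subst (2) 1) (simp add: S_word_append shift_pow_adj mult.assoc)
    show ?thesis
      unfolding e1 shift_pow_mult_Sw[OF w(1)] mult.assoc e3 by simp
  qed
  have \<gamma>1: "adj (Sw \<gamma>) * Sw \<gamma> = 1" by (rule Sw_isometry[OF \<gamma>w])
  have E: "adj ((\<phi> ^^ a) (Sw \<gamma>)) * (\<phi> ^^ b) (Sw \<gamma>) = (if a = b then 1 else 0)"
    if "a \<le> K" "b \<le> K" for a b
  proof -
    have 0: "(\<phi> ^^ k) 0 = 0" for k using shift_pow_add[of k 0 0] by simp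
    have less: "adj ((\<phi> ^^ a) (Sw \<gamma>)) * (\<phi> ^^ b) (Sw \<gamma>) = 0" if "b < a" "a \<le> K" for a b
    proof -
      have a: "(\<phi> ^^ a) x = (\<phi> ^^ b) ((\<phi> ^^ (a - b)) x)" for x
        using that funpow_add[of b "a - b" \<phi>] by simp
      have "adj ((\<phi> ^^ a) (Sw \<gamma>)) * (\<phi> ^^ b) (Sw \<gamma>) = (\<phi> ^^ b) (adj ((\<phi> ^^ (a - b)) (Sw \<gamma>)) * Sw \<gamma>)"
        by (simp add: a shift_pow_mult shift_pow_adj)
      then show ?thesis using disj[of "a - b"] that 0 by simp
    qed
    consider "a = b" | "b < a" | "a < b" by linarith
    then show ?thesis
    proof cases
      case 1
      then show ?thesis using \<gamma>1 by (simp flip: shift_pow_mult shift_pow_adj add: shift_pow_1)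
    next
      case 3
      from arg_cong[OF less[OF 3 \<open>b \<le> K\<close>], of adj] show ?thesis using 3 by (simp add: adj_mult adj_adj)
    qed (use less that in simp)
  qed
  \<comment> \<open>Pulling \<open>W\<close> through the two words lowers the shift exponent
    \<open>K\<close> by their lengths. By \<open>E\<close> the two remaining isometries have
    orthogonal ranges unless the lengths agree, and then they cancel.\<close>
  have mono: "adj W * ev_monomial S x * W = (if gauge_degree x = 0 then ev_monomial S x else 0)"
    if x: "x \<in> set xs" for x
  proof -
    obtain c \<mu> \<nu> where [simp]: "x = (c, \<mu>, \<nu>)" by (cases x) auto
    have "length \<mu> + length \<nu> \<le> K"
      unfolding K_def by (rule member_le_sum_list) (use x in force, auto)
    then have len: "length \<mu> \<le> K" "length \<nu> \<le> K" by auto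
    have "letters_in n x" using x xs by blast
    then have w: "\<mu> \<in> words n (length \<mu>)" "\<nu> \<in> words n (length \<nu>)"
      by (simp_all add: words_def)
    have W: "W = (\<phi> ^^ length \<alpha>) ((\<phi> ^^ (K - length \<alpha>)) (Sw \<gamma>))" if "length \<alpha> \<le> K" for \<alpha> :: "nat list"
      using that funpow_add[of "length \<alpha>" "K - length \<alpha>" \<phi>] by (simp add: W_def)
    have "adj W * Sw \<mu> = Sw \<mu> * adj ((\<phi> ^^ (K - length \<mu>)) (Sw \<gamma>))"
      using shift_pow_mult_Sw[OF w(1)] by (simp add: W[OF len(1)] flip: shift_pow_adj)
    moreover have "adj (Sw \<nu>) * W = (\<phi> ^^ (K - length \<nu>)) (Sw \<gamma>) * adj (Sw \<nu>)"
      using adj_Sw_mult_shift_pow[OF w(2)] by (simp add: W[OF len(2)])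
    moreover have "adj W * ev_monomial S x * W = c *\<^sub>C ((adj W * Sw \<mu>) * (adj (Sw \<nu>) * W))"
      by (simp add: scaleC_mult_left scaleC_mult_right mult.assoc)
    moreover have "(Sw \<mu> * adj ((\<phi> ^^ (K - length \<mu>)) (Sw \<gamma>))) * ((\<phi> ^^ (K - length \<nu>)) (Sw \<gamma>) * adj (Sw \<nu>))
        = Sw \<mu> * (adj ((\<phi> ^^ (K - length \<mu>)) (Sw \<gamma>)) * (\<phi> ^^ (K - length \<nu>)) (Sw \<gamma>)) * adj (Sw \<nu>)"
      by (simp add: mult.assoc)
    moreover have "K - length \<mu> = K - length \<nu> \<longleftrightarrow> gauge_degree x = 0" using len by auto
    ultimately show ?thesis using E[of "K - length \<mu>" "K - length \<nu>"] by simp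
  qed
  have "adj W * ev S ys * W = ev S (filter (\<lambda>m. gauge_degree m = 0) ys)" if "set ys \<subseteq> set xs" for ys
    using that by (induction ys) (simp_all add: ev_Cons distrib_left distrib_right mono)
  then have "norm (ev S (filter (\<lambda>m. gauge_degree m = 0) xs)) = norm (adj W * ev S xs * W)" by simp
  also have "\<dots> \<le> norm (adj W) * norm (ev S xs) * norm W"
    by (meson norm_mult_ineq mult_right_mono norm_ge_zero order_trans)
  also have "norm W = 1"
    using \<gamma>1 by (intro norm_isometry) (simp add: W_def shift_pow_1 flip: shift_pow_mult shift_pow_adj)
  finally show ?thesis by (simp add: \<open>norm W = 1\<close>)
qed

end

text \<open>Right multiplication by \<open>adj (S_word S \<omega>)\<close>, with \<omega> of length
  \<open>r\<close>, moves degree \<open>r\<close> to degree 0. There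
  \<open>norm_ev_degree_0_le\<close> isolates the part inside \<open>S\<close>, and
  \<open>norm_ev_matrix_le\<close> carries it over to \<open>T\<close>; negative degrees follow by
  taking adjoints. Averaging over the gauge action would do the same, but that action exists only
  after the uniqueness theorem.\<close>

lemma norm_ev_degree_le:
  fixes S :: "nat \<Rightarrow> 'a::cstar_algebra" and T :: "nat \<Rightarrow> 'b::cstar_algebra"
  assumes n: "n \<ge> 2" and S: "cuntz_family n S" and T: "cuntz_family n T" and xs: "xs \<in> polynomials n"
  shows "norm (ev T (filter (\<lambda>m. gauge_degree m = j) xs)) \<le> norm (ev S xs)"
proof -
  interpret S: cuntz_family n S by fact
  interpret T: cuntz_family n T by fact
  have nonneg: "norm (ev T (filter (\<lambda>m. gauge_degree m = int r) ys)) \<le> norm (ev S ys)"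
    if ys: "ys \<in> polynomials n" for r ys
  proof -
    define \<omega> where "\<omega> = replicate r (1::nat)"
    have \<omega>: "set \<omega> \<subseteq> {1..n}" "\<omega> \<in> words n r" using n by (auto simp: \<omega>_def words_def)
    define f :: "monomial \<Rightarrow> monomial" where "f = (\<lambda>(c, \<mu>, \<nu>). (c, \<mu>, \<omega> @ \<nu>))"
    have ev_f: "ev U (map f zs) = ev U zs * adj (S_word U \<omega>)" for U :: "nat \<Rightarrow> 'c::cstar_algebra" and zs
      by (induction zs)
        (auto simp: ev_Cons f_def S_word_append adj_mult scaleC_mult_left distrib_right mult.assoc)
    have deg_f: "gauge_degree (f m) = gauge_degree m - int r" for m by (cases m) (simp add: f_def \<omega>_def)
    have filter_f: "filter (\<lambda>m. gauge_degree m = 0) (map f ys) = map f (filter (\<lambda>m. gauge_degree m = int r) ys)"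
      by (simp add: filter_map comp_def deg_f)
    have fys: "map f ys \<in> polynomials n" using ys \<omega> by (auto simp: f_def)
    define zs where "zs = filter (\<lambda>m. gauge_degree m = 0) (map f ys)"
    define K where "K = sum_list (map (\<lambda>(c, \<mu>, \<nu>). length \<nu>) zs)"
    have "matrix_monomial K m" if "m \<in> set zs" for m
    proof -
      obtain c \<mu> \<nu> where [simp]: "m = (c, \<mu>, \<nu>)" by (cases m) auto
      have "length \<nu> \<le> K" unfolding K_def by (rule member_le_sum_list) (use that in force, auto)
      then show ?thesis using that by (simp add: zs_def)
    qed
    moreover have "set zs \<subseteq> set (map f ys)" unfolding zs_def by (rule filter_is_subset)
    ultimately have zs: "zs \<in> matrix_polynomials n K" using fys by blast
    have "ev T (filter (\<lambda>m. gauge_degree m = int r) ys) = ev T zs * S_word T \<omega>"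
      by (simp add: zs_def filter_f ev_f mult.assoc T.Sw_isometry[OF \<omega>(2)])
    then have "norm (ev T (filter (\<lambda>m. gauge_degree m = int r) ys)) \<le> norm (ev T zs)"
      using norm_mult_ineq[of "ev T zs" "S_word T \<omega>"] T.norm_Sw[OF \<omega>(1)] by simp
    also have "\<dots> \<le> norm (ev S zs)" by (rule norm_ev_matrix_le[OF S T zs])
    also have "\<dots> \<le> norm (ev S (map f ys))"
      unfolding zs_def by (rule S.norm_ev_degree_0_le[OF n fys])
    also have "\<dots> \<le> norm (ev S ys)"
      using norm_mult_ineq[of "ev S ys" "adj (S_word S \<omega>)"] S.norm_Sw[OF \<omega>(1)] by (simp add: ev_f)
    finally show ?thesis .
  qed
  show ?thesis
  proof (cases "j \<ge> 0")
    case True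
    then show ?thesis using nonneg[OF xs, of "nat j"] by simp
  next
    case False
    have "map monomial_adj xs \<in> polynomials n" using xs by simp
    from nonneg[OF this, of "nat (- j)"] False
    have "norm (ev T (map monomial_adj (filter (\<lambda>m. gauge_degree m = j) xs))) \<le> norm (ev S (map monomial_adj xs))"
      by (simp add: filter_map comp_def)
    then show ?thesis by (simp add: ev_adj)
  qed
qed

lemma norm_ev_le:
  fixes S :: "nat \<Rightarrow> 'a::cstar_algebra" and T :: "nat \<Rightarrow> 'b::cstar_algebra"
  assumes n: "n \<ge> 2" and S: "cuntz_family n S" and T: "cuntz_family n T" and xs: "xs \<in> polynomials n"
  shows "norm (ev T xs) \<le> norm (ev S xs)"
proof -
  have linear: "norm (ev T ys) \<le> (2 * real d + 1) * norm (ev S ys)" if ys: "ys \<in> polynomials_upto n d" for ys d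
  proof -
    have decomp: "ev T zs = (\<Sum>j\<in>{- int d..int d}. ev T (filter (\<lambda>m. gauge_degree m = j) zs))"
      if "\<forall>m\<in>set zs. \<bar>gauge_degree m\<bar> \<le> int d" for zs
      using that
    proof (induction zs)
      case (Cons x zs)
      have "(\<Sum>j\<in>{- int d..int d}. ev T (filter (\<lambda>m. gauge_degree m = j) (x # zs)))
          = (\<Sum>j\<in>{- int d..int d}. (if gauge_degree x = j then ev_monomial T x else 0)
              + ev T (filter (\<lambda>m. gauge_degree m = j) zs))"
        by (intro sum.cong) (auto simp: ev_Cons)
      then show ?case using Cons by (simp add: sum.distrib ev_Cons abs_le_iff)
    qed simp
    have yp: "ys \<in> polynomials n" and yd: "\<forall>m\<in>set ys. \<bar>gauge_degree m\<bar> \<le> int d" using ys by auto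
    have "norm (ev T ys) \<le> (\<Sum>j\<in>{- int d..int d}. norm (ev S ys))"
      unfolding decomp[OF yd] by (rule sum_norm_le[OF norm_ev_degree_le[OF n S T yp]])
    then show ?thesis by (simp add: mult.commute)
  qed
  define d where "d = sum_list (map (\<lambda>m. nat \<bar>gauge_degree m\<bar>) xs)"
  have "nat \<bar>gauge_degree m\<bar> \<le> d" if "m \<in> set xs" for m
    unfolding d_def by (rule member_le_sum_list) (use that in force, auto)
  then have "xs \<in> polynomials_upto n d" using xs by fastforce
  \<comment> \<open>Gram powers have degree at most \<open>2 * d * 2 ^ m\<close>, hence at most
    \<open>2 * (2 * d * 2 ^ m) + 1\<close> homogeneous parts.\<close>
  from linear[OF gram_power_upto[OF this]]
  have "norm (ev T (gram_power xs m)) \<le> (4 * real d * 2 ^ m + 1) * norm (ev S (gram_power xs m))" for m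
    by (simp add: mult.assoc)
  then show ?thesis by (rule norm_ev_le_of_growth[OF S T xs])
qed

section \<open>Extension from polynomials to the whole Cuntz algebra\<close>

lemma cuntz_family_of_algebra: "cuntz_algebra n S \<Longrightarrow> cuntz_family n S"
  by unfold_locales (auto simp: cuntz_algebra_def)

theorem cuntz_universal_property:
  fixes S :: "nat \<Rightarrow> 'a::cstar_algebra" and T :: "nat \<Rightarrow> 'b::cstar_algebra"
  assumes n: "n \<ge> 2" and alg: "cuntz_algebra n S" and T: "cuntz_family n T"
  obtains \<Lambda> where "star_hom UNIV UNIV \<Lambda>" "\<Lambda> 1 = 1" "\<And>i. i \<in> {1..n} \<Longrightarrow> \<Lambda> (S i) = T i"
    "\<And>x. norm (\<Lambda> x) \<le> norm x"
proof -
  have S: "cuntz_family n S" using alg by (rule cuntz_family_of_algebra)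
  interpret S: cuntz_family n S by fact
  interpret T: cuntz_family n T by fact
  \<comment> \<open>The closure of the relation between the values of one polynomial in
    \<open>S\<close> and in \<open>T\<close>. A relation is used because different lists may
    evaluate to the same element; \<open>norm_ev_le\<close> makes it single-valued and
    contractive.\<close>
  define G where "G = (\<lambda>x y. \<exists>f. (\<forall>k. f k \<in> polynomials n) \<and>
      (\<lambda>k. ev S (f k)) \<longlonglongrightarrow> x \<and> (\<lambda>k. ev T (f k)) \<longlonglongrightarrow> y)"
  have GI: "G x y" if "\<And>k. f k \<in> polynomials n" "(\<lambda>k. ev S (f k)) \<longlonglongrightarrow> x" "(\<lambda>k. ev T (f k)) \<longlonglongrightarrow> y"
    for x y f
    unfolding G_def using that by (intro exI[of _ f] conjI allI)
  have G_norm: "norm y \<le> norm x" if G: "G x y" for x y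
  proof -
    obtain f where f: "\<And>k. f k \<in> polynomials n" "(\<lambda>k. ev S (f k)) \<longlonglongrightarrow> x" "(\<lambda>k. ev T (f k)) \<longlonglongrightarrow> y"
      using G unfolding G_def by (elim exE conjE) (rule that, auto)
    show ?thesis
      using tendsto_norm[OF f(3)] tendsto_norm[OF f(2)]
      by (rule LIMSEQ_le) (use norm_ev_le[OF n S T f(1)] in blast)
  qed
  have G_add: "G (x + x') (y + y')" and G_mult: "G (x * x') (y * y')" if G: "G x y" "G x' y'" for x y x' y'
  proof -
    obtain f where f: "\<And>k. f k \<in> polynomials n" "(\<lambda>k. ev S (f k)) \<longlonglongrightarrow> x" "(\<lambda>k. ev T (f k)) \<longlonglongrightarrow> y"
      using G(1) unfolding G_def by (elim exE conjE) (rule that, auto)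
    obtain g where g: "\<And>k. g k \<in> polynomials n" "(\<lambda>k. ev S (g k)) \<longlonglongrightarrow> x'" "(\<lambda>k. ev T (g k)) \<longlonglongrightarrow> y'"
      using G(2) unfolding G_def by (elim exE conjE) (rule that, auto)
    show "G (x + x') (y + y')"
    proof (rule GI[of "\<lambda>k. f k @ g k"])
      show "f k @ g k \<in> polynomials n" for k using f(1)[of k] g(1)[of k] by auto
    qed (use tendsto_add[OF f(2) g(2)] tendsto_add[OF f(3) g(3)] in \<open>simp_all add: ev_append\<close>)
    show "G (x * x') (y * y')"
    proof (rule GI[of "\<lambda>k. poly_mult (f k) (g k)"])
      show "poly_mult (f k) (g k) \<in> polynomials n" for k by (rule poly_mult_polynomials[OF f(1) g(1)])
    qed (use tendsto_mult[OF f(2) g(2)] tendsto_mult[OF f(3) g(3)] in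
        \<open>simp_all only: S.ev_poly_mult[OF f(1) g(1)] T.ev_poly_mult[OF f(1) g(1)]\<close>)
  qed
  have G_scale: "G (c *\<^sub>C x) (c *\<^sub>C y)" and G_adj: "G (adj x) (adj y)" if G: "G x y" for c x y
  proof -
    obtain f where f: "\<And>k. f k \<in> polynomials n" "(\<lambda>k. ev S (f k)) \<longlonglongrightarrow> x" "(\<lambda>k. ev T (f k)) \<longlonglongrightarrow> y"
      using G unfolding G_def by (elim exE conjE) (rule that, auto)
    show "G (c *\<^sub>C x) (c *\<^sub>C y)"
    proof (rule GI[of "\<lambda>k. map (monomial_scale c) (f k)"])
      show "map (monomial_scale c) (f k) \<in> polynomials n" for k using f(1)[of k] by auto
    qed (use tendsto_scaleC[OF f(2)] tendsto_scaleC[OF f(3)] in \<open>simp_all add: ev_scale\<close>)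
    show "G (adj x) (adj y)"
    proof (rule GI[of "\<lambda>k. map monomial_adj (f k)"])
      show "map monomial_adj (f k) \<in> polynomials n" for k using f(1)[of k] by auto
    qed (use tendsto_adj[OF f(2)] tendsto_adj[OF f(3)] in \<open>simp_all add: ev_adj\<close>)
  qed
  have G_ev: "G (ev S xs) (ev T xs)" if "xs \<in> polynomials n" for xs
    by (rule GI[of "\<lambda>_. xs"]) (use that in auto)
  have G_unique: "y = y'" if "G x y" "G x y'" for x y y'
  proof -
    have "G (x + (-1) *\<^sub>C x) (y + (-1) *\<^sub>C y')" using that by (intro G_add G_scale)
    from G_norm[OF this] show ?thesis by (simp add: scaleC_minus1_left)
  qed
  have G_S: "G (S i) (T i)" if "i \<in> {1..n}" for i
    using G_ev[of "[(1, [i], [])]"] that by (simp add: ev_Cons S_word_Cons)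
  have G_1: "G 1 1" using G_ev[of "[(1, [], [])]"] by (simp add: ev_Cons)
  \<comment> \<open>Polynomials in \<open>S\<close> are dense because the \<open>S i\<close>
    generate. The norm comparison carries Cauchy sequences over to \<open>T\<close>, where
    completeness gives the partner of \<open>x\<close>.\<close>
  have G_total: "\<exists>y. G x y" for x
  proof -
    define A where "A = ev S ` polynomials n"
    have "cstar_subalgebra (closure A)"
    proof (rule cstar_subalgebra_closure)
      show "0 \<in> A" unfolding A_def by (rule image_eqI[of _ _ "[]"]) simp_all
      fix x y assume "x \<in> A" "y \<in> A"
      then obtain xs ys where *: "x = ev S xs" "xs \<in> polynomials n" "y = ev S ys" "ys \<in> polynomials n"
        unfolding A_def by blast
      show "x + y \<in> A" unfolding A_def by (rule image_eqI[of _ _ "xs @ ys"]) (use * in \<open>auto simp: ev_append\<close>)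
      show "x * y \<in> A" unfolding A_def
        by (rule image_eqI[of _ _ "poly_mult xs ys"])
          (use * S.ev_poly_mult[OF *(2,4)] poly_mult_polynomials[OF *(2,4)] in simp_all)
    next
      fix c x assume "x \<in> A"
      then obtain xs where *: "x = ev S xs" "xs \<in> polynomials n" unfolding A_def by blast
      show "c *\<^sub>C x \<in> A" unfolding A_def
        by (rule image_eqI[of _ _ "map (monomial_scale c) xs"]) (use * in \<open>auto simp: ev_scale\<close>)
      show "adj x \<in> A" unfolding A_def
        by (rule image_eqI[of _ _ "map monomial_adj xs"]) (use * in \<open>auto simp: ev_adj\<close>)
    qed
    moreover have "S ` {1..n} \<subseteq> closure A"
    proof (rule subset_trans[OF _ closure_subset], rule image_subsetI)
      fix i assume "i \<in> {1..n}"
      then show "S i \<in> A" unfolding A_def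
        by (intro image_eqI[of _ _ "[(1, [i], [])]"]) (auto simp: ev_Cons S_word_Cons)
    qed
    ultimately have "cstar_subalgebra hull (S ` {1..n}) \<subseteq> closure A" by (intro hull_minimal)
    then have xA: "x \<in> closure A" using alg by (auto simp: cuntz_algebra_def)
    obtain g where g: "\<And>k. g k \<in> A" "g \<longlonglongrightarrow> x" by (rule closure_sequentialE[OF xA], rule that)
    have "\<forall>k. \<exists>xs. xs \<in> polynomials n \<and> g k = ev S xs" using g(1) unfolding A_def by blast
    then obtain f where f: "\<And>k. f k \<in> polynomials n" "\<And>k. g k = ev S (f k)" by (metis (no_types))
    have diff: "norm (ev T (f k) - ev T (f l)) \<le> norm (ev S (f k) - ev S (f l))" for k l
    proof -
      have "f k @ map (monomial_scale (-1)) (f l) \<in> polynomials n" using f(1)[of k] f(1)[of l] by auto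
      from norm_ev_le[OF n S T this] show ?thesis by (simp add: ev_append ev_scale scaleC_minus1_left)
    qed
    have "Cauchy g" using g(2) by (rule LIMSEQ_imp_Cauchy)
    have "Cauchy (\<lambda>k. ev T (f k))"
    proof (rule metric_CauchyI)
      fix e :: real assume "e > 0"
      then obtain M where M: "\<And>k l. k \<ge> M \<Longrightarrow> l \<ge> M \<Longrightarrow> dist (g k) (g l) < e"
        using \<open>Cauchy g\<close> unfolding Cauchy_def by metis
      have "dist (ev T (f k)) (ev T (f l)) < e" if "k \<ge> M" "l \<ge> M" for k l
        using M[OF that] diff[of k l] by (simp add: dist_norm f(2))
      then show "\<exists>M. \<forall>k\<ge>M. \<forall>l\<ge>M. dist (ev T (f k)) (ev T (f l)) < e" by blast
    qed
    then obtain y where "(\<lambda>k. ev T (f k)) \<longlonglongrightarrow> y" using Cauchy_convergent convergent_def by blast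
    moreover have "g = (\<lambda>k. ev S (f k))" by (rule ext) (rule f(2))
    then have "(\<lambda>k. ev S (f k)) \<longlonglongrightarrow> x" using g(2) by (simp only:)
    ultimately show ?thesis by (intro exI[of _ y] GI[of f] f(1))
  qed
  define \<Lambda> where "\<Lambda> = (\<lambda>x. SOME y. G x y)"
  have G: "G x (\<Lambda> x)" for x unfolding \<Lambda>_def by (rule someI_ex[OF G_total])
  show ?thesis
  proof (rule that)
    show "star_hom UNIV UNIV \<Lambda>"
      unfolding star_hom_def
      using G_unique[OF G G_add[OF G G]] G_unique[OF G G_mult[OF G G]]
        G_unique[OF G G_scale[OF G]] G_unique[OF G G_adj[OF G]] by blast
    show "\<Lambda> 1 = 1" by (rule G_unique[OF G G_1])
    show "\<Lambda> (S i) = T i" if "i \<in> {1..n}" for i by (rule G_unique[OF G G_S[OF that]])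
    show "norm (\<Lambda> x) \<le> norm x" for x by (rule G_norm[OF G])
  qed
qed

subsection \<open>Homomorphisms and traces\<close>

lemma star_homD:
  assumes "star_hom B C f"
  shows "x \<in> B \<Longrightarrow> f x \<in> C" "x \<in> B \<Longrightarrow> y \<in> B \<Longrightarrow> f (x + y) = f x + f y"
    "x \<in> B \<Longrightarrow> y \<in> B \<Longrightarrow> f (x * y) = f x * f y" "x \<in> B \<Longrightarrow> f (c *\<^sub>C x) = c *\<^sub>C f x"
    "x \<in> B \<Longrightarrow> f (adj x) = adj (f x)"
  using assms by (auto simp: star_hom_def)

lemma star_hom_0: "cstar_subalgebra B \<Longrightarrow> star_hom B C f \<Longrightarrow> f 0 = 0"
  using star_homD(4)[of B C f 0 0] by (simp add: cstar_subalgebraD(2))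

lemma star_hom_sum:
  assumes "cstar_subalgebra B" "star_hom B C f" "\<And>i. i \<in> I \<Longrightarrow> g i \<in> B"
  shows "f (sum g I) = (\<Sum>i\<in>I. f (g i))"
  using assms(3)
proof (induction I rule: infinite_finite_induct)
  case (insert i I)
  then show ?case
    using star_homD(2)[OF assms(2), of "g i" "sum g I"] cstar_subalgebra_sum[OF assms(1), of I g] by simp
qed (simp_all add: star_hom_0[OF assms(1,2)])

lemma star_hom_tendsto:
  assumes B: "cstar_subalgebra B" and f: "star_hom B C f" and one: "1 \<in> B" "f 1 = 1"
    and x: "x \<in> B" and X: "\<And>m. X m \<in> B" "X \<longlonglongrightarrow> x"
  shows "(\<lambda>m. f (X m)) \<longlonglongrightarrow> f x"
proof -
  have le: "dist (f (X m)) (f x) \<le> 2 * dist (X m) x" for m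
  proof -
    have d: "X m - x \<in> B"
      using cstar_subalgebraD(3)[OF B X(1) cstar_subalgebraD(5)[OF B x, of "-1"]]
      by (simp add: scaleC_minus1_left)
    have "f (X m) = f ((X m - x) + x)" by simp
    also have "\<dots> = f (X m - x) + f x" by (rule star_homD(2)[OF f d x])
    finally show ?thesis using star_hom_norm_le[OF B f one d] by (simp add: dist_norm)
  qed
  have lim: "(\<lambda>m. 2 * dist (X m) x) \<longlonglongrightarrow> 0"
    using tendsto_mult_right_zero[OF tendsto_dist_iff[THEN iffD1, OF X(2)], of 2] .
  have "(\<lambda>m. dist (f (X m)) (f x)) \<longlonglongrightarrow> 0"
    by (rule tendsto_sandwich[OF always_eventually[OF allI[OF zero_le_dist]]
          always_eventually[OF allI[OF le]] tendsto_const lim])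
  then show ?thesis by (rule tendsto_dist_iff[THEN iffD2])
qed

context cuntz_family
begin

section \<open>Continuity of a normalized trace\<close>

context
  fixes \<tau> :: "'a \<Rightarrow> complex"
  assumes \<tau>: "normalized_trace n S \<tau>"
begin

lemma trace_add: "x \<in> core n S \<Longrightarrow> y \<in> core n S \<Longrightarrow> \<tau> (x + y) = \<tau> x + \<tau> y"
  and trace_commute: "x \<in> core n S \<Longrightarrow> y \<in> core n S \<Longrightarrow> \<tau> (x * y) = \<tau> (y * x)"
  and trace_scaleC: "x \<in> core n S \<Longrightarrow> \<tau> (c *\<^sub>C x) = c * \<tau> x"
  and trace_nonneg: "x \<in> core n S \<Longrightarrow> \<tau> (adj x * x) \<in> \<real>\<^sub>\<ge>\<^sub>0"
  and trace_1: "\<tau> 1 = 1"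
  using \<tau> by (auto simp: normalized_trace_def)

lemma trace_minus: "x \<in> core n S \<Longrightarrow> \<tau> (- x) = - \<tau> x"
  using trace_scaleC[of x "-1"] by (simp add: scaleC_minus1_left)

lemma core_uminus: "x \<in> core n S \<Longrightarrow> - x \<in> core n S"
  using cstar_subalgebraD(5)[OF cstar_subalgebra_core, of x "-1"] by (simp add: scaleC_minus1_left)

lemma core_diff: "x \<in> core n S \<Longrightarrow> y \<in> core n S \<Longrightarrow> x - y \<in> core n S"
  using cstar_subalgebraD(3)[OF cstar_subalgebra_core _ core_uminus, of x y] by simp

text \<open>For self-adjoint \<open>h\<close> of norm below 1, \<open>1 - h\<close> and
  \<open>1 + h\<close> are squares of self-adjoint elements of the core, so positivity makes
  \<open>\<tau> h\<close> real of modulus at most 1. Splitting into real and imaginary parts costs a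
  factor 2, and scaling to norm 1/2 another.\<close>

lemma norm_trace_le:
  assumes x: "x \<in> core n S"
  shows "cmod (\<tau> x) \<le> 4 * norm x"
proof -
  note core = cstar_subalgebraD[OF cstar_subalgebra_core]
  have pos: "1 - \<tau> h \<in> \<real>\<^sub>\<ge>\<^sub>0" if h: "h \<in> core n S" "adj h = h" "norm h < 1" for h
  proof -
    obtain z where z: "z \<in> core n S" "adj z = z" "(1 - z) * (1 - z) = 1 - h"
      using sqrt_one_minus[OF cstar_subalgebra_core h] by metis
    have "\<tau> (1 - h) \<in> \<real>\<^sub>\<ge>\<^sub>0"
      using trace_nonneg[OF core_diff[OF one_in_core z(1)]] z by (simp add: adj_diff)
    moreover have "\<tau> (1 - h) = 1 - \<tau> h"
      using trace_add[OF one_in_core core_uminus[OF h(1)]] trace_minus[OF h(1)] trace_1 by simp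
    ultimately show ?thesis by simp
  qed
  have sa: "cmod (\<tau> h) \<le> 1" if h: "h \<in> core n S" "adj h = h" "norm h < 1" for h
  proof -
    have "1 - \<tau> h \<in> \<real>\<^sub>\<ge>\<^sub>0" "1 + \<tau> h \<in> \<real>\<^sub>\<ge>\<^sub>0"
      using pos[OF h] pos[of "- h"] h core_uminus[OF h(1)] trace_minus[OF h(1)] by (simp_all add: adj_minus)
    then have "Im (\<tau> h) = 0" "\<bar>Re (\<tau> h)\<bar> \<le> 1"
      by (auto simp: complex_nonneg_Reals_iff)
    then show ?thesis by (simp add: cmod_def)
  qed
  have two: "cmod (\<tau> y) \<le> 2" if y: "y \<in> core n S" "norm y < 1" for y
  proof -
    define a where "a = (1/2) *\<^sub>C (y + adj y)"
    define b where "b = (- \<i>/2) *\<^sub>C (y + (-1) *\<^sub>C adj y)"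
    have ab: "a \<in> core n S" "b \<in> core n S" using y by (auto simp: a_def b_def intro!: core)
    have adj: "adj a = a" "adj b = b"
      by (simp_all add: a_def b_def adj_scaleC adj_add adj_adj scaleC_add_right scaleC_scaleC add.commute)
    have "norm (y + adj y) < 2" "norm (y + (-1) *\<^sub>C adj y) < 2"
      using norm_triangle_ineq[of y "adj y"] norm_triangle_ineq[of y "(-1) *\<^sub>C adj y"] y(2)
      by (simp_all add: norm_scaleC)
    then have norm: "norm a < 1" "norm b < 1" by (simp_all add: a_def b_def norm_scaleC norm_divide)
    have "a + \<i> *\<^sub>C b = (1/2) *\<^sub>C y + (1/2) *\<^sub>C y"
      by (simp add: a_def b_def scaleC_add_right scaleC_scaleC) (simp flip: scaleC_add_left)
    also have "\<dots> = y" by (simp flip: scaleC_add_left)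
    finally have "\<tau> y = \<tau> a + \<i> * \<tau> b"
      using trace_add[OF ab(1) core(5)[OF ab(2)], of \<i>] trace_scaleC[OF ab(2)] by simp
    also have "cmod \<dots> \<le> cmod (\<tau> a) + cmod (\<i> * \<tau> b)" by (rule norm_triangle_ineq)
    finally show ?thesis using sa[OF ab(1) adj(1) norm(1)] sa[OF ab(2) adj(2) norm(2)]
      by (simp add: norm_mult)
  qed
  show ?thesis
  proof (cases "x = 0")
    case True
    then show ?thesis using trace_scaleC[OF one_in_core, of 0] by simp
  next
    case False
    define c where "c = complex_of_real (1 / (2 * norm x))"
    have c: "cmod c = 1 / (2 * norm x)" by (simp add: c_def norm_divide)
    have "cmod (\<tau> (c *\<^sub>C x)) \<le> 2"
      using c False by (intro two core(5)[OF x]) (simp add: norm_scaleC)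
    then show ?thesis using c False by (simp add: trace_scaleC[OF x] norm_mult field_simps)
  qed
qed

lemma trace_tendsto:
  assumes x: "x \<in> core n S" and X: "\<And>m. X m \<in> core n S" "X \<longlonglongrightarrow> x"
  shows "(\<lambda>m. \<tau> (X m)) \<longlonglongrightarrow> \<tau> x"
proof -
  have le: "dist (\<tau> (X m)) (\<tau> x) \<le> 4 * dist (X m) x" for m
    using norm_trace_le[OF core_diff[OF X(1) x], of m] trace_add[OF X(1) core_uminus[OF x], of m]
    by (simp add: dist_norm trace_minus[OF x])
  have lim: "(\<lambda>m. 4 * dist (X m) x) \<longlonglongrightarrow> 0"
    using tendsto_mult_right_zero[OF tendsto_dist_iff[THEN iffD1, OF X(2)], of 4] .
  have "(\<lambda>m. dist (\<tau> (X m)) (\<tau> x)) \<longlonglongrightarrow> 0"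
    by (rule tendsto_sandwich[OF always_eventually[OF allI[OF zero_le_dist]]
          always_eventually[OF allI[OF le]] tendsto_const lim])
  then show ?thesis by (rule tendsto_dist_iff[THEN iffD2])
qed

end

text \<open>Each \<open>f (Pw \<mu>)\<close> is a projection of the diagonal and so has finite
  level. This makes an abstract endomorphism of the diagonal accessible to combinatorics.\<close>

lemma star_hom_alg_diagonal:
  assumes f: "star_hom (diagonal n S) (diagonal n S) f" and x: "x \<in> alg_diagonal"
  shows "f x \<in> alg_diagonal"
proof -
  have P: "f (Pw \<mu>) \<in> alg_diagonal" if \<mu>: "\<mu> \<in> words n k" for \<mu> k
  proof -
    have D: "Pw \<mu> \<in> diagonal n S" using Pw_alg_diagonal[OF \<mu>] alg_diagonal_subset by blast
    show ?thesis
    proof (rule diagonal_projection)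
      show "f (Pw \<mu>) \<in> diagonal n S" by (rule star_homD(1)[OF f D])
      show "adj (f (Pw \<mu>)) = f (Pw \<mu>)" using star_homD(5)[OF f D] by simp
      show "f (Pw \<mu>) * f (Pw \<mu>) = f (Pw \<mu>)"
        using star_homD(3)[OF f D D] Pw_mult_Pw[OF \<mu> \<mu>] by simp
    qed
  qed
  obtain k c where x: "x = (\<Sum>\<mu>\<in>words n k. c \<mu> *\<^sub>C Pw \<mu>)"
    using x by (auto simp: alg_diagonal_def diagonal_level_def)
  have "c \<mu> *\<^sub>C Pw \<mu> \<in> diagonal n S" if "\<mu> \<in> words n k" for \<mu>
    using alg_diagonal_scaleC[OF Pw_alg_diagonal[OF that]] alg_diagonal_subset by blast
  then have "f x = (\<Sum>\<mu>\<in>words n k. f (c \<mu> *\<^sub>C Pw \<mu>))"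
    unfolding x by (rule star_hom_sum[OF cstar_subalgebra_diagonal f])
  also have "\<dots> = (\<Sum>\<mu>\<in>words n k. c \<mu> *\<^sub>C f (Pw \<mu>))"
    using Pw_alg_diagonal alg_diagonal_subset by (intro sum.cong refl star_homD(4)[OF f]) blast
  also have "\<dots> \<in> alg_diagonal" by (intro alg_diagonal_sum alg_diagonal_scaleC P)
  finally show ?thesis .
qed

subsection \<open>The endomorphisms given by permutation unitaries\<close>

text \<open>Everything reduces to the action of \<open>u\<close> and \<open>adj u\<close> on the
  \<open>Sw \<mu>\<close>, by inserting the sum of the \<open>Pw \<mu>\<close>.\<close>

lemma permutation_unitary:
  assumes \<sigma>: "bij_betw \<sigma> (words n k) (words n k)"
    and u: "u = (\<Sum>\<mu>\<in>words n k. Sw (\<sigma> \<mu>) * adj (Sw \<mu>))"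
  shows "adj u * u = 1" "u * adj u = 1" "u \<in> core_level n S k"
    "\<mu> \<in> words n k \<Longrightarrow> u * Sw \<mu> = Sw (\<sigma> \<mu>)"
proof -
  have \<sigma>w: "\<sigma> \<mu> \<in> words n k" if "\<mu> \<in> words n k" for \<mu>
    using \<sigma> that by (auto simp: bij_betw_def)
  have uS: "u * Sw \<mu> = Sw (\<sigma> \<mu>)" if m: "\<mu> \<in> words n k" for \<mu>
  proof -
    have "u * Sw \<mu> = (\<Sum>\<kappa>\<in>words n k. if \<kappa> = \<mu> then Sw (\<sigma> \<kappa>) else 0)"
      unfolding u sum_distrib_right using m
      by (intro sum.cong) (auto simp: mult.assoc adj_Sw_mult_Sw)
    then show ?thesis using m by simp
  qed
  have uS': "adj u * Sw (\<sigma> \<mu>) = Sw \<mu>" if m: "\<mu> \<in> words n k" for \<mu>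
  proof -
    have "adj (Sw (\<sigma> \<kappa>)) * Sw (\<sigma> \<mu>) = (if \<kappa> = \<mu> then 1 else 0)" if \<kappa>: "\<kappa> \<in> words n k" for \<kappa>
      using adj_Sw_mult_Sw[OF \<sigma>w[OF \<kappa>] \<sigma>w[OF m]] inj_on_eq_iff[OF bij_betw_imp_inj_on[OF \<sigma>] \<kappa> m]
      by (simp only:)
    then have "adj u * Sw (\<sigma> \<mu>) = (\<Sum>\<kappa>\<in>words n k. if \<kappa> = \<mu> then Sw \<kappa> else 0)"
      unfolding u adj_sum sum_distrib_right by (intro sum.cong) (simp_all add: adj_mult adj_adj mult.assoc)
    then show ?thesis using m by simp
  qed
  show "adj u * u = 1"
  proof -
    have "adj u * u = (\<Sum>\<mu>\<in>words n k. adj u * (u * Sw \<mu>) * adj (Sw \<mu>))"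
      using sum_Pw_right[of "adj u * u" k] by (simp add: P_word_def mult.assoc)
    also have "\<dots> = (\<Sum>\<mu>\<in>words n k. Pw \<mu>)" by (simp add: uS uS' P_word_def)
    finally show ?thesis by (simp add: sum_Pw)
  qed
  show "u * adj u = 1"
  proof -
    have "u * adj u = (\<Sum>\<kappa>\<in>words n k. u * (adj u * Sw \<kappa>) * adj (Sw \<kappa>))"
      using sum_Pw_right[of "u * adj u" k] by (simp add: P_word_def mult.assoc)
    also have "\<dots> = (\<Sum>\<mu>\<in>words n k. u * (adj u * Sw (\<sigma> \<mu>)) * adj (Sw (\<sigma> \<mu>)))"
      by (rule sum.reindex_bij_betw[OF \<sigma>, symmetric])
    also have "\<dots> = (\<Sum>\<mu>\<in>words n k. Pw (\<sigma> \<mu>))" by (simp add: uS uS' P_word_def)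
    also have "\<dots> = (\<Sum>\<mu>\<in>words n k. Pw \<mu>)" by (rule sum.reindex_bij_betw[OF \<sigma>])
    finally show ?thesis by (simp add: sum_Pw)
  qed
  show "u \<in> core_level n S k"
    unfolding core_level_iff
  proof (intro ballI)
    fix \<mu> \<nu> assume m: "\<mu> \<in> words n k" "\<nu> \<in> words n k"
    have "adj (Sw \<mu>) * u * Sw \<nu> = (if \<mu> = \<sigma> \<nu> then 1 else 0) *\<^sub>C 1"
      using m by (simp add: mult.assoc uS adj_Sw_mult_Sw \<sigma>w)
    then show "\<exists>c. adj (Sw \<mu>) * u * Sw \<nu> = c *\<^sub>C 1" by blast
  qed
  show "u * Sw \<mu> = Sw (\<sigma> \<mu>)" if "\<mu> \<in> words n k" by (rule uS[OF that])
qed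

text \<open>This feeds the universal property, which then yields
  \<open>\<lambda>\<^sub>u\<close>.\<close>

lemma cuntz_family_unitary:
  assumes "adj u * u = 1" "u * adj u = 1"
  shows "cuntz_family n (\<lambda>i. u * S i)"
proof
  fix i assume i: "i \<in> {1..n}"
  have "adj (u * S i) * (u * S i) = adj (S i) * (adj u * u) * S i" by (simp add: adj_mult mult.assoc)
  then show "adj (u * S i) * (u * S i) = 1" using assms isometry[OF i] by simp
next
  have "(\<Sum>i=1..n. u * S i * adj (u * S i)) = u * (\<Sum>i=1..n. S i * adj (S i)) * adj u"
    by (simp add: sum_distrib_left sum_distrib_right adj_mult mult.assoc)
  then show "(\<Sum>i=1..n. u * S i * adj (u * S i)) = 1" using assms sum_range_projections by simp
qed

section \<open>The endomorphism of a unitary of finite level\<close>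

context
  fixes \<Lambda> :: "'a \<Rightarrow> 'a" and u :: 'a and K :: nat
  assumes \<Lambda>: "is_lambda n S u \<Lambda>"
    and unitary: "adj u * u = 1" "u * adj u = 1" and u_core: "u \<in> core_level n S K"
begin

lemma lambda_hom: "star_hom UNIV UNIV \<Lambda>"
  and lambda_1: "\<Lambda> 1 = 1"
  and lambda_S: "i \<in> {1..n} \<Longrightarrow> \<Lambda> (S i) = u * S i"
  using \<Lambda> by (auto simp: is_lambda_def unital_star_endo_def)

lemmas lambda_simps = star_homD(2,3)[OF lambda_hom UNIV_I UNIV_I]
  star_homD(4-5)[OF lambda_hom UNIV_I] star_hom_sum[OF cstar_subalgebra_UNIV lambda_hom UNIV_I]

lemma lambda_shift: "\<Lambda> (\<phi> x) = u * \<phi> (\<Lambda> x) * adj u"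
  by (simp add: shift_def lambda_simps lambda_S adj_mult sum_distrib_left sum_distrib_right mult.assoc)

text \<open>The unitary \<open>v\<close> is the cocycle
  \<open>u * \<phi> u * \<dots> * (\<phi> ^^ (l - 1)) u\<close>, built by the recursion
  \<open>w = u * \<phi> v\<close>. Iterating \<open>lambda_shift\<close> gives the rule for shifts,
  and \<open>S i * v = \<phi> v * S i\<close> gives the rule for words with the same
  \<open>v\<close>.\<close>

lemma lambda_shift_pow:
  obtains v where "v \<in> core_level n S (K + l)" "adj v * v = 1" "v * adj v = 1"
    "\<And>y. \<Lambda> ((\<phi> ^^ l) y) = v * (\<phi> ^^ l) (\<Lambda> y) * adj v"
    "\<And>\<mu>. \<mu> \<in> words n l \<Longrightarrow> \<Lambda> (Sw \<mu>) = v * Sw \<mu>"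
proof -
  have "\<exists>v\<in>core_level n S (K + l). adj v * v = 1 \<and> v * adj v = 1 \<and>
      (\<forall>y. \<Lambda> ((\<phi> ^^ l) y) = v * (\<phi> ^^ l) (\<Lambda> y) * adj v) \<and> (\<forall>\<mu>\<in>words n l. \<Lambda> (Sw \<mu>) = v * Sw \<mu>)"
  proof (induction l)
    case 0
    show ?case
      using core_level_mono[OF core_level_matrix_unit[of "[]" 0 "[]"], of K]
      by (intro bexI[of _ 1]) (simp_all add: lambda_1)
  next
    case (Suc l)
    then obtain v where v: "v \<in> core_level n S (K + l)" "adj v * v = 1" "v * adj v = 1"
      "\<And>y. \<Lambda> ((\<phi> ^^ l) y) = v * (\<phi> ^^ l) (\<Lambda> y) * adj v"
      "\<And>\<mu>. \<mu> \<in> words n l \<Longrightarrow> \<Lambda> (Sw \<mu>) = v * Sw \<mu>" by blast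
    define w where "w = u * \<phi> v"
    have "adj w * w = \<phi> (adj v) * (adj u * u) * \<phi> v" by (simp add: w_def adj_mult shift_adj mult.assoc)
    then have w1: "adj w * w = 1" using unitary v by (simp add: shift_1 flip: shift_mult)
    have "w * adj w = u * (\<phi> v * \<phi> (adj v)) * adj u" by (simp add: w_def adj_mult shift_adj mult.assoc)
    then have w2: "w * adj w = 1" using unitary v by (simp add: shift_1 flip: shift_mult)
    have w3: "w \<in> core_level n S (K + Suc l)"
      unfolding w_def using core_level_mono[OF u_core, of "Suc l"] core_level_shift[OF v(1)]
      by (intro core_level_mult) simp_all
    have w4: "\<Lambda> ((\<phi> ^^ Suc l) y) = w * (\<phi> ^^ Suc l) (\<Lambda> y) * adj w" for y
      by (simp add: lambda_shift v(4) shift_mult w_def adj_mult shift_adj mult.assoc)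
    have w5: "\<Lambda> (Sw \<mu>) = w * Sw \<mu>" if \<mu>: "\<mu> \<in> words n (Suc l)" for \<mu>
    proof -
      obtain i \<nu> where eq: "\<mu> = i # \<nu>" and m: "i \<in> {1..n}" "\<nu> \<in> words n l" using \<mu> by (meson words_SucE)
      have "\<Lambda> (Sw \<mu>) = u * (S i * v) * Sw \<nu>"
        using m by (simp add: eq S_word_Cons lambda_simps lambda_S v(5) mult.assoc)
      also have "S i * v = \<phi> v * S i" using m by (simp add: shift_mult_S)
      finally show ?thesis by (simp add: w_def eq S_word_Cons mult.assoc)
    qed
    show ?case using w1 w2 w3 w4 w5 by (intro bexI[of _ w] conjI allI ballI)
  qed
  then show ?thesis using that by blast
qed

text \<open>All words of length \<open>l\<close> are multiplied on the left by the same
  \<open>v\<close>, so on level \<open>l\<close> the map is conjugation by an element of the core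
  that depends on \<open>l\<close> only. Both invariance of the core and of the trace rest on
  this.\<close>

lemma lambda_core_level:
  obtains v where "v \<in> core n S" "adj v * v = 1" "\<And>x. x \<in> core_level n S l \<Longrightarrow> \<Lambda> x = v * x * adj v"
proof -
  obtain v where v: "v \<in> core_level n S (K + l)" "adj v * v = 1"
    "\<And>\<mu>. \<mu> \<in> words n l \<Longrightarrow> \<Lambda> (Sw \<mu>) = v * Sw \<mu>"
    using lambda_shift_pow[of l] by metis
  have "\<Lambda> x = v * x * adj v" if x: "x \<in> core_level n S l" for x
  proof -
    obtain c where "x = (\<Sum>\<mu>\<in>words n l. \<Sum>\<nu>\<in>words n l. c \<mu> \<nu> *\<^sub>C (Sw \<mu> * adj (Sw \<nu>)))"
      using x by (auto simp: core_level_def)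
    then show ?thesis
      by (simp add: lambda_simps v(3) adj_mult sum_distrib_left sum_distrib_right
          scaleC_mult_left scaleC_mult_right mult.assoc)
  qed
  then show ?thesis using v core_level_subset_core that by blast
qed

lemma lambda_core: "unital_star_endo (core n S) \<Lambda>"
proof -
  have "\<Lambda> x \<in> core n S" if x: "x \<in> core n S" for x
  proof -
    have level: "\<Lambda> y \<in> core n S" if y: "y \<in> (\<Union>k. core_level n S k)" for y
    proof -
      obtain l where l: "y \<in> core_level n S l" using y by blast
      obtain v where v: "v \<in> core n S" "\<Lambda> y = v * y * adj v"
        using lambda_core_level[of l] l by metis
      then show ?thesis
        using l core_level_subset_core cstar_subalgebraD(4,6)[OF cstar_subalgebra_core] by (metis subsetD)
    qed
    obtain X where X: "\<And>m. X m \<in> (\<Union>k. core_level n S k)" "X \<longlonglongrightarrow> x"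
      by (rule closure_sequentialE[OF x[unfolded core_def]], rule that)
    have lim: "(\<lambda>m. \<Lambda> (X m)) \<longlonglongrightarrow> \<Lambda> x"
      by (rule star_hom_tendsto[OF cstar_subalgebra_UNIV lambda_hom UNIV_I lambda_1 UNIV_I UNIV_I X(2)])
    show ?thesis
      by (rule closed_sequentially[OF cstar_subalgebraD(1)[OF cstar_subalgebra_core] level[OF X(1)] lim])
  qed
  then show ?thesis
    unfolding unital_star_endo_def star_hom_def by (auto simp: lambda_simps lambda_1)
qed

lemma lambda_trace:
  assumes \<tau>: "normalized_trace n S \<tau>" and x: "x \<in> core n S"
  shows "\<tau> (\<Lambda> x) = \<tau> x"
proof -
  have \<Lambda>core: "\<Lambda> y \<in> core n S" if "y \<in> core n S" for y
    using lambda_core star_homD(1) that by (auto simp only: unital_star_endo_def)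
  note core = cstar_subalgebraD[OF cstar_subalgebra_core]
  have level: "\<tau> (\<Lambda> y) = \<tau> y" if y: "y \<in> (\<Union>k. core_level n S k)" for y
  proof -
    obtain l where l: "y \<in> core_level n S l" using y by blast
    obtain v where v: "v \<in> core n S" "adj v * v = 1" "\<Lambda> y = v * y * adj v"
      using lambda_core_level[of l] l by metis
    have yc: "y \<in> core n S" using l core_level_subset_core by blast
    have "\<tau> (\<Lambda> y) = \<tau> (v * (y * adj v))" by (simp add: v(3) mult.assoc)
    also have "\<dots> = \<tau> (y * adj v * v)" by (rule trace_commute[OF \<tau> v(1) core(4)[OF yc core(6)[OF v(1)]]])
    finally show ?thesis by (simp add: mult.assoc v(2))
  qed
  obtain X where X: "\<And>m. X m \<in> (\<Union>k. core_level n S k)" "X \<longlonglongrightarrow> x"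
    by (rule closure_sequentialE[OF x[unfolded core_def]], rule that)
  have Xc: "X m \<in> core n S" for m using X(1)[of m] core_level_subset_core by blast
  have lim: "(\<lambda>m. \<Lambda> (X m)) \<longlonglongrightarrow> \<Lambda> x"
    by (rule star_hom_tendsto[OF cstar_subalgebra_UNIV lambda_hom UNIV_I lambda_1 UNIV_I UNIV_I X(2)])
  have "(\<lambda>m. \<tau> (\<Lambda> (X m))) \<longlonglongrightarrow> \<tau> (\<Lambda> x)"
    by (rule trace_tendsto[OF \<tau> \<Lambda>core[OF x] \<Lambda>core[OF Xc] lim])
  then have "(\<lambda>m. \<tau> (X m)) \<longlonglongrightarrow> \<tau> (\<Lambda> x)" by (simp only: level[OF X(1)])
  moreover have "(\<lambda>m. \<tau> (X m)) \<longlonglongrightarrow> \<tau> x" by (rule trace_tendsto[OF \<tau> x Xc X(2)])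
  ultimately show ?thesis by (rule LIMSEQ_unique)
qed

end

end

subsection \<open>Automorphisms of the diagonal\<close>

locale diagonal_automorphism = cuntz_family +
  fixes \<alpha> :: "'a \<Rightarrow> 'a"
  assumes auto: "star_auto (diagonal n S) \<alpha>"
begin

definition \<beta> :: "'a \<Rightarrow> 'a" where "\<beta> = inv_into (diagonal n S) \<alpha>"

lemma \<alpha>_hom: "star_hom (diagonal n S) (diagonal n S) \<alpha>"
  and \<alpha>_bij: "bij_betw \<alpha> (diagonal n S) (diagonal n S)"
  using auto by (auto simp: star_auto_def)

lemma \<alpha>_\<beta>: "x \<in> diagonal n S \<Longrightarrow> \<alpha> (\<beta> x) = x"
  and \<beta>_\<alpha>: "x \<in> diagonal n S \<Longrightarrow> \<beta> (\<alpha> x) = x"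
  and \<beta>_diagonal: "x \<in> diagonal n S \<Longrightarrow> \<beta> x \<in> diagonal n S"
  using \<alpha>_bij unfolding \<beta>_def bij_betw_def by (auto simp: f_inv_into_f inv_into_into)

text \<open>Unitality is not part of \<open>star_auto\<close>; it comes from surjectivity, since
  \<open>\<alpha> 1\<close> is a unit for the range.\<close>

lemma \<alpha>_1: "\<alpha> 1 = 1"
  using star_homD(3)[OF \<alpha>_hom one_diagonal \<beta>_diagonal[OF one_diagonal]] \<alpha>_\<beta>[OF one_diagonal]
  by simp

lemma \<beta>_hom: "star_hom (diagonal n S) (diagonal n S) \<beta>"
proof -
  note D = cstar_subalgebraD[OF cstar_subalgebra_diagonal]
  note \<alpha> = star_homD[OF \<alpha>_hom]
  have eq: "\<beta> x = y" if "y \<in> diagonal n S" "x = \<alpha> y" for x y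
    using \<beta>_\<alpha> that by simp
  show ?thesis
    unfolding star_hom_def
    by (intro conjI ballI allI eq image_subsetI)
      (simp_all add: \<alpha> \<beta>_diagonal D \<alpha>_\<beta>)
qed

lemma \<beta>_1: "\<beta> 1 = 1"
  using \<beta>_\<alpha>[OF one_diagonal] \<alpha>_1 by simp

lemmas \<alpha>_alg = star_hom_alg_diagonal[OF \<alpha>_hom]
  and \<beta>_alg = star_hom_alg_diagonal[OF \<beta>_hom]

lemma alg_in_diagonal: "x \<in> alg_diagonal \<Longrightarrow> x \<in> diagonal n S"
  using alg_diagonal_subset by blast

lemmas \<alpha>_add = star_homD(2)[OF \<alpha>_hom alg_in_diagonal alg_in_diagonal]
  and \<alpha>_mult = star_homD(3)[OF \<alpha>_hom alg_in_diagonal alg_in_diagonal]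
  and \<alpha>_scaleC = star_homD(4)[OF \<alpha>_hom alg_in_diagonal]
  and \<beta>_add = star_homD(2)[OF \<beta>_hom alg_in_diagonal alg_in_diagonal]
  and \<beta>_mult = star_homD(3)[OF \<beta>_hom alg_in_diagonal alg_in_diagonal]
  and \<beta>_scaleC = star_homD(4)[OF \<beta>_hom alg_in_diagonal]

lemma \<alpha>_0: "\<alpha> 0 = 0" and \<beta>_0: "\<beta> 0 = 0"
  using star_hom_0[OF cstar_subalgebra_diagonal] \<alpha>_hom \<beta>_hom by blast+

lemma property_P_of_lambda:
  assumes \<Lambda>: "is_lambda n S u \<Lambda>" and unitary: "adj u * u = 1" "u * adj u = 1"
    and u: "u \<in> core_level n S K" and eq: "\<And>x. x \<in> diagonal n S \<Longrightarrow> \<alpha> x = \<Lambda> x"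
  shows "property_P n S \<beta>"
  unfolding property_P_def
proof (intro exI[of _ K] allI impI ballI)
  fix k x assume k: "K \<le> k" and "x \<in> diagonal_level n S 1"
  then have x: "x \<in> alg_diagonal" by (intro alg_diagonalI)
  \<comment> \<open>Under \<alpha> the claim becomes
    \<open>\<alpha> ((\<phi> ^^ l) y) = (\<phi> ^^ k) x\<close>. The unitary \<open>v\<close> below
    has level \<open>K + l = k\<close>, exactly the shift exponent past which it can be
    moved.\<close>
  define l where "l = k - K"
  define y where "y = \<beta> ((\<phi> ^^ K) x)"
  have y: "y \<in> alg_diagonal" unfolding y_def by (intro \<beta>_alg alg_diagonal_shift_pow x)
  have l: "(\<phi> ^^ l) y \<in> alg_diagonal" by (rule alg_diagonal_shift_pow[OF y])
  obtain v where v: "v \<in> core_level n S (K + l)" "v * adj v = 1"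
    "\<And>y. \<Lambda> ((\<phi> ^^ l) y) = v * (\<phi> ^^ l) (\<Lambda> y) * adj v"
    using lambda_shift_pow[OF \<Lambda> unitary u, of l] by metis
  have "\<Lambda> y = (\<phi> ^^ K) x"
    using eq[OF alg_in_diagonal[OF y]] \<alpha>_\<beta> alg_in_diagonal[OF alg_diagonal_shift_pow[OF x]] y_def by simp
  moreover have "(\<phi> ^^ l) ((\<phi> ^^ K) x) = (\<phi> ^^ (K + l)) x"
    using funpow_add[of l K \<phi>] by (simp add: add.commute)
  ultimately have "\<alpha> ((\<phi> ^^ l) y) = v * (\<phi> ^^ (K + l)) x * adj v"
    using eq[OF alg_in_diagonal[OF l]] v(3) by simp
  also have "\<dots> = (\<phi> ^^ (K + l)) x * (v * adj v)"
    using core_level_commute[OF v(1)] by (simp add: mult.assoc)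
  finally have "\<alpha> ((\<phi> ^^ l) y) = (\<phi> ^^ k) x" using v(2) k by (simp add: l_def)
  then show "\<beta> ((\<phi> ^^ k) x) = (\<phi> ^^ (k - K)) (\<beta> ((\<phi> ^^ K) x))"
    using \<beta>_\<alpha>[OF alg_in_diagonal[OF l]] by (simp add: l_def y_def)
qed

text \<open>The map \<open>\<gamma>\<close> is forced to be \<open>x \<mapsto> u x u\<^sup>*\<close> by \<open>\<alpha>(S\<^sub>i x S\<^sub>i\<^sup>*) = u S\<^sub>i \<alpha>(x) S\<^sub>i\<^sup>* u\<^sup>*\<close>.\<close>

definition \<theta> :: "'a \<Rightarrow> 'a" where
  "\<theta> y = (\<Sum>i=1..n. S i * \<beta> (adj (S i) * y * S i) * adj (S i))"

definition \<gamma> :: "'a \<Rightarrow> 'a" where "\<gamma> y = \<alpha> (\<theta> y)"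

section \<open>The map \<open>\<gamma>\<close> as an injective homomorphism on elements of finite
  level\<close>

lemma S_adj_S: "i \<in> {1..n} \<Longrightarrow> S i * adj (S i) \<in> alg_diagonal"
  using alg_diagonal_S[OF one_alg_diagonal] by simp

text \<open>Compression by an isometry is multiplicative here because the range projection commutes
  with the diagonal.\<close>

lemma compress_mult:
  assumes "x \<in> alg_diagonal" "y \<in> alg_diagonal" "i \<in> {1..n}"
  shows "adj (S i) * (x * y) * S i = (adj (S i) * x * S i) * (adj (S i) * y * S i)"
proof -
  have "(adj (S i) * x * S i) * (adj (S i) * y * S i) = adj (S i) * (x * (S i * adj (S i))) * (y * S i)"
    by (simp add: mult.assoc)
  also have "x * (S i * adj (S i)) = (S i * adj (S i)) * x"
    using assms S_adj_S by (intro alg_diagonal_commute)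
  finally show ?thesis by (simp add: mult.assoc adj_S_mult_S_left[OF assms(3) assms(3)])
qed

lemma block_mult:
  "(\<Sum>i=1..n. S i * a i * adj (S i)) * (\<Sum>i=1..n. S i * b i * adj (S i)) =
    (\<Sum>i=1..n. S i * (a i * b i) * adj (S i))"
proof -
  have "(S i * a i * adj (S i)) * (\<Sum>j=1..n. S j * b j * adj (S j)) = S i * (a i * b i) * adj (S i)"
    if i: "i \<in> {1..n}" for i
  proof -
    have "(S i * a i * adj (S i)) * (\<Sum>j=1..n. S j * b j * adj (S j)) =
        S i * a i * (\<Sum>j=1..n. adj (S i) * (S j * (b j * adj (S j))))"
      by (simp add: sum_distrib_left mult.assoc)
    also have "(\<Sum>j=1..n. adj (S i) * (S j * (b j * adj (S j)))) = (\<Sum>j=1..n. if j = i then b j * adj (S j) else 0)"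
      using i by (intro sum.cong) (auto simp: adj_S_mult_S_left)
    finally show ?thesis using i by (simp add: mult.assoc)
  qed
  then show ?thesis by (simp add: sum_distrib_right)
qed

lemma block_compress:
  assumes "i \<in> {1..n}"
  shows "adj (S i) * (\<Sum>j=1..n. S j * b j * adj (S j)) * S i = b i"
proof -
  have "adj (S i) * (\<Sum>j=1..n. S j * b j * adj (S j)) * S i =
      (\<Sum>j=1..n. adj (S i) * (S j * (b j * (adj (S j) * S i))))"
    by (simp add: sum_distrib_left sum_distrib_right mult.assoc)
  also have "\<dots> = (\<Sum>j=1..n. if j = i then b j else 0)"
    using assms by (intro sum.cong) (auto simp: adj_S_mult_S_left adj_S_mult_S)
  finally show ?thesis using assms by simp
qed

lemma block_decomposition:
  assumes "y \<in> alg_diagonal"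
  shows "(\<Sum>i=1..n. S i * (adj (S i) * y * S i) * adj (S i)) = y"
proof -
  have "S i * (adj (S i) * y * S i) * adj (S i) = S i * adj (S i) * y" if i: "i \<in> {1..n}" for i
  proof -
    have "S i * (adj (S i) * y * S i) * adj (S i) = S i * adj (S i) * (y * (S i * adj (S i)))"
      by (simp add: mult.assoc)
    also have "y * (S i * adj (S i)) = S i * adj (S i) * y"
      using assms i S_adj_S by (intro alg_diagonal_commute)
    finally show ?thesis using i by (simp add: mult.assoc adj_S_mult_S_left)
  qed
  then show ?thesis using sum_range_projections by (simp flip: sum_distrib_right)
qed

lemma \<theta>_alg: "y \<in> alg_diagonal \<Longrightarrow> \<theta> y \<in> alg_diagonal"
  unfolding \<theta>_def by (intro alg_diagonal_sum alg_diagonal_S \<beta>_alg alg_diagonal_adj_S)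

lemma \<gamma>_alg: "y \<in> alg_diagonal \<Longrightarrow> \<gamma> y \<in> alg_diagonal"
  unfolding \<gamma>_def by (intro \<alpha>_alg \<theta>_alg)

lemma \<gamma>_add:
  assumes "x \<in> alg_diagonal" "y \<in> alg_diagonal"
  shows "\<gamma> (x + y) = \<gamma> x + \<gamma> y"
proof -
  have "\<beta> (adj (S i) * (x + y) * S i) = \<beta> (adj (S i) * x * S i) + \<beta> (adj (S i) * y * S i)"
    if "i \<in> {1..n}" for i
    using \<beta>_add[OF alg_diagonal_adj_S[OF assms(1) that] alg_diagonal_adj_S[OF assms(2) that]]
    by (simp add: distrib_left distrib_right)
  then have "\<theta> (x + y) = \<theta> x + \<theta> y"
    by (simp add: \<theta>_def distrib_left distrib_right sum.distrib)
  then show ?thesis using \<alpha>_add \<theta>_alg assms by (simp add: \<gamma>_def)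
qed

lemma \<gamma>_scaleC:
  assumes "x \<in> alg_diagonal"
  shows "\<gamma> (c *\<^sub>C x) = c *\<^sub>C \<gamma> x"
proof -
  have "\<beta> (adj (S i) * (c *\<^sub>C x) * S i) = c *\<^sub>C \<beta> (adj (S i) * x * S i)" if "i \<in> {1..n}" for i
    using \<beta>_scaleC[OF alg_diagonal_adj_S[OF assms that]] by (simp add: scaleC_mult_left scaleC_mult_right)
  then have "\<theta> (c *\<^sub>C x) = c *\<^sub>C \<theta> x"
    by (simp add: \<theta>_def scaleC_mult_left scaleC_mult_right scaleC_sum_right)
  then show ?thesis using \<alpha>_scaleC \<theta>_alg assms by (simp add: \<gamma>_def)
qed

lemma \<gamma>_mult:
  assumes "x \<in> alg_diagonal" "y \<in> alg_diagonal"
  shows "\<gamma> (x * y) = \<gamma> x * \<gamma> y"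
proof -
  have eq: "\<beta> (adj (S i) * (x * y) * S i) = \<beta> (adj (S i) * x * S i) * \<beta> (adj (S i) * y * S i)"
    if "i \<in> {1..n}" for i
    unfolding compress_mult[OF assms that]
    by (rule \<beta>_mult[OF alg_diagonal_adj_S[OF assms(1) that] alg_diagonal_adj_S[OF assms(2) that]])
  have "\<theta> (x * y) = \<theta> x * \<theta> y"
    unfolding \<theta>_def block_mult by (rule sum.cong) (simp_all only: eq)
  then show ?thesis using \<alpha>_mult \<theta>_alg assms by (simp add: \<gamma>_def)
qed

lemma \<gamma>_1: "\<gamma> 1 = 1"
proof -
  have "\<theta> 1 = (\<Sum>i=1..n. S i * adj (S i))"
    unfolding \<theta>_def by (intro sum.cong) (simp_all add: isometry \<beta>_1)
  then show ?thesis using sum_range_projections \<alpha>_1 by (simp add: \<gamma>_def)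
qed

text \<open>\<alpha> and \<beta> are injective, and the blocks \<open>adj (S i) * y * S i\<close>
  determine \<open>y\<close>. Injectivity keeps the images of the \<open>Pw \<mu>\<close> nonzero
  when \<open>\<gamma>\<close> is shown to permute them.\<close>

lemma \<gamma>_eq_0:
  assumes y: "y \<in> alg_diagonal" and 0: "\<gamma> y = 0"
  shows "y = 0"
proof -
  have "\<theta> y = 0"
    using \<beta>_\<alpha>[OF alg_in_diagonal[OF \<theta>_alg[OF y]]] 0 \<beta>_0 by (simp add: \<gamma>_def)
  then have "adj (S i) * y * S i = 0" if i: "i \<in> {1..n}" for i
    using block_compress[OF i, of "\<lambda>j. \<beta> (adj (S j) * y * S j)"] \<alpha>_0
      \<alpha>_\<beta>[OF alg_in_diagonal[OF alg_diagonal_adj_S[OF y i]]] by (simp add: \<theta>_def)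
  then show ?thesis using block_decomposition[OF y] by simp
qed

lemma \<gamma>_sum:
  assumes "\<And>i. i \<in> I \<Longrightarrow> g i \<in> alg_diagonal"
  shows "\<gamma> (sum g I) = (\<Sum>i\<in>I. \<gamma> (g i))"
proof -
  have "\<gamma> 0 = 0" using \<gamma>_scaleC[OF one_alg_diagonal, of 0] by simp
  with assms show ?thesis
  proof (induction I rule: infinite_finite_induct)
    case (insert i I)
    then show ?case using \<gamma>_add[of "g i" "sum g I"] alg_diagonal_sum[of I g] by simp
  qed simp_all
qed

text \<open>Under property (P), \<open>\<gamma>\<close> changes only the first \<open>m + 1\<close> letters.\<close>

lemma \<gamma>_shift_pow_letter:
  assumes P: "\<And>k x. k \<ge> m \<Longrightarrow> x \<in> diagonal_level n S 1 \<Longrightarrow>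
      \<beta> ((\<phi> ^^ k) x) = (\<phi> ^^ (k - m)) (\<beta> ((\<phi> ^^ m) x))"
    and k: "k \<ge> Suc m" and x: "x \<in> diagonal_level n S 1"
  shows "\<gamma> ((\<phi> ^^ k) x) = (\<phi> ^^ k) x"
proof -
  \<comment> \<open>The compressions in \<open>\<theta>\<close> use up one shift, and (P) must still
    apply to the remaining \<open>k - 1\<close>; hence \<open>k \<ge> Suc m\<close>.\<close>
  obtain l where l: "k = Suc l" "l \<ge> m" using k by (cases k) auto
  have "adj (S i) * \<phi> z * S i = z" if "i \<in> {1..n}" for z i
    using that by (simp add: adj_S_mult_shift isometry mult.assoc)
  then have "\<theta> ((\<phi> ^^ k) x) = \<phi> (\<beta> ((\<phi> ^^ l) x))"
    unfolding \<theta>_def by (simp add: l shift_def[of n S "\<beta> _"])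
  \<comment> \<open>(P) is used at exponent \<open>l\<close> here and at exponent \<open>k\<close>
    in the next step; together they show that \<open>\<theta>\<close> and \<beta> agree on
    \<open>(\<phi> ^^ k) x\<close>.\<close>
  also have "\<dots> = (\<phi> ^^ (k - m)) (\<beta> ((\<phi> ^^ m) x))"
    using P[OF l(2) x] l by (simp add: Suc_diff_le)
  also have "\<dots> = \<beta> ((\<phi> ^^ k) x)" using P[of k, OF _ x] k by simp
  finally show ?thesis
    using \<alpha>_\<beta>[OF alg_in_diagonal[OF alg_diagonal_shift_pow[OF alg_diagonalI[OF x]]]] by (simp add: \<gamma>_def)
qed

text \<open>The projection of a word is a product of shifted one-letter projections with exponents
  at least \<open>k\<close>, so multiplicativity of \<open>\<gamma>\<close> reduces the claim to
  single letters.\<close>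

lemma \<gamma>_shift_pow_word:
  assumes P: "\<And>k x. k \<ge> m \<Longrightarrow> x \<in> diagonal_level n S 1 \<Longrightarrow>
      \<beta> ((\<phi> ^^ k) x) = (\<phi> ^^ (k - m)) (\<beta> ((\<phi> ^^ m) x))"
    and "k \<ge> Suc m" "\<nu> \<in> words n l"
  shows "\<gamma> ((\<phi> ^^ k) (Pw \<nu>)) = (\<phi> ^^ k) (Pw \<nu>)"
  using assms(2,3)
proof (induction l arbitrary: k \<nu>)
  case 0
  then show ?case by (simp add: shift_pow_1 \<gamma>_1)
next
  case (Suc l)
  obtain i \<nu>' where eq: "\<nu> = i # \<nu>'" and m: "i \<in> {1..n}" "\<nu>' \<in> words n l"
    using Suc.prems(2) by (meson words_SucE)
  have i: "[i] \<in> words n 1" using m by (auto simp: words_def)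
  have "Pw \<nu> = Pw [i] * \<phi> (Pw \<nu>')" using Pw_append[OF i, of \<nu>'] by (simp add: eq)
  then have split: "(\<phi> ^^ k) (Pw \<nu>) = (\<phi> ^^ k) (Pw [i]) * (\<phi> ^^ Suc k) (Pw \<nu>')"
    by (simp add: shift_pow_mult funpow_swap1)
  have "\<gamma> ((\<phi> ^^ k) (Pw \<nu>)) = \<gamma> ((\<phi> ^^ k) (Pw [i])) * \<gamma> ((\<phi> ^^ Suc k) (Pw \<nu>'))"
    unfolding split
    by (intro \<gamma>_mult alg_diagonal_shift_pow Pw_alg_diagonal[OF i] Pw_alg_diagonal[OF m(2)])
  also have "\<gamma> ((\<phi> ^^ k) (Pw [i])) = (\<phi> ^^ k) (Pw [i])"
    by (rule \<gamma>_shift_pow_letter[OF P Suc.prems(1) Pw_diagonal_level[OF i]])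
  also have "\<gamma> ((\<phi> ^^ Suc k) (Pw \<nu>')) = (\<phi> ^^ Suc k) (Pw \<nu>')"
    using Suc.prems(1) by (intro Suc.IH m(2)) simp
  finally show ?case unfolding split .
qed

lemma \<gamma>_inner:
  assumes "property_P n S \<beta>"
  obtains K \<sigma> u where "bij_betw \<sigma> (words n K) (words n K)"
    "u = (\<Sum>\<mu>\<in>words n K. Sw (\<sigma> \<mu>) * adj (Sw \<mu>))"
    "\<And>y. y \<in> alg_diagonal \<Longrightarrow> \<gamma> y = u * y * adj u"
proof -
  obtain m where P: "\<And>k x. k \<ge> m \<Longrightarrow> x \<in> diagonal_level n S 1 \<Longrightarrow>
      \<beta> ((\<phi> ^^ k) x) = (\<phi> ^^ (k - m)) (\<beta> ((\<phi> ^^ m) x))"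
    using assms unfolding property_P_def by blast
  have "\<gamma> ` Pw ` words n (Suc m) \<subseteq> alg_diagonal"
    using \<gamma>_alg Pw_alg_diagonal by blast
  then obtain k where k: "\<gamma> ` Pw ` words n (Suc m) \<subseteq> diagonal_level n S k"
    by (rule alg_diagonal_finite_level[rotated]) auto
  \<comment> \<open>The first \<open>Suc m\<close> letters are sent into level \<open>k\<close>, and
    the \<open>k\<close> further letters are fixed by \<open>\<gamma>\<close>; both factors lie in
    level \<open>Suc m + k\<close>, which is therefore mapped into itself.\<close>
  define K where "K = Suc m + k"
  let ?W = "words n K"
  have level: "\<gamma> (Pw \<mu>) \<in> diagonal_level n S K" if "\<mu> \<in> ?W" for \<mu>
  proof -
    obtain \<mu>1 \<mu>2 where eq: "\<mu> = \<mu>1 @ \<mu>2" and w: "\<mu>1 \<in> words n (Suc m)" "\<mu>2 \<in> words n k"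
      using \<open>\<mu> \<in> ?W\<close> unfolding K_def by (meson words_appendE)
    have "\<gamma> (Pw \<mu>) = \<gamma> (Pw \<mu>1) * \<gamma> ((\<phi> ^^ Suc m) (Pw \<mu>2))"
      unfolding eq Pw_append[OF w(1)]
      by (intro \<gamma>_mult alg_diagonal_shift_pow Pw_alg_diagonal[OF w(1)] Pw_alg_diagonal[OF w(2)])
    also have "\<gamma> ((\<phi> ^^ Suc m) (Pw \<mu>2)) = (\<phi> ^^ Suc m) (Pw \<mu>2)"
      by (rule \<gamma>_shift_pow_word[OF P order_refl w(2)])
    finally have "\<gamma> (Pw \<mu>) = \<gamma> (Pw \<mu>1) * (\<phi> ^^ Suc m) (Pw \<mu>2)" .
    moreover have "\<gamma> (Pw \<mu>1) \<in> diagonal_level n S (k + Suc m)"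
      using k w(1) by (intro diagonal_level_mono) blast
    moreover have "(\<phi> ^^ Suc m) (Pw \<mu>2) \<in> diagonal_level n S (Suc m + k)"
      by (rule diagonal_level_shift_pow[OF Pw_diagonal_level[OF w(2)]])
    ultimately show ?thesis
      unfolding K_def by (simp only: add.commute[of k "Suc m"] diagonal_level_mult)
  qed
  have \<gamma>P: "\<gamma> (Pw \<mu>) * \<gamma> (Pw \<nu>) = (if \<mu> = \<nu> then \<gamma> (Pw \<mu>) else 0)" if "\<mu> \<in> ?W" "\<nu> \<in> ?W" for \<mu> \<nu>
    using \<gamma>_mult[OF Pw_alg_diagonal[OF that(1)] Pw_alg_diagonal[OF that(2)]] Pw_mult_Pw[OF that]
      \<gamma>_scaleC[OF one_alg_diagonal, of 0] by (auto split: if_splits)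
  \<comment> \<open>A nonzero projection of level \<open>K\<close> dominates some minimal projection
    \<open>Pw \<kappa>\<close>: each of its coefficients satisfies c * c = c, and not all are
    0.\<close>
  have "\<exists>\<kappa>\<in>?W. \<gamma> (Pw \<mu>) * Pw \<kappa> = Pw \<kappa>" if \<mu>: "\<mu> \<in> ?W" for \<mu>
  proof (rule ccontr)
    assume none: "\<not> (\<exists>\<kappa>\<in>?W. \<gamma> (Pw \<mu>) * Pw \<kappa> = Pw \<kappa>)"
    have "\<gamma> (Pw \<mu>) * Pw \<kappa> = 0" if \<kappa>: "\<kappa> \<in> ?W" for \<kappa>
    proof -
      obtain c where c: "\<gamma> (Pw \<mu>) * Pw \<kappa> = c *\<^sub>C Pw \<kappa>"
        using level[OF \<mu>] \<kappa> unfolding diagonal_level_iff by blast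
      have "c *\<^sub>C Pw \<kappa> = \<gamma> (Pw \<mu>) * \<gamma> (Pw \<mu>) * Pw \<kappa>" using \<gamma>P[OF \<mu> \<mu>] c by simp
      also have "\<dots> = (c * c) *\<^sub>C Pw \<kappa>" by (simp add: mult.assoc c scaleC_mult_right scaleC_scaleC)
      finally have "(c * c + (- 1) * c) *\<^sub>C Pw \<kappa> = 0"
        by (simp only: scaleC_add_left scaleC_scaleC[symmetric] scaleC_minus1_left) simp
      then have "cmod (c * c + (- 1) * c) * norm (Pw \<kappa>) = 0" by (metis norm_scaleC norm_zero)
      then have "c * (c - 1) = 0" using Pw_nonzero[OF \<kappa>] by (simp add: algebra_simps)
      then show ?thesis using none c \<kappa> by auto
    qed
    then have "\<gamma> (Pw \<mu>) = 0" using sum_Pw_right[of "\<gamma> (Pw \<mu>)" K] by simp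
    then show False using \<gamma>_eq_0[OF Pw_alg_diagonal[OF \<mu>]] Pw_nonzero[OF \<mu>] by blast
  qed
  \<comment> \<open>One minimal projection is chosen below each image. Images of distinct words are
    orthogonal, so the choice is injective and, on a finite set, bijective; nothing is left over,
    and each image is minimal itself.\<close>
  then obtain \<sigma> where \<sigma>: "\<And>\<mu>. \<mu> \<in> ?W \<Longrightarrow> \<sigma> \<mu> \<in> ?W" "\<And>\<mu>. \<mu> \<in> ?W \<Longrightarrow> \<gamma> (Pw \<mu>) * Pw (\<sigma> \<mu>) = Pw (\<sigma> \<mu>)"
    by metis
  have off: "\<gamma> (Pw \<mu>) * Pw (\<sigma> \<nu>) = 0" if "\<mu> \<in> ?W" "\<nu> \<in> ?W" "\<mu> \<noteq> \<nu>" for \<mu> \<nu>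
  proof -
    have "\<gamma> (Pw \<mu>) * Pw (\<sigma> \<nu>) = \<gamma> (Pw \<mu>) * \<gamma> (Pw \<nu>) * Pw (\<sigma> \<nu>)" using \<sigma>(2)[OF that(2)] by (simp add: mult.assoc)
    then show ?thesis using \<gamma>P[OF that(1,2)] that by simp
  qed
  have "inj_on \<sigma> ?W"
  proof (rule inj_onI, rule ccontr)
    fix \<mu> \<nu> assume "\<mu> \<in> ?W" "\<nu> \<in> ?W" "\<sigma> \<mu> = \<sigma> \<nu>" "\<mu> \<noteq> \<nu>"
    then show False using off[of \<mu> \<nu>] \<sigma> Pw_nonzero by metis
  qed
  moreover have "\<sigma> ` ?W = ?W" using \<sigma>(1) \<open>inj_on \<sigma> ?W\<close> by (intro endo_inj_surj) auto
  ultimately have bij: "bij_betw \<sigma> ?W ?W" by (simp add: bij_betw_def)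
  have \<gamma>\<sigma>: "\<gamma> (Pw \<mu>) = Pw (\<sigma> \<mu>)" if \<mu>: "\<mu> \<in> ?W" for \<mu>
  proof -
    have "\<gamma> (Pw \<mu>) = (\<Sum>\<kappa>\<in>?W. \<gamma> (Pw \<mu>) * Pw \<kappa>)" by (simp add: sum_Pw_right)
    also have "\<dots> = (\<Sum>\<nu>\<in>?W. \<gamma> (Pw \<mu>) * Pw (\<sigma> \<nu>))" by (rule sum.reindex_bij_betw[OF bij, symmetric])
    also have "\<dots> = (\<Sum>\<nu>\<in>?W. if \<nu> = \<mu> then Pw (\<sigma> \<nu>) else 0)"
      using \<mu> off \<sigma>(2) by (intro sum.cong) auto
    finally show ?thesis using \<mu> by simp
  qed
  define u where "u = (\<Sum>\<mu>\<in>words n K. Sw (\<sigma> \<mu>) * adj (Sw \<mu>))"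
  note u = permutation_unitary[OF bij u_def]
  have "\<gamma> y = u * y * adj u" if yA: "y \<in> alg_diagonal" for y
  proof -
    obtain l where "y \<in> diagonal_level n S l" using yA by (auto simp: alg_diagonal_def)
    then have "y \<in> diagonal_level n S (K + l)" using diagonal_level_mono[of y l K] by (simp add: add.commute)
    then obtain c where y: "y = (\<Sum>\<kappa>\<in>words n (K + l). c \<kappa> *\<^sub>C Pw \<kappa>)" by (auto simp: diagonal_level_def)
    \<comment> \<open>Beyond level \<open>K\<close> the tail is fixed by \<open>\<gamma>\<close>,
      since \<open>K \<ge> Suc m\<close>, and \<open>u\<close> likewise changes only the first
      \<open>K\<close> letters.\<close>
    have \<gamma>\<kappa>: "\<gamma> (c \<kappa> *\<^sub>C Pw \<kappa>) = u * (c \<kappa> *\<^sub>C Pw \<kappa>) * adj u" if \<kappa>: "\<kappa> \<in> words n (K + l)" for \<kappa>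
    proof -
      obtain \<mu> \<nu> where eq: "\<kappa> = \<mu> @ \<nu>" and w: "\<mu> \<in> ?W" "\<nu> \<in> words n l"
        using \<kappa> by (meson words_appendE)
      have K: "K \<ge> Suc m" by (simp add: K_def)
      have "\<gamma> (Pw \<kappa>) = \<gamma> (Pw \<mu>) * \<gamma> ((\<phi> ^^ K) (Pw \<nu>))"
        unfolding eq Pw_append[OF w(1)]
        by (intro \<gamma>_mult alg_diagonal_shift_pow Pw_alg_diagonal[OF w(1)] Pw_alg_diagonal[OF w(2)])
      also have "\<dots> = Pw (\<sigma> \<mu>) * (\<phi> ^^ K) (Pw \<nu>)"
        using \<gamma>_shift_pow_word[OF P K w(2)] \<gamma>\<sigma>[OF w(1)] by simp
      also have "\<dots> = (u * Sw \<mu>) * Pw \<nu> * adj (u * Sw \<mu>)"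
        using Pw_mult_shift_pow[OF \<sigma>(1)[OF w(1)]] u(4)[OF w(1)] by simp
      also have "\<dots> = u * Pw \<kappa> * adj u"
        by (simp add: eq P_word_append adj_mult mult.assoc)
      finally show ?thesis
        using \<gamma>_scaleC[OF Pw_alg_diagonal[OF \<kappa>]] by (simp add: scaleC_mult_left scaleC_mult_right)
    qed
    have "\<gamma> y = (\<Sum>\<kappa>\<in>words n (K + l). \<gamma> (c \<kappa> *\<^sub>C Pw \<kappa>))"
      unfolding y by (intro \<gamma>_sum alg_diagonal_scaleC Pw_alg_diagonal)
    also have "\<dots> = u * y * adj u" by (simp add: \<gamma>\<kappa> y sum_distrib_left sum_distrib_right)
    finally show ?thesis .
  qed
  with bij u_def that show ?thesis by blast
qed

text \<open>Knowing \<open>\<gamma>\<close> gives a recursion that adds a first letter: \<alpha> on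
  a word is determined by \<open>u\<close> and \<alpha> on the tail. \<open>\<Lambda>\<close>
  satisfies the same recursion, and density does the rest.\<close>

lemma eq_lambda:
  assumes \<Lambda>: "is_lambda n S u \<Lambda>" and \<gamma>: "\<And>y. y \<in> alg_diagonal \<Longrightarrow> \<gamma> y = u * y * adj u"
    and x: "x \<in> diagonal n S"
  shows "\<alpha> x = \<Lambda> x"
proof -
  have hom: "star_hom UNIV UNIV \<Lambda>" and \<Lambda>1: "\<Lambda> 1 = 1"
    and \<Lambda>S: "\<And>i. i \<in> {1..n} \<Longrightarrow> \<Lambda> (S i) = u * S i"
    using \<Lambda> by (auto simp: is_lambda_def unital_star_endo_def)
  have P: "\<alpha> (Pw \<mu>) = \<Lambda> (Pw \<mu>)" if "\<mu> \<in> words n k" for \<mu> k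
    using that
  proof (induction k arbitrary: \<mu>)
    case 0
    then show ?case by (simp add: \<alpha>_1 \<Lambda>1)
  next
    case (Suc k)
    obtain i \<nu> where eq: "\<mu> = i # \<nu>" and m: "i \<in> {1..n}" "\<nu> \<in> words n k"
      using Suc.prems by (meson words_SucE)
    \<comment> \<open>Chosen so that \<open>\<theta> y = Pw \<mu>\<close>: the \<beta> inside
      \<open>\<theta>\<close> undoes \<alpha> on the tail.\<close>
    define y where "y = S i * \<alpha> (Pw \<nu>) * adj (S i)"
    have A: "\<alpha> (Pw \<nu>) \<in> alg_diagonal" by (rule \<alpha>_alg[OF Pw_alg_diagonal[OF m(2)]])
    have y: "y \<in> alg_diagonal" unfolding y_def by (rule alg_diagonal_S[OF A m(1)])
    have "S j * \<beta> (adj (S j) * y * S j) * adj (S j) = (if j = i then Pw \<mu> else 0)" if j: "j \<in> {1..n}" for j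
    proof -
      have "adj (S j) * y * S j = adj (S j) * (S i * (\<alpha> (Pw \<nu>) * (adj (S i) * S j)))"
        by (simp add: y_def mult.assoc)
      also have "\<dots> = (if j = i then \<alpha> (Pw \<nu>) else 0)"
        using j m by (auto simp: adj_S_mult_S_left isometry)
      finally show ?thesis
        using \<beta>_\<alpha>[OF alg_in_diagonal[OF Pw_alg_diagonal[OF m(2)]]] by (simp add: \<beta>_0 eq P_word_Cons)
    qed
    then have "\<theta> y = Pw \<mu>" using m by (simp add: \<theta>_def)
    then have "\<alpha> (Pw \<mu>) = u * y * adj u" using \<gamma>[OF y] by (simp add: \<gamma>_def)
    also have "\<dots> = \<Lambda> (Pw \<mu>)"
      using m Suc.IH[OF m(2)]
      by (simp add: y_def eq P_word_Cons star_homD[OF hom] \<Lambda>S adj_mult mult.assoc)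
    finally show ?case .
  qed
  have alg: "\<alpha> y = \<Lambda> y" if y: "y \<in> alg_diagonal" for y
  proof -
    obtain k c where yc: "y = (\<Sum>\<mu>\<in>words n k. c \<mu> *\<^sub>C Pw \<mu>)"
      using y by (auto simp: alg_diagonal_def diagonal_level_def)
    have "\<alpha> y = (\<Sum>\<mu>\<in>words n k. \<alpha> (c \<mu> *\<^sub>C Pw \<mu>))"
      unfolding yc by (intro star_hom_sum[OF cstar_subalgebra_diagonal \<alpha>_hom] alg_in_diagonal
          alg_diagonal_scaleC Pw_alg_diagonal)
    also have "\<dots> = (\<Sum>\<mu>\<in>words n k. \<Lambda> (c \<mu> *\<^sub>C Pw \<mu>))"
    proof (rule sum.cong[OF refl])
      fix \<mu> assume \<mu>: "\<mu> \<in> words n k"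
      show "\<alpha> (c \<mu> *\<^sub>C Pw \<mu>) = \<Lambda> (c \<mu> *\<^sub>C Pw \<mu>)"
        by (simp add: \<alpha>_scaleC[OF Pw_alg_diagonal[OF \<mu>]] P[OF \<mu>] star_homD[OF hom])
    qed
    also have "\<dots> = \<Lambda> y"
      unfolding yc by (rule star_hom_sum[OF cstar_subalgebra_UNIV hom, symmetric]) simp
    finally show ?thesis .
  qed
  obtain X where X: "\<And>m. X m \<in> alg_diagonal" "X \<longlonglongrightarrow> x"
    by (rule closure_sequentialE[OF x[unfolded diagonal_eq]], rule that)
  have "(\<lambda>m. \<alpha> (X m)) \<longlonglongrightarrow> \<alpha> x"
    by (rule star_hom_tendsto[OF cstar_subalgebra_diagonal \<alpha>_hom one_diagonal \<alpha>_1 x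
          alg_in_diagonal[OF X(1)] X(2)])
  then have "(\<lambda>m. \<Lambda> (X m)) \<longlonglongrightarrow> \<alpha> x" by (simp only: alg[OF X(1)])
  moreover have "(\<lambda>m. \<Lambda> (X m)) \<longlonglongrightarrow> \<Lambda> x"
    by (rule star_hom_tendsto[OF cstar_subalgebra_UNIV hom UNIV_I \<Lambda>1 UNIV_I UNIV_I X(2)])
  ultimately show ?thesis by (rule LIMSEQ_unique)
qed

end

theorem theorem3p4:
  fixes n :: nat and S :: "nat \<Rightarrow> 'a::cstar_algebra" and \<alpha> :: "'a \<Rightarrow> 'a"
  assumes "n \<ge> 2"
    and "cuntz_algebra n S"
    and "star_auto (diagonal n S) \<alpha>"
  shows "(property_P n S (inv_into (diagonal n S) \<alpha>) \<longleftrightarrow>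
            (\<exists>u\<in>perm_unitaries n S. \<exists>\<Lambda>. is_lambda n S u \<Lambda> \<and> (\<forall>x\<in>diagonal n S. \<alpha> x = \<Lambda> x))) \<and>
         (property_P n S (inv_into (diagonal n S) \<alpha>) \<longrightarrow>
            (\<exists>\<beta>. unital_star_endo (core n S) \<beta> \<and> (\<forall>x\<in>diagonal n S. \<beta> x = \<alpha> x)) \<and>
            (\<forall>\<tau>. normalized_trace n S \<tau> \<longrightarrow>
               (\<forall>x\<in>diagonal n S. \<tau> (\<alpha> x) = \<tau> x \<and> \<tau> (inv_into (diagonal n S) \<alpha> x) = \<tau> x)))"
proof -
  interpret diagonal_automorphism n S \<alpha>
    by (rule diagonal_automorphism.intro[OF cuntz_family_of_algebra[OF assms(2)]
          diagonal_automorphism_axioms.intro[OF assms(3)]])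
  have perm: "\<exists>K. adj u * u = 1 \<and> u * adj u = 1 \<and> u \<in> core_level n S K" if "u \<in> perm_unitaries n S" for u
    using that permutation_unitary(1-3) unfolding perm_unitaries_def by blast
  have "\<exists>u\<in>perm_unitaries n S. \<exists>\<Lambda>. is_lambda n S u \<Lambda> \<and> (\<forall>x\<in>diagonal n S. \<alpha> x = \<Lambda> x)"
    if P: "property_P n S \<beta>"
  proof -
    obtain K \<sigma> u where bij: "bij_betw \<sigma> (words n K) (words n K)"
      and u: "u = (\<Sum>\<mu>\<in>words n K. S_word S (\<sigma> \<mu>) * adj (S_word S \<mu>))"
      and \<gamma>: "\<And>y. y \<in> alg_diagonal \<Longrightarrow> \<gamma> y = u * y * adj u"
      by (rule \<gamma>_inner[OF P], rule that)
    obtain \<Lambda> where "star_hom UNIV UNIV \<Lambda>" "\<Lambda> 1 = 1" "\<And>i. i \<in> {1..n} \<Longrightarrow> \<Lambda> (S i) = u * S i"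
      by (rule cuntz_universal_property[OF assms(1,2)
            cuntz_family_unitary[OF permutation_unitary(1,2)[OF bij u]]], rule that)
    then have "is_lambda n S u \<Lambda>" by (simp add: is_lambda_def unital_star_endo_def)
    moreover have "u \<in> perm_unitaries n S" using bij u unfolding perm_unitaries_def by blast
    ultimately show ?thesis using eq_lambda \<gamma> by blast
  qed
  \<comment> \<open>Extension and trace invariance are obtained from condition (2); the implication
    just proved transfers them to the hypothesis (P).\<close>
  moreover have "property_P n S \<beta>"
    "\<exists>\<beta>'. unital_star_endo (core n S) \<beta>' \<and> (\<forall>x\<in>diagonal n S. \<beta>' x = \<alpha> x)"
    "\<forall>\<tau>. normalized_trace n S \<tau> \<longrightarrow> (\<forall>x\<in>diagonal n S. \<tau> (\<alpha> x) = \<tau> x \<and> \<tau> (\<beta> x) = \<tau> x)"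
    if u: "u \<in> perm_unitaries n S" and \<Lambda>: "is_lambda n S u \<Lambda>"
      and eq: "\<And>x. x \<in> diagonal n S \<Longrightarrow> \<alpha> x = \<Lambda> x" for u \<Lambda>
  proof -
    obtain K where K: "adj u * u = 1" "u * adj u = 1" "u \<in> core_level n S K" using perm[OF u] by blast
    show "property_P n S \<beta>" by (rule property_P_of_lambda[OF \<Lambda> K eq])
    show "\<exists>\<beta>'. unital_star_endo (core n S) \<beta>' \<and> (\<forall>x\<in>diagonal n S. \<beta>' x = \<alpha> x)"
      using lambda_core[OF \<Lambda> K] eq by (intro exI[of _ \<Lambda>]) simp
    have tr: "\<tau> (\<alpha> x) = \<tau> x" if "normalized_trace n S \<tau>" "x \<in> diagonal n S" for \<tau> x
      using lambda_trace[OF \<Lambda> K that(1)] diagonal_subset_core that(2) eq by fastforce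
    show "\<forall>\<tau>. normalized_trace n S \<tau> \<longrightarrow> (\<forall>x\<in>diagonal n S. \<tau> (\<alpha> x) = \<tau> x \<and> \<tau> (\<beta> x) = \<tau> x)"
      \<comment> \<open>Invariance under \<beta> at \<open>x\<close> is invariance under \<alpha> at
        \<open>\<beta> x\<close>.\<close>
      using tr \<alpha>_\<beta> \<beta>_diagonal by metis
  qed
  ultimately show ?thesis unfolding \<beta>_def by blast
qed

end
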